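(* Let $\mathcal{F}$ be an ordinary differential field of characteristic $0$, let $u$ be differentially transcendental over $\mathcal{F}$, and let $\mathcal{G} := \mathcal{F}\langle P_1(u)/Q_1(u), \dots, P_n(u)/Q_n(u)\rangle$, where for every $1\le j\le n$, $P_j, Q_j\in \mathcal{F}\{u\}$ are relatively prime differential polynomials of order at most $e\ge 1$ (i.e. at least one derivative of $u$ occurs in $P_j$ or $Q_j$ for some $j$) and of total degree bounded by $d$, such that $P_j/Q_j\notin \mathcal{F}$ for every $1\le j\le n$. Then any Lüroth generator $v$ of $\mathcal{F}\subset\mathcal{G}$ (i.e. any $v\in\mathcal{G}$ with $\mathcal{G}=\mathcal{F}\langle v\rangle$) can be written as the quotient of two relatively prime differential polynomials $P(u), Q(u)\in\mathcal{F}\{u\}$ with order bounded by $\min\{\mathrm{ord}(P_j/Q_j) : 1\le j\le n\}$ and total degree bounded by $\min\{(d+1)^{(e+1)n},\ (nd(e+1)+1)^{2e+1}\}$.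
   Context: An ordinary differential field is a field equipped with one derivation $\delta$. An element $u$ of a differential extension is differentially transcendental over $\mathcal{F}$ if $u, u^{(1)}, u^{(2)},\dots$ (its successive derivatives) are algebraically independent over $\mathcal{F}$. $\mathcal{F}\{u\}$ is the ring of differential polynomials $\mathcal{F}[u^{(p)} : p\in\mathbb{N}_0]$, with the derivation extending that of $\mathcal{F}$ by $\delta(u^{(i)})=u^{(i+1)}$; it is a polynomial ring in infinitely many variables, and "relatively prime" and "total degree" are understood in this polynomial ring. $\mathcal{F}\langle u\rangle$ is its fraction field, with the induced derivation. For a subset $S$ of $\mathcal{F}\langle u\rangle$, $\mathcal{F}\langle S\rangle$ denotes the smallest differential subfield containing $\mathcal{F}$ and $S$. The order of a differential polynomial $g\in\mathcal{F}\{u\}$ is $\mathrm{ord}(g)=\max\{i : u^{(i)} \text{ appears in } g\}$, and the order of an element of $\mathcal{F}\langle u\rangle$ is the maximum of the orders of the numerator and denominator in a reduced representation of it as a fraction. *)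

theory Defs
  imports Complex_Main "HOL-Library.Poly_Mapping"
begin

definition is_derivation :: "('a::comm_ring_1 \<Rightarrow> 'a) \<Rightarrow> bool" where
  "is_derivation \<delta> \<longleftrightarrow>
     (\<forall>x y. \<delta> (x + y) = \<delta> x + \<delta> y) \<and> (\<forall>x y. \<delta> (x * y) = \<delta> x * y + x * \<delta> y)"

text \<open>
  A differential extension of the differential field \<open>('a, \<delta>)\<close> is a differential field
  \<open>('b, \<Delta>)\<close> together with a homomorphism \<open>\<iota>\<close> of differential fields (necessarily injective).
  The base field, viewed inside the extension, is \<open>range \<iota>\<close>.
\<close>

definition differential_extension ::
    "('a::field \<Rightarrow> 'a) \<Rightarrow> ('b::field \<Rightarrow> 'b) \<Rightarrow> ('a \<Rightarrow> 'b) \<Rightarrow> bool" where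
  "differential_extension \<delta> \<Delta> \<iota> \<longleftrightarrow>
     is_derivation \<delta> \<and> is_derivation \<Delta> \<and>
     \<iota> 1 = 1 \<and> (\<forall>x y. \<iota> (x + y) = \<iota> x + \<iota> y) \<and> (\<forall>x y. \<iota> (x * y) = \<iota> x * \<iota> y) \<and>
     (\<forall>x. \<Delta> (\<iota> x) = \<iota> (\<delta> x))"

definition differential_subfield :: "('b::field \<Rightarrow> 'b) \<Rightarrow> 'b set \<Rightarrow> bool" where
  "differential_subfield \<Delta> K \<longleftrightarrow>
     0 \<in> K \<and> 1 \<in> K \<and>
     (\<forall>x\<in>K. \<forall>y\<in>K. x + y \<in> K \<and> x - y \<in> K \<and> x * y \<in> K) \<and>
     (\<forall>x\<in>K. inverse x \<in> K) \<and> (\<forall>x\<in>K. \<Delta> x \<in> K)"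

definition diff_field_adjoin :: "('b::field \<Rightarrow> 'b) \<Rightarrow> ('a \<Rightarrow> 'b) \<Rightarrow> 'b set \<Rightarrow> 'b set" where
  "diff_field_adjoin \<Delta> \<iota> S = \<Inter> {K. differential_subfield \<Delta> K \<and> range \<iota> \<subseteq> K \<and> S \<subseteq> K}"

text \<open>
  Polynomials over \<open>'a\<close> in the variables with index \<open>0, 1, 2, \<dots>\<close>; the variable with index \<open>i\<close>
  stands for the \<open>i\<close>-th derivative of \<open>u\<close>.  A monomial is its finitely supported exponent vector.
\<close>

type_synonym 'a diff_poly = "(nat \<Rightarrow>\<^sub>0 nat) \<Rightarrow>\<^sub>0 'a"

definition poly_eval :: "('a::zero \<Rightarrow> 'b::comm_semiring_1) \<Rightarrow> (nat \<Rightarrow> 'b) \<Rightarrow> 'a diff_poly \<Rightarrow> 'b" where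
  "poly_eval \<iota> x p =
     (\<Sum>m\<in>Poly_Mapping.keys p. \<iota> (Poly_Mapping.lookup p m) *
        (\<Prod>i\<in>Poly_Mapping.keys m. x i ^ Poly_Mapping.lookup m i))"

definition diff_eval ::
    "('b::field \<Rightarrow> 'b) \<Rightarrow> ('a::field \<Rightarrow> 'b) \<Rightarrow> 'b \<Rightarrow> 'a diff_poly \<Rightarrow> 'b" where
  "diff_eval \<Delta> \<iota> u = poly_eval \<iota> (\<lambda>i. (\<Delta> ^^ i) u)"

definition algebraically_independent :: "('a::field \<Rightarrow> 'b::field) \<Rightarrow> (nat \<Rightarrow> 'b) \<Rightarrow> bool" where
  "algebraically_independent \<iota> x \<longleftrightarrow> (\<forall>p. poly_eval \<iota> x p = 0 \<longrightarrow> p = 0)"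

definition differentially_transcendental ::
    "('b::field \<Rightarrow> 'b) \<Rightarrow> ('a::field \<Rightarrow> 'b) \<Rightarrow> 'b \<Rightarrow> bool" where
  "differentially_transcendental \<Delta> \<iota> u \<longleftrightarrow> algebraically_independent \<iota> (\<lambda>i. (\<Delta> ^^ i) u)"

definition diff_vars :: "'a::zero diff_poly \<Rightarrow> nat set" where
  "diff_vars p = (\<Union>m\<in>Poly_Mapping.keys p. Poly_Mapping.keys m)"

text \<open>Constant polynomials get order \<open>0\<close>, and the zero polynomial gets total degree \<open>0\<close>.\<close>

definition diff_order :: "'a::zero diff_poly \<Rightarrow> nat" where
  "diff_order p = Max (insert 0 (diff_vars p))"

definition total_degree :: "'a::zero diff_poly \<Rightarrow> nat" where
  "total_degree p =
     Max (insert 0 ((\<lambda>m. \<Sum>i\<in>Poly_Mapping.keys m. Poly_Mapping.lookup m i) ` Poly_Mapping.keys p))"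

text \<open>
  The library's \<^const>\<open>coprime\<close> requires a type class with division, of which \<^typ>\<open>'a diff_poly\<close> is
  not an instance; this is the same condition.
\<close>

definition relatively_prime :: "'a::comm_ring_1 \<Rightarrow> 'a \<Rightarrow> bool" where
  "relatively_prime p q \<longleftrightarrow> (\<forall>r. r dvd p \<longrightarrow> r dvd q \<longrightarrow> r dvd 1)"

definition reduced_representation ::
    "('b::field \<Rightarrow> 'b) \<Rightarrow> ('a::field \<Rightarrow> 'b) \<Rightarrow> 'b \<Rightarrow> 'b \<Rightarrow> 'a diff_poly \<Rightarrow> 'a diff_poly \<Rightarrow> bool" where
  "reduced_representation \<Delta> \<iota> u x p q \<longleftrightarrow>
     q \<noteq> 0 \<and> relatively_prime p q \<and> x = diff_eval \<Delta> \<iota> u p / diff_eval \<Delta> \<iota> u q"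

text \<open>
  For differentially transcendental \<open>u\<close>, reduced representations are unique up to a common factor
  from the base field, so the order does not depend on the one chosen here.
\<close>

definition element_order ::
    "('b::field \<Rightarrow> 'b) \<Rightarrow> ('a::field \<Rightarrow> 'b) \<Rightarrow> 'b \<Rightarrow> 'b \<Rightarrow> nat" where
  "element_order \<Delta> \<iota> u x =
     (SOME k. \<exists>p q. reduced_representation \<Delta> \<iota> u x p q \<and> k = max (diff_order p) (diff_order q))"

end

theory Submission
  imports Defs "HOL-Computational_Algebra.Polynomial" "HOL-Library.Product_Lexorder"
    "HOL-Library.FuncSet"
begin

text \<open>
  Write \<open>\<xi> = (u, u', u'', \<dots>)\<close>, let \<open>\<alpha>\<^sub>j = P\<^sub>j(u) / Q\<^sub>j(u)\<close>, let \<open>G\<close> be the differential field that they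
  generate over the base field \<open>F\<close>, let \<open>v\<close> be a generator of \<open>G\<close>, and let \<open>m\<close> be the order of \<open>v\<close>.
  Degrees are controlled by counting monomials, and the slack in the two bounds absorbs the factor that
  the count loses.

  \<^bold>\<open>Order.\<close> An element \<open>x\<close> of \<open>F\<langle>u\<rangle>\<close> has a differential, the operator \<open>dx = \<Sum>\<^sub>i (\<partial>x / \<partial>u\<^sup>(\<^sup>i\<^sup>)) \<partial>\<^sup>i\<close>, and
  \<open>d(x') = \<partial> dx\<close>.  The elements whose differential lies in a given left module of operators form a
  differential field, so \<open>G = F\<langle>v\<rangle>\<close> says that the \<open>d\<alpha>\<^sub>j\<close> generate the same left module as \<open>dv\<close>.  In
  characteristic 0 the order of \<open>x\<close> is the degree of \<open>dx\<close>, and every nonzero left multiple of \<open>dv\<close> has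
  degree at least \<open>m\<close>; hence \<open>m\<close> is at most the order of each \<open>\<alpha>\<^sub>j\<close>.

  \<^bold>\<open>Degree, part one.\<close> It suffices to find a nonzero polynomial \<open>h\<close> over \<open>G\<close>, of total degree at most
  \<open>W\<close> in variables \<open>y\<^sub>0, \<dots>, y\<^sub>m\<close>, that vanishes at \<open>\<xi>\<close>.  The derivatives \<open>v', v'', \<dots>\<close> are
  algebraically independent over \<open>F(u, \<dots>, u\<^sup>(\<^sup>m\<^sup>))\<close>, so collecting their monomials turns \<open>h\<close> into a
  relation \<open>\<Sum>\<^sub>k v\<^sup>k g\<^sub>k(\<xi>) = 0\<close> with \<open>g\<^sub>k\<close> over \<open>F\<close> of degree at most \<open>W\<close> (\<open>descend_to_powers\<close>).  If
  \<open>g\<^sub>K\<close> is the last nonzero coefficient, then \<open>g\<^sub>K v\<close> is integral over a polynomial ring, which is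
  integrally closed (\<open>almost_integral_dvd\<close>), so \<open>g\<^sub>K v\<close> is a polynomial \<open>p\<close>.  The integral equation
  also bounds its degree by \<open>W\<close>, and \<open>v = p / g\<^sub>K\<close> (\<open>representation_from_powers\<close>).

  \<^bold>\<open>Degree, part two.\<close> The polynomials \<open>f\<^sub>j = P\<^sub>j - \<alpha>\<^sub>j Q\<^sub>j\<close> and all their total derivatives have
  coefficients in \<open>G\<close> and degree at most \<open>d\<close>, and they vanish at \<open>\<xi>\<close>.  Their gradients at \<open>\<xi>\<close> are
  multiples of the \<open>d\<alpha>\<^sub>j\<close> and derivatives of these, and the equality of the two left modules shows
  that, after few derivations, \<open>c = N - m\<close> of them are independent, \<open>N\<close> being the number of variables
  involved (\<open>prolonged_rank\<close>).  Either \<open>N = m + 1\<close> and \<open>c = 1\<close>, or \<open>n \<ge> 2\<close> and \<open>N, c \<le> 2 e\<close>.  Counting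
  monomials yields a relation between \<open>y\<^sub>0, \<dots>, y\<^sub>m\<close> and the \<open>c\<close> polynomials, of degree at most
  \<open>W = (N + 1) d\<^sup>c\<close> in the \<open>y\<^sub>i\<close> (\<open>algebraic_relation_bounded\<close>).  Its terms of lowest degree in the
  \<open>c\<close> polynomials give \<open>h\<close>, because the polynomials behave like coordinates near \<open>\<xi>\<close>
  (\<open>bounded_elimination\<close>).  Both bounds of the theorem are at least this \<open>W\<close> (\<open>degree_bound_numeric\<close>).
\<close>

(* Keeps the weight \<lambda>_. 1 and bounds such as n + 1 in the form in which the lemmas state them. *)
declare One_nat_def [simp del]

section \<open>Polynomials as finitely supported coefficient maps\<close>

abbreviation lookup where "lookup \<equiv> Poly_Mapping.lookup"
abbreviation keys where "keys \<equiv> Poly_Mapping.keys"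
abbreviation single where "single \<equiv> Poly_Mapping.single"

definition Const :: "'a::zero \<Rightarrow> 'a diff_poly" where
  "Const c = single 0 c"

definition Var :: "nat \<Rightarrow> 'a::zero_neq_one diff_poly" where
  "Var i = single (single i 1) 1"

lemma poly_mapping_sum_singles: "(\<Sum>m\<in>keys p. single m (lookup p m)) = p"
  by (rule poly_mapping_eqI) (simp add: lookup_sum lookup_single when_def in_keys_iff)

lemma additive_induct [case_names single add]:
  fixes p :: "'k \<Rightarrow>\<^sub>0 'a::comm_monoid_add"
  assumes "\<And>m c. P (single m c)" and "\<And>p q. P p \<Longrightarrow> P q \<Longrightarrow> P (p + q)"
  shows "P p"
proof -
  have "P (\<Sum>m\<in>A. single m (lookup p m))" if "finite A" for A
    using that
  proof (induction A)
    case empty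
    show ?case using assms(1)[of _ 0] by simp
  next
    case (insert m A)
    then show ?case by (simp add: assms)
  qed
  from this[of "keys p"] show ?thesis by (simp add: poly_mapping_sum_singles)
qed

text \<open>
  Used with \<open>B p q\<close> the defect of a product rule, which then has to be checked on monomials only.
\<close>

lemma biadditive_zero:
  fixes B :: "('k \<Rightarrow>\<^sub>0 'a::comm_monoid_add) \<Rightarrow> ('l \<Rightarrow>\<^sub>0 'b::comm_monoid_add) \<Rightarrow> 'c::ab_group_add"
  assumes "\<And>p p' q. B (p + p') q = B p q + B p' q"
    and "\<And>p q q'. B p (q + q') = B p q + B p q'"
    and "\<And>a b c d. B (single a c) (single b d) = 0"
  shows "B p q = 0"
proof (induction p rule: additive_induct)
  case (single m c)
  show ?case by (induction q rule: additive_induct) (simp_all add: assms)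
qed (simp add: assms)

definition mono_eval :: "(nat \<Rightarrow> 'b::comm_monoid_mult) \<Rightarrow> (nat \<Rightarrow>\<^sub>0 nat) \<Rightarrow> 'b" where
  "mono_eval x m = (\<Prod>i\<in>keys m. x i ^ lookup m i)"

lemma mono_eval_superset:
  "finite A \<Longrightarrow> keys m \<subseteq> A \<Longrightarrow> mono_eval x m = (\<Prod>i\<in>A. x i ^ lookup m i)"
  unfolding mono_eval_def by (rule prod.mono_neutral_left) (auto simp: in_keys_iff)

lemma mono_eval_add: "mono_eval x (a + b) = mono_eval x a * mono_eval x b"
proof -
  have "mono_eval x a * mono_eval x b
      = (\<Prod>i\<in>keys a \<union> keys b. x i ^ lookup a i) * (\<Prod>i\<in>keys a \<union> keys b. x i ^ lookup b i)"
    by (simp add: mono_eval_superset[of "keys a \<union> keys b"])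
  also have "\<dots> = mono_eval x (a + b)"
    by (simp add: mono_eval_superset[of "keys a \<union> keys b" "a + b"] Poly_Mapping.keys_add
        lookup_add power_add prod.distrib)
  finally show ?thesis by simp
qed

lemma mono_eval_0 [simp]: "mono_eval x 0 = 1"
  by (simp add: mono_eval_def)

lemma mono_eval_single [simp]: "mono_eval x (single i n) = x i ^ n"
  by (simp add: mono_eval_superset[of "{i}"])

definition ring_map :: "('a::comm_ring_1 \<Rightarrow> 'b::comm_ring_1) \<Rightarrow> bool" where
  "ring_map \<phi> \<longleftrightarrow> \<phi> 1 = 1 \<and> (\<forall>x y. \<phi> (x + y) = \<phi> x + \<phi> y) \<and> (\<forall>x y. \<phi> (x * y) = \<phi> x * \<phi> y)"

lemma ring_mapD:
  assumes "ring_map \<phi>"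
  shows "\<phi> 1 = 1" "\<phi> (x + y) = \<phi> x + \<phi> y" "\<phi> (x * y) = \<phi> x * \<phi> y"
    and "\<phi> 0 = 0" "\<phi> (- x) = - \<phi> x" "\<phi> (x - y) = \<phi> x - \<phi> y"
proof -
  show 1: "\<phi> 1 = 1" "\<phi> (x + y) = \<phi> x + \<phi> y" "\<phi> (x * y) = \<phi> x * \<phi> y" for x y
    using assms by (auto simp: ring_map_def)
  show 0: "\<phi> 0 = 0" using 1(2)[of 0 0] by simp
  show m: "\<phi> (- x) = - \<phi> x" for x using 1(2)[of x "- x"] 0 by (simp add: eq_neg_iff_add_eq_0 add.commute)
  show "\<phi> (x - y) = \<phi> x - \<phi> y" using 1(2)[of x "- y"] m[of y] by simp
qed

lemma ring_map_sum: "ring_map \<phi> \<Longrightarrow> \<phi> (\<Sum>i\<in>A. f i) = (\<Sum>i\<in>A. \<phi> (f i))"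
  by (induction A rule: infinite_finite_induct) (simp_all add: ring_mapD)

lemma ring_map_power: "ring_map \<phi> \<Longrightarrow> \<phi> (x ^ n) = \<phi> x ^ n"
  by (induction n) (simp_all add: ring_mapD)

lemma ring_map_prod: "ring_map \<phi> \<Longrightarrow> \<phi> (\<Prod>i\<in>A. f i) = (\<Prod>i\<in>A. \<phi> (f i))"
  by (induction A rule: infinite_finite_induct) (simp_all add: ring_mapD)

lemma ring_map_of_nat: "ring_map \<phi> \<Longrightarrow> \<phi> (of_nat n) = of_nat n"
  by (induction n) (simp_all add: ring_mapD)

lemma ring_map_id: "ring_map (\<lambda>x. x)"
  by (auto simp: ring_map_def)

lemma ring_map_mono_eval: "ring_map \<phi> \<Longrightarrow> \<phi> (mono_eval x m) = mono_eval (\<lambda>i. \<phi> (x i)) m"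
  by (simp add: mono_eval_def ring_map_prod ring_map_power)

lemma poly_eval_superset:
  assumes "\<phi> 0 = 0" "finite A" "keys p \<subseteq> A"
  shows "poly_eval \<phi> x p = (\<Sum>m\<in>A. \<phi> (lookup p m) * mono_eval x m)"
  unfolding poly_eval_def mono_eval_def
  using assms by (intro sum.mono_neutral_left) (auto simp: in_keys_iff)

lemma poly_eval_single [simp]: "\<phi> 0 = 0 \<Longrightarrow> poly_eval \<phi> x (single m c) = \<phi> c * mono_eval x m"
  by (subst poly_eval_superset[of _ "{m}"]) auto

lemma poly_eval_add:
  assumes "ring_map \<phi>"
  shows "poly_eval \<phi> x (p + q) = poly_eval \<phi> x p + poly_eval \<phi> x q"
proof -
  note [simp] = ring_mapD[OF assms]
  have "finite (keys p \<union> keys q)" by simp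
  then show ?thesis
    by (simp add: poly_eval_superset[of \<phi> "keys p \<union> keys q"] Poly_Mapping.keys_add lookup_add
        algebra_simps sum.distrib)
qed

lemma poly_eval_mult:
  assumes "ring_map \<phi>"
  shows "poly_eval \<phi> x (p * q) = poly_eval \<phi> x p * poly_eval \<phi> x q"
proof -
  note [simp] = ring_mapD[OF assms] and [simp] = poly_eval_add[OF assms]
  have "poly_eval \<phi> x (p * q) - poly_eval \<phi> x p * poly_eval \<phi> x q = 0"
    by (rule biadditive_zero) (simp_all add: algebra_simps mult_single mono_eval_add)
  then show ?thesis by simp
qed

lemma poly_eval_Const [simp]: "\<phi> 0 = 0 \<Longrightarrow> poly_eval \<phi> x (Const c) = \<phi> c"
  by (simp add: Const_def)

lemma poly_eval_Var [simp]: "\<phi> 0 = 0 \<Longrightarrow> \<phi> 1 = 1 \<Longrightarrow> poly_eval \<phi> x (Var i) = x i"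
  by (simp add: Var_def)

lemma ring_map_poly_eval:
  assumes "ring_map \<phi>"
  shows "ring_map (poly_eval \<phi> x)"
proof -
  have "poly_eval \<phi> x 1 = 1"
    using poly_eval_single[of \<phi> x 0 1] ring_mapD[OF assms] by simp
  then show ?thesis
    by (simp add: ring_map_def poly_eval_add[OF assms] poly_eval_mult[OF assms])
qed

lemma Const_simps:
  "Const (c + d) = Const c + Const d" "Const 0 = 0"
  by (simp_all add: Const_def single_add)

lemma Const_mult: "Const (c * d) = Const c * Const (d::'a::comm_ring_1)"
  by (simp add: Const_def mult_single)

lemma Const_1: "Const (1::'a::comm_ring_1) = 1"
  by (simp add: Const_def)

lemma Var_power: "Var i ^ n = single (single i n) (1::'a::comm_ring_1)"
  by (induction n) (simp_all add: Var_def mult_single One_nat_def flip: single_add)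

lemma mono_eval_Var: "mono_eval Var m = single m (1::'a::comm_ring_1)"
proof (induction m rule: additive_induct)
  case (single i n)
  then show ?case by (simp add: Var_power)
next
  case (add p q)
  then show ?case by (simp add: mono_eval_add mult_single)
qed

lemma single_conv: "single m c = Const c * mono_eval Var m" for c :: "'a::comm_ring_1"
  by (simp add: mono_eval_Var Const_def mult_single)

definition polys :: "'a::zero set \<Rightarrow> nat set \<Rightarrow> 'a diff_poly set" where
  "polys K X = {p. \<forall>m\<in>keys p. lookup p m \<in> K \<and> keys m \<subseteq> X}"

text \<open>
  A subset of the polynomial ring over \<open>K\<close> that contains constants and variables and is closed under
  \<open>+\<close> and \<open>*\<close> is everything.  Identities between derivations, evaluations and their composites are
  proved this way.
\<close>

lemma polys_induct [consumes 1, case_names zero one Const Var add mult]: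
  fixes p :: "'a::comm_ring_1 diff_poly"
  assumes p: "p \<in> polys K X" and 0: "0 \<in> K" and 1: "1 \<in> K"
    and C: "\<And>c. c \<in> K \<Longrightarrow> P (Const c)" and V: "\<And>i. i \<in> X \<Longrightarrow> P (Var i)"
    and A: "\<And>p q. P p \<Longrightarrow> P q \<Longrightarrow> P (p + q)" and M: "\<And>p q. P p \<Longrightarrow> P q \<Longrightarrow> P (p * q)"
  shows "P p"
proof -
  have pw: "P (x ^ n)" if "P x" for x n
    using C[OF 1] M[OF that] by (induction n) (simp_all add: Const_1)
  have mono: "P (\<Prod>i\<in>A. Var i ^ lookup m i)" if "finite A" "A \<subseteq> X" for A and m :: "nat \<Rightarrow>\<^sub>0 nat"
    using that C[OF 1] by (induction A) (auto simp: Const_1 intro!: M pw V)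
  have "P (\<Sum>m\<in>A. single m (lookup p m))" if "finite A" "A \<subseteq> keys p" for A
    using that
  proof (induction A)
    case empty
    show ?case using C[OF 0] by (simp add: Const_simps)
  next
    case (insert m A)
    have "P (Const (lookup p m) * mono_eval Var m)"
      unfolding mono_eval_def using insert p by (intro M C mono) (auto simp: polys_def)
    then show ?case using insert by (simp add: single_conv A)
  qed
  from this[of "keys p"] show ?thesis by (simp add: poly_mapping_sum_singles)
qed

lemma poly_induct [case_names Const Var add mult]:
  fixes p :: "'a::comm_ring_1 diff_poly"
  assumes C: "\<And>c. P (Const c)" and V: "\<And>i. P (Var i)"
    and A: "\<And>p q. P p \<Longrightarrow> P q \<Longrightarrow> P (p + q)" and M: "\<And>p q. P p \<Longrightarrow> P q \<Longrightarrow> P (p * q)"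
  shows "P p"
proof (rule polys_induct[of p UNIV UNIV])
  show "p \<in> polys UNIV UNIV" by (simp add: polys_def)
qed (use assms in auto)

definition eval_at :: "(nat \<Rightarrow> 'b::comm_ring_1) \<Rightarrow> 'b diff_poly \<Rightarrow> 'b" where
  "eval_at x p = poly_eval (\<lambda>c. c) x p"

lemma ring_map_eval_at: "ring_map (eval_at x)"
proof -
  have "eval_at x = poly_eval (\<lambda>c. c) x" by (simp add: fun_eq_iff eval_at_def)
  then show ?thesis by (simp add: ring_map_poly_eval[OF ring_map_id])
qed

lemma eval_at_simps:
  "eval_at \<xi> (Const c) = c" "eval_at \<xi> (Var i) = \<xi> i" "eval_at \<xi> (single m c) = c * mono_eval \<xi> m"
  "eval_at \<xi> (p + q) = eval_at \<xi> p + eval_at \<xi> q" "eval_at \<xi> (p * q) = eval_at \<xi> p * eval_at \<xi> q"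
  "eval_at \<xi> (p - q) = eval_at \<xi> p - eval_at \<xi> q" "eval_at \<xi> (- p) = - eval_at \<xi> p"
  "eval_at \<xi> 0 = 0" "eval_at \<xi> 1 = 1" "eval_at \<xi> (p ^ n) = eval_at \<xi> p ^ n"
  "eval_at \<xi> (sum f A) = (\<Sum>i\<in>A. eval_at \<xi> (f i))"
  by (simp_all add: ring_mapD[OF ring_map_eval_at] ring_map_power[OF ring_map_eval_at]
    ring_map_sum[OF ring_map_eval_at]) (simp_all add: eval_at_def)

section \<open>Partial derivatives\<close>

text \<open>
  The exponent of \<open>i\<close> is subtracted with truncation; where it is 0, so is the coefficient.
\<close>

definition partial :: "nat \<Rightarrow> 'a::comm_ring_1 diff_poly \<Rightarrow> 'a diff_poly" where
  "partial i p = (\<Sum>m\<in>keys p. single (m - single i 1) (of_nat (lookup m i) * lookup p m))"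

lemma partial_superset:
  "finite A \<Longrightarrow> keys p \<subseteq> A \<Longrightarrow>
    partial i p = (\<Sum>m\<in>A. single (m - single i 1) (of_nat (lookup m i) * lookup p m))"
  unfolding partial_def by (rule sum.mono_neutral_left) (auto simp: in_keys_iff)

lemma partial_single:
  "partial i (single m c) = single (m - single i 1) (of_nat (lookup m i) * c)"
  by (subst partial_superset[of "{m}"]) auto

lemma partial_add: "partial i (p + q) = partial i p + partial i q"
proof -
  have "finite (keys p \<union> keys q)" by simp
  then show ?thesis
    by (simp add: partial_superset[of "keys p \<union> keys q"] Poly_Mapping.keys_add lookup_add
        algebra_simps sum.distrib single_add)
qed

lemma mono_minus_single_add:
  fixes a b :: "nat \<Rightarrow>\<^sub>0 nat"
  assumes "lookup a i > 0"
  shows "a - single i 1 + b = a + b - single i 1"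
  using assms by (intro poly_mapping_eqI) (auto simp: lookup_add lookup_minus lookup_single when_def)

lemma partial_mult: "partial i (p * q) = partial i p * q + p * partial i q"
proof -
  have "partial i (p * q) - (partial i p * q + p * partial i q) = 0"
  proof (rule biadditive_zero[where B = "\<lambda>p q. partial i (p * q) - (partial i p * q + p * partial i q)"])
    fix a b :: "nat \<Rightarrow>\<^sub>0 nat" and c d :: 'a
    have 1: "single (a - single i 1 + b) (of_nat (lookup a i) * c * d)
        = single (a + b - single i 1) (of_nat (lookup a i) * c * d)"
      by (cases "lookup a i = 0") (simp_all add: mono_minus_single_add del: One_nat_def)
    have 2: "single (a + (b - single i 1)) (c * (of_nat (lookup b i) * d))
        = single (a + b - single i 1) (of_nat (lookup b i) * c * d)"
      using mono_minus_single_add[of b i a]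
      by (cases "lookup b i = 0") (simp_all add: algebra_simps del: One_nat_def)
    show "partial i (single a c * single b d)
        - (partial i (single a c) * single b d + single a c * partial i (single b d)) = 0"
      unfolding partial_single mult_single 1 2
      by (simp add: lookup_add algebra_simps flip: single_add)
  qed (simp_all add: partial_add algebra_simps)
  then show ?thesis by simp
qed

lemma partial_Const [simp]: "partial i (Const c) = 0"
  by (simp add: Const_def partial_single)

lemma partial_0 [simp]: "partial i 0 = 0"
  by (simp add: partial_def)

lemma partial_Var: "partial i (Var j) = (if i = j then 1 else 0)"
  by (auto simp: Var_def partial_single lookup_single when_def)

lemma partial_uminus: "partial i (- p) = - partial i p"
  using partial_add[of i p "- p"] by (simp add: eq_neg_iff_add_eq_0 add.commute)

lemma partial_diff: "partial i (p - q) = partial i p - partial i q"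
  using partial_add[of i p "- q"] by (simp add: partial_uminus)

lemma mono_eq_minus_single_iff:
  fixes m k :: "nat \<Rightarrow>\<^sub>0 nat"
  assumes "lookup k i > 0"
  shows "k - single i 1 = m \<longleftrightarrow> k = m + single i 1"
proof
  assume "k - single i 1 = m"
  then show "k = m + single i 1"
    using assms by (auto intro!: poly_mapping_eqI simp: lookup_add lookup_minus lookup_single when_def)
qed auto

lemma lookup_partial:
  "lookup (partial i p) m = of_nat (Suc (lookup m i)) * lookup p (m + single i 1)"
proof (induction p rule: additive_induct)
  case (single k c)
  show ?case
  proof (cases "lookup k i = 0")
    case True
    then have "k \<noteq> m + single i 1" by (auto simp: lookup_add)
    with True show ?thesis by (simp add: partial_single lookup_single when_def)
  next
    case False
    then show ?thesis
      using mono_eq_minus_single_iff[of k i m]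
      by (auto simp: partial_single lookup_single when_def lookup_add algebra_simps)
  qed
next
  case (add p q)
  then show ?case by (simp add: partial_add lookup_add algebra_simps)
qed

lemma partial_eq_0: "i \<notin> diff_vars p \<Longrightarrow> partial i p = 0"
proof (rule poly_mapping_eqI)
  fix m :: "nat \<Rightarrow>\<^sub>0 nat"
  assume "i \<notin> diff_vars p"
  moreover have "i \<in> keys (m + single i 1)" by (simp add: in_keys_iff lookup_add lookup_single)
  ultimately have "lookup p (m + single i 1) = 0"
    unfolding diff_vars_def by (metis UN_I in_keys_iff)
  then show "lookup (partial i p) m = lookup 0 m" by (simp add: lookup_partial)
qed

section \<open>Coefficients in a subring, variables in a set\<close>

definition subring :: "'a::comm_ring_1 set \<Rightarrow> bool" where
  "subring K \<longleftrightarrow> 0 \<in> K \<and> 1 \<in> K \<and> (\<forall>x\<in>K. \<forall>y\<in>K. x + y \<in> K \<and> x - y \<in> K \<and> x * y \<in> K)"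

lemma subringD:
  assumes "subring K"
  shows "0 \<in> K" "1 \<in> K" "x \<in> K \<Longrightarrow> y \<in> K \<Longrightarrow> x + y \<in> K" "x \<in> K \<Longrightarrow> y \<in> K \<Longrightarrow> x - y \<in> K"
    "x \<in> K \<Longrightarrow> y \<in> K \<Longrightarrow> x * y \<in> K" "x \<in> K \<Longrightarrow> - x \<in> K" "of_nat n \<in> K"
proof -
  show *: "0 \<in> K" "1 \<in> K" "x \<in> K \<Longrightarrow> y \<in> K \<Longrightarrow> x + y \<in> K" "x \<in> K \<Longrightarrow> y \<in> K \<Longrightarrow> x - y \<in> K"
    "x \<in> K \<Longrightarrow> y \<in> K \<Longrightarrow> x * y \<in> K" for x y
    using assms by (auto simp: subring_def)
  show "x \<in> K \<Longrightarrow> - x \<in> K" using *(1) *(4)[of 0 x] by simp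
  show "of_nat n \<in> K" by (induction n) (simp_all add: *)
qed

lemma subring_sum: "subring K \<Longrightarrow> (\<And>i. i \<in> A \<Longrightarrow> f i \<in> K) \<Longrightarrow> (\<Sum>i\<in>A. f i) \<in> K"
  by (induction A rule: infinite_finite_induct) (simp_all add: subringD)

lemma subring_prod: "subring K \<Longrightarrow> (\<And>i. i \<in> A \<Longrightarrow> f i \<in> K) \<Longrightarrow> (\<Prod>i\<in>A. f i) \<in> K"
  by (induction A rule: infinite_finite_induct) (simp_all add: subringD)

lemma subring_power: "subring K \<Longrightarrow> x \<in> K \<Longrightarrow> x ^ n \<in> K"
  by (induction n) (simp_all add: subringD)

lemma subring_mono_eval: "subring K \<Longrightarrow> (\<And>i. i \<in> keys m \<Longrightarrow> x i \<in> K) \<Longrightarrow> mono_eval x m \<in> K"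
  unfolding mono_eval_def by (intro subring_prod subring_power)

lemma polys_mono: "K \<subseteq> K' \<Longrightarrow> X \<subseteq> X' \<Longrightarrow> polys K X \<subseteq> polys K' X'"
  by (auto simp: polys_def)

lemma polys_lookup: "0 \<in> K \<Longrightarrow> p \<in> polys K X \<Longrightarrow> lookup p m \<in> K"
  by (cases "m \<in> keys p") (auto simp: polys_def in_keys_iff)

lemma polys_single: "c \<in> K \<Longrightarrow> keys m \<subseteq> X \<Longrightarrow> single m c \<in> polys K X"
  by (auto simp: polys_def split: if_splits)

lemma polys_vars: "p \<in> polys K X \<Longrightarrow> diff_vars p \<subseteq> X"
  by (auto simp: polys_def diff_vars_def)

lemma polys_add:
  assumes "subring K" "p \<in> polys K X" "q \<in> polys K X"
  shows "p + q \<in> polys K X"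
proof -
  have "lookup (p + q) m \<in> K" for m
    using assms subringD[OF assms(1)] by (simp add: lookup_add polys_lookup)
  moreover have "keys m \<subseteq> X" if "m \<in> keys (p + q)" for m
    using that Poly_Mapping.keys_add[of p q] assms(2,3) by (auto simp: polys_def)
  ultimately show ?thesis by (auto simp: polys_def)
qed

lemma polys_sum:
  assumes "subring K" "\<And>i. i \<in> A \<Longrightarrow> f i \<in> polys K X"
  shows "(\<Sum>i\<in>A. f i) \<in> polys K X"
  using assms(2)
proof (induction A rule: infinite_finite_induct)
  case (insert x F)
  then show ?case by (simp add: polys_add assms(1))
qed (simp_all add: polys_def)

lemma polys_mult:
  assumes K: "subring K" and p: "p \<in> polys K X" and q: "q \<in> polys K X"
  shows "p * q \<in> polys K X"
proof -
  have "single a (lookup p a) * single b (lookup q b) \<in> polys K X"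
    if "a \<in> keys p" "b \<in> keys q" for a b
  proof -
    have "lookup p a \<in> K" "lookup q b \<in> K" "keys a \<subseteq> X" "keys b \<subseteq> X"
      using that p q by (auto simp: polys_def)
    moreover from this have "keys (a + b) \<subseteq> X"
      using Poly_Mapping.keys_add[of a b] by blast
    ultimately show ?thesis
      unfolding mult_single by (intro polys_single subringD(5)[OF K])
  qed
  then have "(\<Sum>a\<in>keys p. single a (lookup p a)) * (\<Sum>b\<in>keys q. single b (lookup q b)) \<in> polys K X"
    unfolding sum_product by (intro polys_sum K) auto
  then show ?thesis by (simp add: poly_mapping_sum_singles)
qed

lemma polys_Const: "c \<in> K \<Longrightarrow> Const c \<in> polys K X"
  by (simp add: Const_def polys_single)

lemma polys_Var: "1 \<in> K \<Longrightarrow> i \<in> X \<Longrightarrow> Var i \<in> polys K X"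
  by (simp add: Var_def polys_single)

lemma subring_polys: "subring K \<Longrightarrow> subring (polys K X)"
proof -
  assume K: "subring K"
  note k = subringD[OF K]
  have "p - q = p + Const (-1) * q" for p q :: "'a diff_poly"
  proof -
    have "Const (-1::'a) = - 1" by (simp add: Const_def single_uminus)
    then show ?thesis by simp
  qed
  then have "p - q \<in> polys K X" if "p \<in> polys K X" "q \<in> polys K X" for p q
    using K that k by (metis polys_add polys_mult polys_Const)
  then show ?thesis
    using K k polys_Const[of 1 K X] polys_Const[of 0 K X]
    by (auto simp: subring_def Const_1 Const_simps intro!: polys_add polys_mult)
qed

lemma polys_partial:
  assumes K: "subring K" and p: "p \<in> polys K X"
  shows "partial i p \<in> polys K X"
proof -
  have "keys (m - single i 1) \<subseteq> keys m" for m :: "nat \<Rightarrow>\<^sub>0 nat"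
    by (auto simp: in_keys_iff lookup_minus)
  then show ?thesis
    unfolding partial_def
    using p subringD[OF K] by (intro polys_sum K polys_single) (auto simp: polys_def)
qed

lemma poly_eval_in_subring:
  assumes "subring R" "\<And>c. c \<in> K \<Longrightarrow> \<phi> c \<in> R" "\<And>i. i \<in> X \<Longrightarrow> x i \<in> R" "p \<in> polys K X"
  shows "poly_eval \<phi> x p \<in> R"
  unfolding poly_eval_def using assms
  by (intro subring_sum subringD(5) subring_prod subring_power) (auto simp: polys_def)

section \<open>Leading monomials\<close>

text \<open>
  Weight 1 on every variable gives the total degree, the indicator of \<open>i\<close> gives the degree in
  variable \<open>i\<close>; one treatment of leading monomials serves both.
\<close>

definition wdeg :: "(nat \<Rightarrow> nat) \<Rightarrow> (nat \<Rightarrow>\<^sub>0 nat) \<Rightarrow> nat" where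
  "wdeg \<omega> m = (\<Sum>i\<in>keys m. \<omega> i * lookup m i)"

lemma wdeg_superset: "finite A \<Longrightarrow> keys m \<subseteq> A \<Longrightarrow> wdeg \<omega> m = (\<Sum>i\<in>A. \<omega> i * lookup m i)"
  unfolding wdeg_def by (rule sum.mono_neutral_left) (auto simp: in_keys_iff)

lemma wdeg_add: "wdeg \<omega> (a + b) = wdeg \<omega> a + wdeg \<omega> b"
proof -
  have "finite (keys a \<union> keys b)" by simp
  then show ?thesis
    by (simp add: wdeg_superset[of "keys a \<union> keys b"] Poly_Mapping.keys_add lookup_add
        algebra_simps sum.distrib)
qed

lemma wdeg_single [simp]: "wdeg \<omega> (single i n) = \<omega> i * n"
  by (simp add: wdeg_superset[of "{i}"])

text \<open>
  The order by weight, with ties broken by the given linear order on exponent vectors.  Both components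
  are compatible with addition.
\<close>

definition mkey :: "(nat \<Rightarrow> nat) \<Rightarrow> (nat \<Rightarrow>\<^sub>0 nat) \<Rightarrow> nat \<times> (nat \<Rightarrow>\<^sub>0 nat)" where
  "mkey \<omega> m = (wdeg \<omega> m, m)"

definition lead :: "(nat \<Rightarrow> nat) \<Rightarrow> 'a::zero diff_poly \<Rightarrow> (nat \<Rightarrow>\<^sub>0 nat)" where
  "lead \<omega> p = snd (Max (mkey \<omega> ` keys p))"

lemma mkey_eq_iff [simp]: "mkey \<omega> a = mkey \<omega> b \<longleftrightarrow> a = b"
  by (auto simp: mkey_def)

lemma lead_props:
  assumes "p \<noteq> 0"
  shows "lead \<omega> p \<in> keys p" and "m \<in> keys p \<Longrightarrow> mkey \<omega> m \<le> mkey \<omega> (lead \<omega> p)"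
proof -
  have ne: "keys p \<noteq> {}" using assms poly_mapping_eqI[of p 0] by (auto simp: in_keys_iff)
  have "Max (mkey \<omega> ` keys p) \<in> mkey \<omega> ` keys p" using ne by (intro Max_in) auto
  then obtain k where k: "k \<in> keys p" "Max (mkey \<omega> ` keys p) = mkey \<omega> k" by auto
  then have "lead \<omega> p = k" by (simp add: lead_def mkey_def)
  with k show "lead \<omega> p \<in> keys p" by simp
  show "mkey \<omega> m \<le> mkey \<omega> (lead \<omega> p)" if "m \<in> keys p"
    using that \<open>lead \<omega> p = k\<close> k(2) by (metis Max_ge finite_imageI finite_keys imageI)
qed

lemma lead_eqI:
  assumes "m \<in> keys p" "\<And>k. k \<in> keys p \<Longrightarrow> mkey \<omega> k \<le> mkey \<omega> m"
  shows "lead \<omega> p = m"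
proof -
  have "p \<noteq> 0" using assms(1) by auto
  then have "mkey \<omega> (lead \<omega> p) = mkey \<omega> m"
    using assms lead_props[of p] by (meson antisym)
  then show ?thesis by simp
qed

lemma mkey_add_mono: "mkey \<omega> a \<le> mkey \<omega> b \<Longrightarrow> mkey \<omega> (a + c) \<le> mkey \<omega> (b + c)"
  by (auto simp: mkey_def wdeg_add add_right_mono)

lemma mkey_add_eq:
  assumes "mkey \<omega> a \<le> mkey \<omega> a'" "mkey \<omega> b \<le> mkey \<omega> b'" "a + b = a' + b'"
  shows "a = a' \<and> b = b'"
proof -
  have "mkey \<omega> (a + b) \<le> mkey \<omega> (a' + b)" "mkey \<omega> (a' + b) \<le> mkey \<omega> (a' + b')"
    using mkey_add_mono[OF assms(1), of b] mkey_add_mono[OF assms(2), of a'] by (simp_all add: add.commute)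
  then have "mkey \<omega> (a' + b) = mkey \<omega> (a' + b')" using assms(3) by simp
  then show ?thesis using assms(3) by simp
qed

lemma lookup_mult_conv:
  fixes p q :: "'a::comm_ring_1 diff_poly"
  shows "lookup (p * q) m = (\<Sum>a\<in>keys p. \<Sum>b\<in>keys q. if a + b = m then lookup p a * lookup q b else 0)"
proof -
  have "p * q = (\<Sum>a\<in>keys p. \<Sum>b\<in>keys q. single (a + b) (lookup p a * lookup q b))"
    using sum_product[of "\<lambda>a. single a (lookup p a)" "keys p" "\<lambda>b. single b (lookup q b)" "keys q"]
    by (simp add: poly_mapping_sum_singles mult_single)
  then show ?thesis by (simp add: lookup_sum lookup_single when_def)
qed

lemma lookup_mult_lead:
  fixes p q :: "'a::comm_ring_1 diff_poly"
  assumes "p \<noteq> 0" "q \<noteq> 0"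
  shows "lookup (p * q) (lead \<omega> p + lead \<omega> q) = lookup p (lead \<omega> p) * lookup q (lead \<omega> q)"
proof -
  have "(if a + b = lead \<omega> p + lead \<omega> q then lookup p a * lookup q b else 0)
      = (if b = lead \<omega> q then if a = lead \<omega> p then lookup p a * lookup q b else 0 else 0)"
    if "a \<in> keys p" "b \<in> keys q" for a b
    using that mkey_add_eq[of \<omega> a "lead \<omega> p" b "lead \<omega> q"] lead_props(2)[of p a \<omega>]
      lead_props(2)[of q b \<omega>] assms by auto
  then have "lookup (p * q) (lead \<omega> p + lead \<omega> q) = (\<Sum>a\<in>keys p. \<Sum>b\<in>keys q.
      if b = lead \<omega> q then if a = lead \<omega> p then lookup p a * lookup q b else 0 else 0)"
    unfolding lookup_mult_conv by (intro sum.cong refl) auto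
  also have "\<dots> = lookup p (lead \<omega> p) * lookup q (lead \<omega> q)"
    using lead_props(1)[OF assms(1), of \<omega>] lead_props(1)[OF assms(2), of \<omega>] by simp
  finally show ?thesis .
qed

text \<open>
  Only the pair of leading monomials contributes to the largest sum.
\<close>

lemma lead_mult:
  fixes p q :: "'a::idom diff_poly"
  assumes "p \<noteq> 0" "q \<noteq> 0"
  shows "lead \<omega> (p * q) = lead \<omega> p + lead \<omega> q"
proof (rule lead_eqI)
  show "lead \<omega> p + lead \<omega> q \<in> keys (p * q)"
    using assms lookup_mult_lead[OF assms, of \<omega>] lead_props(1)[of p \<omega>] lead_props(1)[of q \<omega>]
    by (simp add: in_keys_iff)
next
  fix k assume "k \<in> keys (p * q)"
  then obtain a b where ab: "k = a + b" "a \<in> keys p" "b \<in> keys q"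
    using Poly_Mapping.keys_mult[of p q] by auto
  have "mkey \<omega> (a + b) \<le> mkey \<omega> (lead \<omega> p + b)" 
    using ab assms by (intro mkey_add_mono lead_props)
  also have "\<dots> \<le> mkey \<omega> (lead \<omega> p + lead \<omega> q)"
    using mkey_add_mono[OF lead_props(2)[OF assms(2) ab(3), of \<omega>], of "lead \<omega> p"]
    by (simp add: add.commute)
  finally show "mkey \<omega> k \<le> mkey \<omega> (lead \<omega> p + lead \<omega> q)" using ab by simp
qed

lemma wdeg_le_lead: "p \<noteq> 0 \<Longrightarrow> m \<in> keys p \<Longrightarrow> wdeg \<omega> m \<le> wdeg \<omega> (lead \<omega> p)"
  using lead_props(2)[of p m \<omega>] by (auto simp: mkey_def)

abbreviation mdeg :: "(nat \<Rightarrow>\<^sub>0 nat) \<Rightarrow> nat" where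
  "mdeg \<equiv> wdeg (\<lambda>_. 1)"

lemma total_degree_le_iff: "total_degree p \<le> d \<longleftrightarrow> (\<forall>m\<in>keys p. mdeg m \<le> d)"
  by (auto simp: total_degree_def wdeg_def)

lemma total_degree_lead: "p \<noteq> 0 \<Longrightarrow> total_degree p = mdeg (lead (\<lambda>_. 1) p)"
  using lead_props(1)[of p "\<lambda>_. 1"] wdeg_le_lead[of p _ "\<lambda>_. 1"] total_degree_le_iff[of p]
  by (metis antisym order_refl)

lemma total_degree_mult:
  fixes p q :: "'a::idom diff_poly"
  assumes "p \<noteq> 0" "q \<noteq> 0"
  shows "total_degree (p * q) = total_degree p + total_degree q"
  using assms by (simp add: total_degree_lead lead_mult wdeg_add)

lemma diff_vars_lead:
  assumes "p \<noteq> 0"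
  shows "i \<in> diff_vars p \<longleftrightarrow> lookup (lead (\<lambda>j. if j = i then 1 else 0) p) i > 0"
proof -
  have w: "wdeg (\<lambda>j. if j = i then 1 else 0) m = lookup m i" for m
    by (subst wdeg_superset[of "insert i (keys m)"]) (auto simp: if_distrib[of "\<lambda>c. c * _"] cong: if_cong)
  have "i \<in> diff_vars p \<longleftrightarrow> (\<exists>m\<in>keys p. lookup m i > 0)"
    by (auto simp: diff_vars_def in_keys_iff)
  then show ?thesis
    using lead_props(1)[OF assms] wdeg_le_lead[OF assms, of _ "\<lambda>j. if j = i then 1 else 0"]
    unfolding w by (meson less_le_trans)
qed

text \<open>
  Degrees in a single variable add up under multiplication, so a factor of a nonzero polynomial
  involves no further variables.
\<close>

lemma diff_vars_factor:
  fixes p q :: "'a::idom diff_poly"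
  assumes "p \<noteq> 0" "q \<noteq> 0"
  shows "diff_vars (p * q) = diff_vars p \<union> diff_vars q"
proof -
  have "i \<in> diff_vars (p * q) \<longleftrightarrow> i \<in> diff_vars p \<union> diff_vars q" for i
    using assms by (simp add: diff_vars_lead lead_mult lookup_add)
  then show ?thesis by auto
qed

lemma lead_power:
  fixes p :: "'a::idom diff_poly"
  assumes "p \<noteq> 0"
  shows "lookup (lead \<omega> (p ^ n)) i = n * lookup (lead \<omega> p) i"
proof (induction n)
  case 0
  have "lead \<omega> (1 :: 'a diff_poly) = 0"
    by (rule lead_eqI) (simp_all add: in_keys_iff lookup_one)
  then show ?case by simp
next
  case (Suc n)
  then show ?case using assms by (simp add: lead_mult lookup_add)
qed

section \<open>Points with natural number coordinates\<close>

text \<open>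
  Two different exponent vectors have equal weights with respect to \<open>\<omega> i = n ^ i\<close> only if \<open>n\<close> is a root of
  a nonzero univariate polynomial, so all but finitely many \<open>n\<close> separate finitely many monomials.
\<close>

lemma separating_weight:
  assumes "finite M"
  shows "\<exists>n::nat. inj_on (wdeg (\<lambda>i. n ^ i)) M"
proof -
  define g :: "(nat \<Rightarrow>\<^sub>0 nat) \<Rightarrow> (nat \<Rightarrow>\<^sub>0 nat) \<Rightarrow> int poly" where
    "g a b = (\<Sum>i\<in>keys a \<union> keys b. monom (int (lookup a i) - int (lookup b i)) i)" for a b
  have coeff_g: "coeff (g a b) i = int (lookup a i) - int (lookup b i)" for a b i
    by (auto simp: g_def coeff_sum in_keys_iff)
  have poly_g: "poly (g a b) (int n) = int (wdeg (\<lambda>i. n ^ i) a) - int (wdeg (\<lambda>i. n ^ i) b)" for a b n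
  proof -
    have "finite (keys a \<union> keys b)" by simp
    then show ?thesis
      by (simp add: g_def poly_sum poly_monom wdeg_superset[of "keys a \<union> keys b"] algebra_simps
          sum_subtractf)
  qed
  have g0: "g a b \<noteq> 0" if "a \<noteq> b" for a b
  proof
    assume "g a b = 0"
    then have "lookup a i = lookup b i" for i using coeff_g[of a b i] by simp
    then show False using that by (auto intro: poly_mapping_eqI)
  qed
  define R where "R = (\<Union>a\<in>M. \<Union>b\<in>M - {a}. {x. poly (g a b) x = 0})"
  have "finite R"
    unfolding R_def using assms g0 by (auto intro!: poly_roots_finite)
  moreover have "infinite (range int)" by (simp add: range_inj_infinite)
  ultimately obtain n where n: "int n \<notin> R"
    by (meson finite_subset image_subsetI)
  have "inj_on (wdeg (\<lambda>i. n ^ i)) M"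
  proof (rule inj_onI, rule ccontr)
    fix a b assume "a \<in> M" "b \<in> M" "wdeg (\<lambda>i. n ^ i) a = wdeg (\<lambda>i. n ^ i) b" "a \<noteq> b"
    then have "int n \<in> R" unfolding R_def using poly_g[of a b n] by auto
    with n show False by simp
  qed
  then show ?thesis by blast
qed

text \<open>
  Substituting \<open>N ^ (n ^ i)\<close> for variable \<open>i\<close>, with \<open>n\<close> separating the monomials, gives a nonzero
  univariate polynomial in \<open>N\<close>.
\<close>

lemma poly_nonvanishing_nat:
  fixes p :: "'b::field diff_poly"
  assumes char0: "inj (of_nat :: nat \<Rightarrow> 'b)" and "p \<noteq> 0"
  shows "\<exists>l :: nat \<Rightarrow> nat. eval_at (\<lambda>i. of_nat (l i)) p \<noteq> 0"
proof -
  obtain n where inj: "inj_on (wdeg (\<lambda>i. n ^ i)) (keys p)"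
    using separating_weight[of "keys p"] by auto
  define w where "w = wdeg (\<lambda>i. n ^ i)"
  define g where "g = (\<Sum>m\<in>keys p. monom (lookup p m) (w m))"
  obtain k where k: "k \<in> keys p" using assms(2) lead_props(1) by blast
  have "coeff g (w k) = (\<Sum>m\<in>keys p. if m = k then lookup p m else 0)"
    unfolding g_def coeff_sum using inj k by (intro sum.cong) (auto simp: w_def inj_on_def)
  also have "\<dots> = lookup p k" using k by simp
  finally have "g \<noteq> 0" using k by (auto simp: in_keys_iff)
  then have "finite {x. poly g x = 0}" by (rule poly_roots_finite)
  then obtain N where N: "poly g (of_nat N) \<noteq> 0"
    using range_inj_infinite[OF char0] by (metis (mono_tags, lifting) finite_subset image_subsetI mem_Collect_eq)
  have "mono_eval (\<lambda>i. of_nat (N ^ (n ^ i)) :: 'b) m = of_nat N ^ w m" for m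
    by (simp add: mono_eval_def w_def wdeg_def power_sum power_mult)
  then have "eval_at (\<lambda>i. of_nat (N ^ (n ^ i))) p = poly g (of_nat N)"
    unfolding eval_at_def by (subst poly_eval_superset[of _ "keys p"]) (simp_all add: g_def poly_sum poly_monom)
  with N show ?thesis by metis
qed

section \<open>Almost integral quotients of polynomials\<close>

definition subfield :: "'b::field set \<Rightarrow> bool" where
  "subfield K \<longleftrightarrow> subring K \<and> (\<forall>x\<in>K. inverse x \<in> K)"

lemma subfieldD:
  assumes "subfield K"
  shows "subring K" "x \<in> K \<Longrightarrow> inverse x \<in> K" "x \<in> K \<Longrightarrow> y \<in> K \<Longrightarrow> x / y \<in> K"
  using assms by (auto simp: subfield_def subring_def divide_inverse)

definition monomials :: "nat set \<Rightarrow> nat \<Rightarrow> (nat \<Rightarrow>\<^sub>0 nat) set" where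
  "monomials X d = {m. keys m \<subseteq> X \<and> mdeg m \<le> d}"

lemma lookup_le_mdeg: "lookup m i \<le> mdeg m"
  by (cases "i \<in> keys m") (auto simp: wdeg_def in_keys_iff intro: member_le_sum)

lemma finite_monomials:
  assumes "finite X"
  shows "finite (monomials X d)"
proof -
  have "inj_on (\<lambda>m. restrict (lookup m) X) (monomials X d)"
  proof (rule inj_onI, rule poly_mapping_eqI)
    fix a b i
    assume *: "a \<in> monomials X d" "b \<in> monomials X d" "restrict (lookup a) X = restrict (lookup b) X"
    show "lookup a i = lookup b i"
    proof (cases "i \<in> X")
      case True
      then show ?thesis using *(3) by (metis restrict_apply)
    next
      case False
      then have "i \<notin> keys a" "i \<notin> keys b" using * by (auto simp: monomials_def)
      then show ?thesis by (simp add: in_keys_iff)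
    qed
  qed
  moreover have "(\<lambda>m. restrict (lookup m) X) ` monomials X d \<subseteq> X \<rightarrow>\<^sub>E {..d}"
    by (auto simp: monomials_def intro: order_trans[OF lookup_le_mdeg])
  ultimately show ?thesis
    using assms by (meson finite_PiE finite_atMost finite_imageD finite_subset)
qed

text \<open>
  Polynomial rings are completely integrally closed.  If all powers of \<open>p / q\<close> have the common
  denominator \<open>s\<close>, comparison of leading exponents for large \<open>n\<close> shows that the leading monomial of \<open>q\<close>
  divides that of \<open>p\<close>.  Subtracting the corresponding multiple of \<open>q\<close> from \<open>p\<close> keeps the hypothesis (by
  the binomial theorem) and lowers the leading monomial; only finitely many monomials in the variables
  \<open>X\<close> lie below a given one in the graded order.
\<close>

lemma almost_integral_dvd:
  fixes p q s :: "'b::field diff_poly"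
  assumes K: "subfield K" and X: "finite X"
    and "p \<in> polys K X" and q: "q \<in> polys K X" "q \<noteq> 0" and s: "s \<noteq> 0"
    and "\<And>n. \<exists>r. s * p ^ n = q ^ n * r"
  shows "\<exists>r\<in>polys K X. p = q * r"
  using assms(3,7)
proof (induction "card {m. keys m \<subseteq> X \<and> mkey (\<lambda>_. 1) m \<le> mkey (\<lambda>_. 1) (lead (\<lambda>_. 1) p)}"
    arbitrary: p rule: less_induct)
  case less
  define \<omega> :: "nat \<Rightarrow> nat" where "\<omega> = (\<lambda>_. 1)"
  note k = subfieldD[OF K]
  have poly0: "0 \<in> polys K X" by (simp add: polys_def)
  show ?case
  proof (cases "p = 0")
    case True
    then show ?thesis using poly0 by (intro bexI[of _ 0]) auto
  next
    case p: False
    define a where "a = lead \<omega> p"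
    define b where "b = lead \<omega> q"
    have le: "lookup b i \<le> lookup a i" for i
    proof -
      \<comment> \<open>For this \<open>n\<close> the exponent contributed by \<open>s\<close> is less than one multiple of \<open>n\<close>.\<close>
      define n where "n = Suc (lookup (lead \<omega> s) i)"
      obtain r where r: "s * p ^ n = q ^ n * r" using less.prems(2) by blast
      then have "r \<noteq> 0" using p s by auto
      have "lookup (lead \<omega> (s * p ^ n)) i = lookup (lead \<omega> s) i + n * lookup a i"
        using s p by (simp add: lead_mult lookup_add lead_power a_def)
      moreover have "lookup (lead \<omega> (q ^ n * r)) i = n * lookup b i + lookup (lead \<omega> r) i"
        using q \<open>r \<noteq> 0\<close> by (simp add: lead_mult lookup_add lead_power b_def)
      ultimately have "n * lookup b i \<le> lookup (lead \<omega> s) i + n * lookup a i" using r by simp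
      then have "n * lookup b i < n * Suc (lookup a i)" unfolding n_def by simp
      then show ?thesis by (meson less_Suc_eq_le mult_less_cancel1)
    qed
    define M where "M = a - b"
    have Mb: "M + b = a"
      using le by (intro poly_mapping_eqI) (simp add: M_def lookup_add lookup_minus)
    have a_in: "a \<in> keys p" and b_in: "b \<in> keys q"
      using lead_props(1) p q by (auto simp: a_def b_def)
    define c where "c = lookup p a / lookup q b"
    have c0: "c \<noteq> 0" using a_in b_in by (simp add: c_def in_keys_iff)
    have "c \<in> K" using k less.prems(1) q(1) by (simp add: c_def polys_lookup subringD(1))
    moreover have "keys M \<subseteq> X"
    proof -
      have "keys M \<subseteq> keys a" by (auto simp: M_def in_keys_iff lookup_minus)
      then show ?thesis using a_in less.prems(1) unfolding polys_def by blast
    qed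
    ultimately have t: "single M c \<in> polys K X" by (rule polys_single)
    define p' where "p' = p - single M c * q"
    have p'K: "p' \<in> polys K X"
      using k less.prems(1) q(1) t subringD(4)[OF subring_polys] polys_mult unfolding p'_def by blast
    have div: "\<exists>r. s * p' ^ n = q ^ n * r" for n
    proof -
      obtain r where r: "\<And>n. s * p ^ n = q ^ n * r n" using less.prems(2) by metis
      have "s * p' ^ n = s * (\<Sum>k\<le>n. of_nat (n choose k) * p ^ k * (- single M c * q) ^ (n - k))"
        unfolding p'_def by (simp flip: binomial_ring)
      also have "\<dots> = (\<Sum>k\<le>n. of_nat (n choose k) * (s * p ^ k) * (- single M c * q) ^ (n - k))"
        by (simp add: sum_distrib_left ac_simps)
      also have "\<dots> = (\<Sum>k\<le>n. of_nat (n choose k) * (q ^ k * r k) * (- single M c) ^ (n - k) * q ^ (n - k))"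
        by (simp only: r power_mult_distrib mult.assoc)
      also have "\<dots> = (\<Sum>k\<le>n. q ^ n * (of_nat (n choose k) * r k * (- single M c) ^ (n - k)))"
      proof (intro sum.cong refl)
        fix k assume "k \<in> {..n}"
        then have "q ^ n = q ^ k * q ^ (n - k)" by (simp flip: power_add)
        then show "of_nat (n choose k) * (q ^ k * r k) * (- single M c) ^ (n - k) * q ^ (n - k)
            = q ^ n * (of_nat (n choose k) * r k * (- single M c) ^ (n - k))"
          by (simp only: ac_simps)
      qed
      also have "\<dots> = q ^ n * (\<Sum>k\<le>n. of_nat (n choose k) * r k * (- single M c) ^ (n - k))"
        by (simp only: sum_distrib_left)
      finally show ?thesis by blast
    qed
    have "\<exists>r\<in>polys K X. p' = q * r"
    proof (cases "p' = 0")
      case True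
      then show ?thesis using poly0 by (intro bexI[of _ 0]) auto
    next
      case False
      have s0: "single M c \<noteq> 0" using c0 by (metis lookup_single_eq lookup_zero)
      have lM: "lead \<omega> (single M c) = M"
        using c0 by (intro lead_eqI) (auto)
      have lMq: "lead \<omega> (single M c * q) = a"
        using s0 q by (simp add: lead_mult lM Mb flip: b_def)
      have "lookup (single M c * q) a = c * lookup q b"
        using lookup_mult_lead[OF s0 q(2), of \<omega>] by (simp add: lM Mb flip: b_def)
      then have a0: "lookup p' a = 0"
        using b_in by (simp add: p'_def lookup_minus c_def in_keys_iff)
      have kp': "mkey \<omega> m \<le> mkey \<omega> a" if "m \<in> keys p'" for m
      proof -
        have "m \<in> keys p \<or> m \<in> keys (single M c * q)"
          using that by (auto simp: p'_def in_keys_iff lookup_minus)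
        then show ?thesis
          using lead_props(2)[of p m \<omega>] lead_props(2)[of "single M c * q" m \<omega>] p s0 q lMq
          by (auto simp flip: a_def)
      qed
      define a' where "a' = lead \<omega> p'"
      have "a' \<in> keys p'" using lead_props(1) False by (auto simp: a'_def)
      then have "mkey \<omega> a' \<le> mkey \<omega> a" "a' \<noteq> a" using kp' a0 by (auto simp: in_keys_iff)
      then have less_a: "mkey \<omega> a' < mkey \<omega> a" by (metis mkey_eq_iff order_le_less)
      let ?S = "\<lambda>a. {m. keys m \<subseteq> X \<and> mkey \<omega> m \<le> mkey \<omega> a}"
      have "?S a \<subseteq> monomials X (mdeg a)"
        by (auto simp: monomials_def mkey_def \<omega>_def)
      then have "finite (?S a)" using finite_monomials[OF X] finite_subset by blast
      moreover have "?S a' \<subset> ?S a"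
      proof
        show "?S a' \<subseteq> ?S a" using less_a by auto
        have "keys a \<subseteq> X" using a_in less.prems(1) by (auto simp: polys_def)
        then have "a \<in> ?S a" "a \<notin> ?S a'" using less_a by auto
        then show "?S a' \<noteq> ?S a" by blast
      qed
      ultimately have "card (?S a') < card (?S a)" by (rule psubset_card_mono)
      then show ?thesis
        using less.hyps[OF _ p'K div] unfolding a_def a'_def \<omega>_def by blast
    qed
    then obtain r where r: "r \<in> polys K X" "p' = q * r" by blast
    have "p = q * (r + single M c)" using r(2) by (simp add: p'_def algebra_simps)
    moreover have "r + single M c \<in> polys K X" using r(1) t k by (intro polys_add)
    ultimately show ?thesis by blast
  qed
qed

section \<open>Counting monomials\<close>

lemma mdeg_nth: "mdeg (Poly_Mapping.nth xs) = sum_list xs"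
proof -
  have "mdeg (Poly_Mapping.nth xs) = (\<Sum>i<length xs. lookup (Poly_Mapping.nth xs) i)"
    by (subst wdeg_superset[of "{..<length xs}"])
      (auto simp: in_keys_iff nth_default_def simp del: keys_nth split: if_splits)
  also have "\<dots> = (\<Sum>i<length xs. xs ! i)" by (simp add: nth_default_def)
  finally show ?thesis by (simp add: sum_list_sum_nth atLeast0LessThan)
qed

text \<open>
  A monomial of degree at most \<open>W\<close> in \<open>k\<close> variables is a composition of \<open>W\<close> into \<open>k + 1\<close> parts, the last
  of which is the unused degree.
\<close>

lemma card_monomials: "card (monomials {..<k} W) = (W + k) choose k"
proof -
  let ?L = "{l :: nat list. length l = k + 1 \<and> sum_list l = W}"
  have md: "mdeg m = sum_list (map (lookup m) [0..<k])" if "keys m \<subseteq> {..<k}" for m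
    using that wdeg_superset[of "{..<k}" m "\<lambda>_. 1"]
    by (simp add: interv_sum_list_conv_sum_set_nat atLeast0LessThan)
  have "bij_betw (\<lambda>m. map (lookup m) [0..<k] @ [W - mdeg m]) (monomials {..<k} W) ?L"
  proof (rule bij_betw_byWitness[where f' = "\<lambda>l. Poly_Mapping.nth (take k l)"])
    show "\<forall>m\<in>monomials {..<k} W. Poly_Mapping.nth (take k (map (lookup m) [0..<k] @ [W - mdeg m])) = m"
      by (auto intro!: poly_mapping_eqI simp: nth_default_def monomials_def in_keys_iff subset_eq)
    show "\<forall>l\<in>?L. map (lookup (Poly_Mapping.nth (take k l))) [0..<k] @ [W - mdeg (Poly_Mapping.nth (take k l))] = l"
    proof
      fix l assume l: "l \<in> ?L"
      then have tl: "l = take k l @ [last l]"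
        by (metis (mono_tags, lifting) Suc_eq_plus1 append_butlast_last_id butlast_conv_take diff_Suc_1 length_0_conv mem_Collect_eq nat.simps(3))
      have "W = sum_list (take k l) + last l" using l by (subst (asm) tl) simp
      then have "W - mdeg (Poly_Mapping.nth (take k l)) = last l" by (simp add: mdeg_nth)
      moreover have "map (lookup (Poly_Mapping.nth (take k l))) [0..<k] = take k l"
        using l by (intro nth_equalityI) (auto simp: nth_default_def)
      ultimately show "map (lookup (Poly_Mapping.nth (take k l))) [0..<k] @ [W - mdeg (Poly_Mapping.nth (take k l))] = l"
        using tl by simp
    qed
    show "(\<lambda>m. map (lookup m) [0..<k] @ [W - mdeg m]) ` monomials {..<k} W \<subseteq> ?L"
      by (auto simp: monomials_def md)
    show "(\<lambda>l. Poly_Mapping.nth (take k l)) ` ?L \<subseteq> monomials {..<k} W"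
    proof -
      have "sum_list (take k l) \<le> sum_list l" for l :: "nat list"
        by (metis append_take_drop_id le_add1 sum_list_append)
      moreover have "keys (Poly_Mapping.nth (take k l)) \<subseteq> {..<k}" for l :: "nat list"
        by (auto simp: in_keys_iff nth_default_def simp del: keys_nth split: if_splits)
      ultimately show ?thesis by (auto simp: monomials_def mdeg_nth simp del: keys_nth)
    qed
  qed
  then have "card (monomials {..<k} W) = card ?L" by (rule bij_betw_same_card)
  also have "\<dots> = (W + k) choose W" using card_length_sum_list[of "k + 1" W] by simp
  also have "\<dots> = (W + k) choose k" by (simp add: binomial_symmetric[of W "W + k"])
  finally show ?thesis .
qed

section \<open>Algebraic relations of bounded degree\<close>

text \<open>
  Gaussian elimination inside a subfield: a homogeneous system with more unknowns than equations has a
  nontrivial solution with entries in the field of its coefficients.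
\<close>

lemma subfield_linear_dependence:
  fixes M :: "'s \<Rightarrow> 'e \<Rightarrow> 'b::field"
  assumes K: "subfield K" and "finite E" "finite S" "card E < card S"
    and "\<And>s e. s \<in> S \<Longrightarrow> e \<in> E \<Longrightarrow> M s e \<in> K"
  shows "\<exists>c. (\<forall>s\<in>S. c s \<in> K) \<and> (\<exists>s\<in>S. c s \<noteq> 0) \<and> (\<forall>e\<in>E. (\<Sum>s\<in>S. c s * M s e) = 0)"
  using assms(2-)
proof (induction E arbitrary: S M)
  case empty
  then have "S \<noteq> {}" by auto
  then show ?case using subringD(2)[OF subfieldD(1)[OF K]] by (intro exI[of _ "\<lambda>_. 1"]) auto
next
  case (insert e E)
  note k = subfieldD[OF K] and kr = subringD[OF subfieldD(1)[OF K]]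
  show ?case
  proof (cases "\<forall>s\<in>S. M s e = 0")
    case True
    then obtain c where "\<forall>s\<in>S. c s \<in> K" "\<exists>s\<in>S. c s \<noteq> 0" "\<forall>e\<in>E. (\<Sum>s\<in>S. c s * M s e) = 0"
      using insert.IH[of S M] insert.prems insert.hyps by auto
    then show ?thesis using True by (intro exI[of _ c]) auto
  next
    case False
    then obtain t where t: "t \<in> S" "M t e \<noteq> 0" by auto
    define S' where "S' = S - {t}"
    define M' where "M' s f = M s f - M s e / M t e * M t f" for s f
    have fin: "finite S'" using insert.prems by (simp add: S'_def)
    have S: "S = insert t S'" "t \<notin> S'" using t by (auto simp: S'_def)
    have "card E < card S'" using insert.prems insert.hyps S fin by simp
    moreover have "M' s f \<in> K" if "s \<in> S'" "f \<in> E" for s f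
      using that t insert.prems S unfolding M'_def by (intro kr k) auto
    ultimately obtain c where c: "\<forall>s\<in>S'. c s \<in> K" "\<exists>s\<in>S'. c s \<noteq> 0"
      "\<forall>f\<in>E. (\<Sum>s\<in>S'. c s * M' s f) = 0"
      using insert.IH[of S' M'] fin by blast
    define d where "d = - (\<Sum>s\<in>S'. c s * M s e) / M t e"
    have dK: "d \<in> K"
      unfolding d_def using c(1) insert.prems t S
      by (intro k kr subring_sum k(1)) auto
    have eq: "(\<Sum>s\<in>S. (c(t := d)) s * M s f) = d * M t f + (\<Sum>s\<in>S'. c s * M s f)" for f
      unfolding S(1) using fin S(2) by (simp, intro sum.cong) auto
    have "(\<Sum>s\<in>S. (c(t := d)) s * M s f) = 0" if "f \<in> insert e E" for f
    proof (cases "f = e")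
      case True
      then show ?thesis using t unfolding eq by (simp add: d_def)
    next
      case False
      then have "0 = (\<Sum>s\<in>S'. c s * M' s f)" using c(3) that by auto
      also have "\<dots> = (\<Sum>s\<in>S'. c s * M s f) - (\<Sum>s\<in>S'. c s * M s e) / M t e * M t f"
        by (simp add: M'_def algebra_simps sum_subtractf sum_distrib_left sum_divide_distrib)
      finally show ?thesis unfolding eq by (simp add: d_def)
    qed
    moreover have "\<forall>s\<in>S. (c(t := d)) s \<in> K" using c(1) dK S by auto
    moreover have "\<exists>s\<in>S. (c(t := d)) s \<noteq> 0" using c(2) S by auto
    ultimately show ?thesis by blast
  qed
qed

lemma total_degree_mult_le:
  "total_degree (p * q) \<le> total_degree p + total_degree (q :: 'a::idom diff_poly)"
proof (cases "p = 0 \<or> q = 0")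
  case True
  then show ?thesis by (auto simp: total_degree_def)
qed (simp add: total_degree_mult)

lemma total_degree_1: "total_degree (1 :: 'a::idom diff_poly) = 0"
  by (simp add: total_degree_def)

lemma total_degree_power_le:
  "total_degree (p ^ n) \<le> n * total_degree (p :: 'a::idom diff_poly)"
proof (induction n)
  case (Suc n)
  then show ?case using total_degree_mult_le[of p "p ^ n"] by simp
qed (simp add: total_degree_1)

lemma total_degree_prod_le:
  "total_degree (\<Prod>i\<in>A. f i) \<le> (\<Sum>i\<in>A. total_degree (f i :: 'a::idom diff_poly))"
proof (induction A rule: infinite_finite_induct)
  case (insert x F)
  then show ?case using total_degree_mult_le[of "f x" "prod f F"] by simp
qed (simp_all add: total_degree_1)

lemma total_degree_mono_eval_le:
  fixes f :: "nat \<Rightarrow> 'a::idom diff_poly"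
  assumes "\<And>j. j \<in> keys b \<Longrightarrow> total_degree (f j) \<le> d"
  shows "total_degree (mono_eval f b) \<le> d * mdeg b"
proof -
  have "total_degree (mono_eval f b) \<le> (\<Sum>i\<in>keys b. total_degree (f i ^ lookup b i))"
    unfolding mono_eval_def by (rule total_degree_prod_le)
  also have "\<dots> \<le> (\<Sum>i\<in>keys b. d * lookup b i)"
  proof (rule sum_mono)
    fix i assume "i \<in> keys b"
    then show "total_degree (f i ^ lookup b i) \<le> d * lookup b i"
      using total_degree_power_le[of "f i" "lookup b i"] assms[of i]
      by (metis le_trans mult.commute mult_le_mono2)
  qed
  also have "\<dots> = d * mdeg b" by (simp add: wdeg_def sum_distrib_left)
  finally show ?thesis .
qed

lemma sum_lessThan_add:
  fixes m n :: nat
  shows "(\<Sum>i<m + n. g i) = (\<Sum>i<m. g i) + (\<Sum>i<n. g (m + i) :: nat)"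
  by (induction n) (simp_all add: add.assoc)

definition mono_of :: "nat \<Rightarrow> (nat \<Rightarrow> nat) \<Rightarrow> (nat \<Rightarrow>\<^sub>0 nat)" where
  "mono_of k f = Poly_Mapping.nth (map f [0..<k])"

lemma lookup_mono_of: "lookup (mono_of k f) i = (if i < k then f i else 0)"
  by (simp add: mono_of_def nth_default_def)

lemma keys_mono_of: "keys (mono_of k f) \<subseteq> {..<k}"
  by (auto simp: in_keys_iff lookup_mono_of split: if_splits)

lemma mdeg_mono_of: "mdeg (mono_of k f) = (\<Sum>i<k. f i)"
  by (subst wdeg_superset[OF _ keys_mono_of]) (simp_all add: lookup_mono_of)

text \<open>
  Dividing the last \<open>c\<close> exponents of a monomial by \<open>d\<close>, with remainder, embeds the monomials of degree at
  most \<open>W\<close> into pairs of a monomial of weight at most \<open>W\<close>, where the last \<open>c\<close> variables have weight \<open>d\<close>,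
  and a vector of \<open>c\<close> remainders.
\<close>

lemma card_monomials_weighted:
  assumes "d \<ge> 1"
  shows "card (monomials {..<m + c} W)
    \<le> card {(a, b). keys a \<subseteq> {..<m} \<and> keys b \<subseteq> {..<c} \<and> mdeg a + d * mdeg b \<le> W} * d ^ c"
    and "finite {(a, b). keys a \<subseteq> {..<m} \<and> keys b \<subseteq> {..<c} \<and> mdeg a + d * mdeg b \<le> W}"
      (is "finite ?S")
proof -
  have "?S \<subseteq> monomials {..<m} W \<times> monomials {..<c} W"
  proof
    fix ab assume "ab \<in> ?S"
    then obtain a b where ab: "ab = (a, b)" "keys a \<subseteq> {..<m}" "keys b \<subseteq> {..<c}"
      "mdeg a + d * mdeg b \<le> W" by auto
    have "mdeg b \<le> d * mdeg b" using assms by simp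
    then have "mdeg b \<le> W" using ab(4) by linarith
    moreover have "mdeg a \<le> W" using ab(4) by linarith
    ultimately show "ab \<in> monomials {..<m} W \<times> monomials {..<c} W"
      using ab by (auto simp: monomials_def)
  qed
  then show fin: "finite ?S" by (rule finite_subset) (simp add: finite_monomials)
  let ?R = "{..<c} \<rightarrow>\<^sub>E {..<d}"
  define h where "h s = ((mono_of m (lookup s), mono_of c (\<lambda>j. lookup s (m + j) div d)),
    restrict (\<lambda>j. lookup s (m + j) mod d) {..<c})" for s :: "nat \<Rightarrow>\<^sub>0 nat"
  have "inj_on h (monomials {..<m + c} W)"
  proof (rule inj_onI, rule poly_mapping_eqI)
    fix s t i
    assume *: "s \<in> monomials {..<m + c} W" "t \<in> monomials {..<m + c} W" "h s = h t"
    have 1: "lookup (mono_of m (lookup s)) i = lookup (mono_of m (lookup t)) i"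
      and 2: "\<And>j. lookup (mono_of c (\<lambda>j. lookup s (m + j) div d)) j
        = lookup (mono_of c (\<lambda>j. lookup t (m + j) div d)) j"
      and 3: "restrict (\<lambda>j. lookup s (m + j) mod d) {..<c} = restrict (\<lambda>j. lookup t (m + j) mod d) {..<c}"
      using *(3) by (auto simp: h_def)
    consider "i < m" | "m \<le> i" "i < m + c" | "m + c \<le> i" by linarith
    then show "lookup s i = lookup t i"
    proof cases
      case 1
      then show ?thesis using \<open>lookup (mono_of m (lookup s)) i = _\<close> by (simp add: lookup_mono_of)
    next
      case c2: 2
      then obtain j where j: "i = m + j" "j < c" by (metis add_less_cancel_left le_iff_add)
      have "lookup s i div d = lookup t i div d" using 2[of j] j by (simp add: lookup_mono_of)
      moreover have "lookup s i mod d = lookup t i mod d"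
        using fun_cong[OF 3, of j] j by simp
      ultimately show ?thesis by (metis div_mult_mod_eq)
    next
      case 3
      then have "i \<notin> keys s" "i \<notin> keys t" using *(1,2) by (auto simp: monomials_def)
      then show ?thesis by (simp add: in_keys_iff)
    qed
  qed
  moreover have "h ` monomials {..<m + c} W \<subseteq> ?S \<times> ?R"
  proof
    fix y assume "y \<in> h ` monomials {..<m + c} W"
    then obtain s where s: "s \<in> monomials {..<m + c} W" "y = h s" by auto
    have "mdeg (mono_of m (lookup s)) + d * mdeg (mono_of c (\<lambda>j. lookup s (m + j) div d))
        = (\<Sum>i<m. lookup s i) + (\<Sum>j<c. d * (lookup s (m + j) div d))"
      by (simp add: mdeg_mono_of sum_distrib_left)
    also have "\<dots> \<le> (\<Sum>i<m. lookup s i) + (\<Sum>j<c. lookup s (m + j))"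
      by (intro add_left_mono sum_mono) simp
    also have "\<dots> = mdeg s"
      using s wdeg_superset[of "{..<m + c}" s "\<lambda>_. 1"] by (simp add: monomials_def sum_lessThan_add)
    also have "\<dots> \<le> W" using s by (simp add: monomials_def)
    finally show "y \<in> ?S \<times> ?R"
      using assms keys_mono_of unfolding s(2) h_def by auto
  qed
  moreover have "finite (?S \<times> ?R)" by (intro finite_cartesian_product fin finite_PiE) auto
  ultimately have "card (monomials {..<m + c} W) \<le> card (?S \<times> ?R)"
    by (meson card_inj_on_le)
  also have "\<dots> = card ?S * d ^ c" by (simp add: card_cartesian_product card_PiE)
  finally show "card (monomials {..<m + c} W) \<le> card ?S * d ^ c" .
qed

text \<open>
  With \<open>W = (N + 1) * d ^ c\<close>, passing from \<open>N\<close> to \<open>N + 1\<close> variables multiplies the number of monomials by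
  \<open>(W + N + 1) / (N + 1) > d ^ c\<close>.
\<close>

lemma card_monomials_less:
  assumes "d \<ge> 1"
  shows "card (monomials {..<N} ((N + 1) * d ^ c)) * d ^ c
    < card (monomials {..<N + 1} ((N + 1) * d ^ c))"
proof -
  define W where "W = (N + 1) * d ^ c"
  have "(N + 1) * ((W + N + 1) choose (N + 1)) = (W + N + 1) * ((W + N) choose N)"
    using Suc_times_binomial_eq[of "W + N" N] by (simp add: One_nat_def algebra_simps)
  moreover have "0 < (W + N) choose N" by simp
  ultimately have "(N + 1) * d ^ c * ((W + N) choose N) < (N + 1) * ((W + N + 1) choose (N + 1))"
    unfolding W_def[symmetric] by simp
  then have "d ^ c * ((W + N) choose N) < (W + N + 1) choose (N + 1)"
    by (metis mult.assoc mult_less_cancel1)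
  then show ?thesis unfolding W_def[symmetric] card_monomials by (simp add: ac_simps)
qed

text \<open>
  A weak form of Perron's theorem.  The products of a monomial in \<open>y\<^sub>0, \<dots>, y\<^sub>m\<^sub>-\<^sub>1\<close> and a monomial in the
  \<open>c\<close> polynomials, of weight at most \<open>W\<close> where each of the latter has weight \<open>d\<close>, are polynomials of degree
  at most \<open>W\<close> in \<open>N\<close> variables; by the two preceding counts there are more of them than monomials to
  express them in.  The dependence is taken over \<open>K\<close>, where the coefficients lie.
\<close>

lemma algebraic_relation_bounded:
  fixes f :: "nat \<Rightarrow> 'b::field diff_poly"
  assumes K: "subfield K" and d: "d \<ge> 1" and mc: "N + 1 = m + c" "m \<le> N"
    and f: "\<And>j. j < c \<Longrightarrow> f j \<in> polys K {..<N}" "\<And>j. j < c \<Longrightarrow> total_degree (f j) \<le> d"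
  shows "\<exists>S A. finite S \<and>
    (\<forall>(a, b)\<in>S. A (a, b) \<in> K \<and> keys a \<subseteq> {..<m} \<and> keys b \<subseteq> {..<c} \<and> mdeg a \<le> (N + 1) * d ^ c)
    \<and> (\<exists>s\<in>S. A s \<noteq> 0)
    \<and> (\<Sum>(a, b)\<in>S. Const (A (a, b)) * single a 1 * mono_eval f b) = 0"
proof -
  define W where "W = (N + 1) * d ^ c"
  define S where "S = {(a, b). keys a \<subseteq> {..<m} \<and> keys b \<subseteq> {..<c} \<and> mdeg a + d * mdeg b \<le> W}"
  define T where "T s = single (fst s) 1 * mono_eval f (snd s)" for s
  note kr = subringD[OF subfieldD(1)[OF K]]
  have fin: "finite S" unfolding S_def by (rule card_monomials_weighted[OF d])
  have TK: "T s \<in> polys K {..<N}" if sS: "s \<in> S" for s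
  proof -
    obtain a b where s: "s = (a, b)" "keys a \<subseteq> {..<m}" "keys b \<subseteq> {..<c}" using sS by (cases s) (auto simp: S_def)
    have "single a 1 \<in> polys K {..<N}" using s mc kr by (intro polys_single) auto
    moreover have "mono_eval f b \<in> polys K {..<N}"
      using s f by (intro subring_mono_eval subring_polys subfieldD(1)[OF K]) auto
    ultimately show ?thesis
      unfolding T_def s by (auto intro: polys_mult[OF subfieldD(1)[OF K]])
  qed
  have TW: "mdeg e \<le> W" if sS: "s \<in> S" "e \<in> keys (T s)" for s e
  proof -
    obtain a b where s: "s = (a, b)" "keys b \<subseteq> {..<c}" "mdeg a + d * mdeg b \<le> W"
      using sS by (cases s) (auto simp: S_def)
    have "total_degree (single a (1::'b)) \<le> mdeg a" by (simp add: total_degree_le_iff)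
    moreover have "total_degree (mono_eval f b) \<le> d * mdeg b"
      using s f by (intro total_degree_mono_eval_le) auto
    ultimately have "total_degree (T s) \<le> W"
      using s total_degree_mult_le[of "single a 1" "mono_eval f b"] by (simp add: T_def)
    then show ?thesis using that by (simp add: total_degree_le_iff)
  qed
  have "card (monomials {..<N} W) * d ^ c < card S * d ^ c"
    using card_monomials_less[OF d, of N c, folded W_def]
      card_monomials_weighted(1)[OF d, of m c W, folded S_def mc(1)] by linarith
  then have "card (monomials {..<N} W) < card S" by simp
  moreover have "lookup (T s) e \<in> K" if "s \<in> S" for s e
    using polys_lookup[OF _ TK[OF that]] kr(1) by blast
  ultimately obtain A where A: "\<forall>s\<in>S. A s \<in> K" "\<exists>s\<in>S. A s \<noteq> 0"
    "\<forall>e\<in>monomials {..<N} W. (\<Sum>s\<in>S. A s * lookup (T s) e) = 0"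
    using subfield_linear_dependence[OF K finite_monomials[of "{..<N}" W] fin, of "\<lambda>s e. lookup (T s) e"]
    by auto
  have "(\<Sum>s\<in>S. Const (A s) * T s) = 0"
  proof (rule poly_mapping_eqI)
    fix e
    have l: "lookup (Const x * p) e = x * lookup p e" for x :: 'b and p
      by (induction p rule: additive_induct)
        (simp_all add: Const_def mult_single lookup_single when_def lookup_add distrib_left)
    show "lookup (\<Sum>s\<in>S. Const (A s) * T s) e = lookup 0 e"
    proof (cases "e \<in> monomials {..<N} W")
      case True
      then show ?thesis using A(3) by (simp add: lookup_sum l)
    next
      case False
      then have "lookup (T s) e = 0" if "s \<in> S" for s
        using TK[OF that] TW[OF that, of e] by (auto simp: polys_def monomials_def in_keys_iff)
      then show ?thesis by (simp add: lookup_sum l)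
    qed
  qed
  then have "(\<Sum>(a, b)\<in>S. Const (A (a, b)) * single a 1 * mono_eval f b) = 0"
    by (simp add: T_def case_prod_unfold mult.assoc)
  moreover have "mdeg a \<le> W" if "(a, b) \<in> S" for a b using that by (auto simp: S_def)
  ultimately show ?thesis
    using fin A(1,2) unfolding W_def[symmetric]
    by (intro exI[of _ S] exI[of _ A]) (auto simp: S_def)
qed

section \<open>Elimination at a point with independent gradients\<close>

definition along_line :: "(nat \<Rightarrow> 'b::field) \<Rightarrow> (nat \<Rightarrow> 'b) \<Rightarrow> 'b diff_poly \<Rightarrow> 'b poly" where
  "along_line \<xi> w = poly_eval (\<lambda>c. [:c:]) (\<lambda>i. [:\<xi> i, w i:])"

lemma ring_map_pCons: "ring_map (\<lambda>c. [:c:])"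
  by (simp add: ring_map_def one_pCons)

lemma ring_map_along_line: "ring_map (along_line \<xi> w)"
  unfolding along_line_def by (rule ring_map_poly_eval[OF ring_map_pCons])

lemma along_line_Const [simp]: "along_line \<xi> w (Const c) = [:c:]"
  by (simp add: along_line_def)

lemma along_line_Var [simp]: "along_line \<xi> w (Var i) = [:\<xi> i, w i:]"
  by (simp add: along_line_def one_pCons)

lemma along_line_0: "poly (along_line \<xi> w p) 0 = eval_at \<xi> p"
  by (induction p rule: poly_induct)
    (simp_all add: eval_at_simps ring_mapD[OF ring_map_along_line])

lemma along_line_1:
  assumes "\<And>i. i \<ge> N \<Longrightarrow> w i = 0"
  shows "coeff (along_line \<xi> w p) 1 = (\<Sum>i<N. w i * eval_at \<xi> (partial i p))"
proof (induction p rule: poly_induct)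
  case (Const c)
  then show ?case by (simp add: eval_at_simps One_nat_def)
next
  case (Var j)
  have "(\<Sum>i<N. w i * eval_at \<xi> (partial i (Var j))) = (\<Sum>i<N. if i = j then w i else 0)"
    by (intro sum.cong) (auto simp: partial_Var eval_at_simps)
  also have "\<dots> = w j" using assms[of j] by auto
  finally show ?case by (simp add: One_nat_def)
next
  case (add p q)
  then show ?case
    by (simp add: ring_mapD[OF ring_map_along_line] partial_add eval_at_simps algebra_simps sum.distrib)
next
  case (mult p q)
  have "coeff (along_line \<xi> w (p * q)) 1 = coeff (along_line \<xi> w p) 0 * coeff (along_line \<xi> w q) 1
      + coeff (along_line \<xi> w p) 1 * coeff (along_line \<xi> w q) 0"
    by (simp add: ring_mapD[OF ring_map_along_line] coeff_mult One_nat_def atMost_Suc)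
  also have "\<dots> = eval_at \<xi> p * coeff (along_line \<xi> w q) 1 + coeff (along_line \<xi> w p) 1 * eval_at \<xi> q"
    by (simp flip: poly_0_coeff_0 add: along_line_0)
  finally show ?case
    unfolding mult by (simp add: partial_mult eval_at_simps algebra_simps sum.distrib sum_distrib_left)
qed

text \<open>
  Take a relation between \<open>y\<^sub>0, \<dots>, y\<^sub>m\<^sub>-\<^sub>1\<close> and \<open>f\<^sub>0, \<dots>, f\<^sub>c\<^sub>-\<^sub>1\<close>, and let \<open>k\<close> be the least degree in the \<open>f\<^sub>j\<close> that
  occurs.  Since the gradients are independent, for every \<open>l\<close> there is a line through \<open>\<xi>\<close> on which \<open>f\<^sub>j\<close> is
  \<open>l\<^sub>j\<close> times the parameter, up to higher order.  The lowest order term of the relation on this line says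
  that \<open>\<Sum>\<^sub>b A\<^sub>b(\<xi>) l\<^sup>b = 0\<close>, summed over the exponents \<open>b\<close> of degree \<open>k\<close>.  As this holds for all natural
  \<open>l\<close>, each \<open>A\<^sub>b\<close> vanishes at \<open>\<xi>\<close>, and one of them is a nonzero polynomial.
\<close>

lemma bounded_elimination:
  fixes f :: "nat \<Rightarrow> 'b::field diff_poly"
  assumes char0: "inj (of_nat :: nat \<Rightarrow> 'b)"
    and K: "subfield K" and d: "d \<ge> 1" and mc: "N + 1 = m + c" "m \<le> N"
    and f: "\<And>j. j < c \<Longrightarrow> f j \<in> polys K {..<N}" "\<And>j. j < c \<Longrightarrow> total_degree (f j) \<le> d"
    and f0: "\<And>j. j < c \<Longrightarrow> eval_at \<xi> (f j) = 0"
    and rank: "\<And>l :: nat \<Rightarrow> 'b. \<exists>w. \<forall>j<c. (\<Sum>i<N. w i * eval_at \<xi> (partial i (f j))) = l j"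
  shows "\<exists>h\<in>polys K {..<m}. h \<noteq> 0 \<and> total_degree h \<le> (N + 1) * d ^ c \<and> eval_at \<xi> h = 0"
proof -
  define W where "W = (N + 1) * d ^ c"
  obtain S A where S: "finite S"
    "\<And>a b. (a, b) \<in> S \<Longrightarrow> A (a, b) \<in> K \<and> keys a \<subseteq> {..<m} \<and> keys b \<subseteq> {..<c} \<and> mdeg a \<le> W"
    and A: "\<exists>s\<in>S. A s \<noteq> 0"
    and rel: "(\<Sum>(a, b)\<in>S. Const (A (a, b)) * single a 1 * mono_eval f b) = 0"
  proof -
    have "\<exists>S A. finite S \<and>
      (\<forall>(a, b)\<in>S. A (a, b) \<in> K \<and> keys a \<subseteq> {..<m} \<and> keys b \<subseteq> {..<c} \<and> mdeg a \<le> (N + 1) * d ^ c)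
      \<and> (\<exists>s\<in>S. A s \<noteq> 0)
      \<and> (\<Sum>(a, b)\<in>S. Const (A (a, b)) * single a 1 * mono_eval f b) = 0"
      by (rule algebraic_relation_bounded[OF K d mc]) (fact f)+
    then obtain S A where "finite S"
      "\<forall>(a, b)\<in>S. A (a, b) \<in> K \<and> keys a \<subseteq> {..<m} \<and> keys b \<subseteq> {..<c} \<and> mdeg a \<le> (N + 1) * d ^ c"
      "\<exists>s\<in>S. A s \<noteq> 0" "(\<Sum>(a, b)\<in>S. Const (A (a, b)) * single a 1 * mono_eval f b) = 0"
      by (elim exE conjE)
    then show ?thesis by (intro that[of S A]) (auto simp: W_def)
  qed
  define B where "B = {s\<in>S. A s \<noteq> 0}"
  define k where "k = Min ((\<lambda>s. mdeg (snd s)) ` B)"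
  have B: "finite B" "B \<noteq> {}" using S(1) A by (auto simp: B_def)
  have kmin: "k \<le> mdeg b" if "(a, b) \<in> B" for a b
    unfolding k_def using B that by (intro Min_le) (force intro: rev_image_eqI)+
  have "k \<in> (\<lambda>s. mdeg (snd s)) ` B" unfolding k_def using B by (intro Min_in) auto
  then obtain a0 \<beta> where \<beta>: "(a0, \<beta>) \<in> B" "mdeg \<beta> = k" by auto
  define L where "L = {s\<in>B. mdeg (snd s) = k}"
  have L: "finite L" using B by (simp add: L_def)
  define pT where "pT = (\<Sum>(a, b)\<in>L. single b (A (a, b) * mono_eval \<xi> a))"
  have "eval_at (\<lambda>i. of_nat (l i)) pT = 0" for l :: "nat \<Rightarrow> nat"
  proof -
    \<comment> \<open>The directional derivatives involve \<open>N\<close> variables only, so the others may stay fixed.\<close>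
    obtain w0 where w0: "\<forall>j<c. (\<Sum>i<N. w0 i * eval_at \<xi> (partial i (f j))) = of_nat (l j)"
      using rank[of "\<lambda>j. of_nat (l j)"] by blast
    define w where "w i = (if i < N then w0 i else 0)" for i
    define \<psi> where "\<psi> = along_line \<xi> w"
    note rm = ring_map_along_line[of \<xi> w, folded \<psi>_def]
    define X :: "'b poly" where "X = [:0, 1:]"
    have X0: "X \<noteq> 0" by (simp add: X_def)
    have "\<exists>g. \<psi> (f j) = X * g \<and> poly g 0 = of_nat (l j)" if "j < c" for j
    proof -
      obtain c0 g where g: "\<psi> (f j) = pCons c0 g" using pCons_cases by blast
      have "c0 = 0" using along_line_0[of \<xi> w "f j"] f0[OF that] g by (simp add: \<psi>_def)
      moreover have "coeff (\<psi> (f j)) 1 = of_nat (l j)"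
        unfolding \<psi>_def using w0 that by (subst along_line_1[of N]) (auto simp: w_def)
      then have "poly g 0 = of_nat (l j)" by (simp add: g One_nat_def poly_0_coeff_0)
      ultimately show ?thesis using g by (intro exI[of _ g]) (simp add: X_def)
    qed
    then obtain g where g: "\<And>j. j < c \<Longrightarrow> \<psi> (f j) = X * g j" "\<And>j. j < c \<Longrightarrow> poly (g j) 0 = of_nat (l j)"
      by metis
    have me: "\<psi> (mono_eval f b) = X ^ mdeg b * mono_eval g b" if "keys b \<subseteq> {..<c}" for b
    proof -
      have "\<psi> (mono_eval f b) = (\<Prod>i\<in>keys b. (X * g i) ^ lookup b i)"
        using that g(1) unfolding ring_map_mono_eval[OF rm] unfolding mono_eval_def
        by (intro prod.cong refl) (metis lessThan_iff subset_iff)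
      also have "\<dots> = X ^ mdeg b * mono_eval g b"
        by (simp add: power_mult_distrib prod.distrib mono_eval_def wdeg_def power_sum)
      finally show ?thesis .
    qed
    have "0 = \<psi> (\<Sum>(a, b)\<in>S. Const (A (a, b)) * single a 1 * mono_eval f b)"
      unfolding rel by (simp add: ring_mapD[OF rm])
    also have "\<dots> = (\<Sum>(a, b)\<in>S. \<psi> (Const (A (a, b)) * single a 1 * mono_eval f b))"
      unfolding ring_map_sum[OF rm] by (intro sum.cong) auto
    also have "\<dots> = (\<Sum>(a, b)\<in>B. \<psi> (Const (A (a, b)) * single a 1 * mono_eval f b))"
      unfolding B_def using S(1)
      by (intro sum.mono_neutral_right) (auto simp: Const_simps ring_mapD[OF rm])
    also have "\<dots> = (\<Sum>(a, b)\<in>B. X ^ k * ([:A (a, b):] * \<psi> (single a 1) * X ^ (mdeg b - k) * mono_eval g b))"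
    proof (intro sum.cong refl, clarify)
      fix a b assume ab: "(a, b) \<in> B"
      then have "keys b \<subseteq> {..<c}" using S(2) by (auto simp: B_def)
      moreover have "X ^ mdeg b = X ^ k * X ^ (mdeg b - k)" using kmin[OF ab] by (simp flip: power_add)
      moreover have "\<psi> (Const (A (a, b))) = [:A (a, b):]" by (simp add: \<psi>_def)
      ultimately show "\<psi> (Const (A (a, b)) * single a 1 * mono_eval f b)
          = X ^ k * ([:A (a, b):] * \<psi> (single a 1) * X ^ (mdeg b - k) * mono_eval g b)"
        by (simp add: ring_mapD[OF rm] me ac_simps)
    qed
    also have "\<dots> = X ^ k * (\<Sum>(a, b)\<in>B. [:A (a, b):] * \<psi> (single a 1) * X ^ (mdeg b - k) * mono_eval g b)"
      by (simp add: sum_distrib_left case_prod_unfold)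
    finally have "(\<Sum>(a, b)\<in>B. [:A (a, b):] * \<psi> (single a 1) * X ^ (mdeg b - k) * mono_eval g b) = 0"
      using X0 by simp
    then have "0 = poly (\<Sum>(a, b)\<in>B. [:A (a, b):] * \<psi> (single a 1) * X ^ (mdeg b - k) * mono_eval g b) 0"
      by simp
    also have "\<dots> = (\<Sum>(a, b)\<in>B. A (a, b) * mono_eval \<xi> a * 0 ^ (mdeg b - k) * mono_eval (\<lambda>i. of_nat (l i)) b)"
      unfolding poly_sum
    proof (intro sum.cong refl, clarify)
      fix a b assume ab: "(a, b) \<in> B"
      have kb: "keys b \<subseteq> {..<c}" using ab S(2) by (auto simp: B_def)
      have 1: "poly (mono_eval g b) 0 = mono_eval (\<lambda>i. of_nat (l i)) b"
        unfolding mono_eval_def poly_prod poly_power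
        using kb g(2) by (intro prod.cong refl) (metis lessThan_iff subset_iff)
      have 2: "poly (\<psi> (single a 1)) 0 = mono_eval \<xi> a"
        unfolding \<psi>_def along_line_0 by (simp add: eval_at_simps)
      show "poly ([:A (a, b):] * \<psi> (single a 1) * X ^ (mdeg b - k) * mono_eval g b) 0
          = A (a, b) * mono_eval \<xi> a * 0 ^ (mdeg b - k) * mono_eval (\<lambda>i. of_nat (l i)) b"
        by (simp add: 1 2 X_def)
    qed
    also have "\<dots> = (\<Sum>(a, b)\<in>L. A (a, b) * mono_eval \<xi> a * mono_eval (\<lambda>i. of_nat (l i)) b)"
    proof -
      have "(\<Sum>s\<in>B. A s * mono_eval \<xi> (fst s) * 0 ^ (mdeg (snd s) - k) * mono_eval (\<lambda>i. of_nat (l i)) (snd s))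
        = (\<Sum>s\<in>L. A s * mono_eval \<xi> (fst s) * 0 ^ (mdeg (snd s) - k) * mono_eval (\<lambda>i. of_nat (l i)) (snd s))"
        unfolding L_def using B(1) kmin
        by (intro sum.mono_neutral_right) (auto simp: power_0_left order_antisym)
      then show ?thesis by (simp add: case_prod_unfold L_def)
    qed
    also have "\<dots> = eval_at (\<lambda>i. of_nat (l i)) pT"
      unfolding pT_def by (simp add: eval_at_simps case_prod_unfold)
    finally show ?thesis by simp
  qed
  then have pT0: "pT = 0" using poly_nonvanishing_nat[OF char0] by blast
  define T where "T = {a. (a, \<beta>) \<in> L}"
  have Lf: "finite T" unfolding T_def using L by (rule finite_vimageI[of L "\<lambda>a. (a, \<beta>)", unfolded vimage_def]) (simp add: inj_on_def)
  define h where "h = (\<Sum>a\<in>T. single a (A (a, \<beta>)))"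
  have lh: "lookup h a = (if a \<in> T then A (a, \<beta>) else 0)" for a
    using Lf by (simp add: h_def lookup_sum lookup_single when_def)
  have T: "A (a, \<beta>) \<in> K \<and> keys a \<subseteq> {..<m} \<and> mdeg a \<le> W" if "a \<in> T" for a
    using that S(2)[of a \<beta>] by (auto simp: T_def L_def B_def)
  have kh: "keys h \<subseteq> T" by (auto simp: in_keys_iff lh split: if_splits)
  have "h \<in> polys K {..<m}" unfolding h_def using T
    by (intro polys_sum subfieldD(1)[OF K] polys_single) auto
  moreover have "lookup h a0 \<noteq> 0" using \<beta> by (auto simp: lh T_def L_def B_def)
  then have "h \<noteq> 0" by auto
  moreover have "total_degree h \<le> W" using kh T by (auto simp: total_degree_le_iff)
  moreover have "eval_at \<xi> h = 0"
  proof -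
    have "0 = lookup pT \<beta>" by (simp add: pT0)
    also have "\<dots> = (\<Sum>s\<in>L. if snd s = \<beta> then A s * mono_eval \<xi> (fst s) else 0)"
      by (simp add: pT_def lookup_sum lookup_single when_def case_prod_unfold)
    also have "\<dots> = (\<Sum>s\<in>(\<lambda>a. (a, \<beta>)) ` T. A s * mono_eval \<xi> (fst s))"
      using L by (intro sum.mono_neutral_cong_right) (auto simp: T_def)
    also have "\<dots> = (\<Sum>a\<in>T. A (a, \<beta>) * mono_eval \<xi> a)"
      by (subst sum.reindex) (auto simp: inj_on_def)
    also have "\<dots> = eval_at \<xi> h" by (simp add: h_def eval_at_simps)
    finally show ?thesis by simp
  qed
  ultimately show ?thesis unfolding W_def by blast
qed

section \<open>The total derivative of a polynomial\<close>

lemma derivation_simps: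
  fixes \<Delta> :: "'b::comm_ring_1 \<Rightarrow> 'b"
  assumes "is_derivation \<Delta>"
  shows "\<Delta> (x + y) = \<Delta> x + \<Delta> y" "\<Delta> (x * y) = \<Delta> x * y + x * \<Delta> y" "\<Delta> 0 = 0" "\<Delta> 1 = 0"
    "\<Delta> (- x) = - \<Delta> x" "\<Delta> (x - y) = \<Delta> x - \<Delta> y"
proof -
  show 1: "\<Delta> (x + y) = \<Delta> x + \<Delta> y" "\<Delta> (x * y) = \<Delta> x * y + x * \<Delta> y" for x y
    using assms by (auto simp: is_derivation_def)
  show 2: "\<Delta> 0 = 0" using 1(1)[of 0 0] by simp
  show "\<Delta> 1 = 0" using 1(2)[of 1 1] by simp
  show 3: "\<Delta> (- x) = - \<Delta> x" for x
    using 1(1)[of x "- x"] 2 by (simp add: eq_neg_iff_add_eq_0 add.commute)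
  show "\<Delta> (x - y) = \<Delta> x - \<Delta> y" using 1(1)[of x "- y"] 3[of y] by simp
qed

definition coeff_deriv :: "('b::comm_ring_1 \<Rightarrow> 'b) \<Rightarrow> 'b diff_poly \<Rightarrow> 'b diff_poly" where
  "coeff_deriv \<Delta> p = Poly_Mapping.map \<Delta> p"

text \<open>
  The derivation that extends \<open>\<Delta>\<close> and sends each variable to the next one.
\<close>

definition total_deriv :: "('b::comm_ring_1 \<Rightarrow> 'b) \<Rightarrow> 'b diff_poly \<Rightarrow> 'b diff_poly" where
  "total_deriv \<Delta> p = coeff_deriv \<Delta> p + (\<Sum>i\<in>diff_vars p. Var (Suc i) * partial i p)"

lemma finite_diff_vars [simp]: "finite (diff_vars p)"
  by (simp add: diff_vars_def)

lemma total_deriv_superset: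
  "finite A \<Longrightarrow> diff_vars p \<subseteq> A \<Longrightarrow>
    total_deriv \<Delta> p = coeff_deriv \<Delta> p + (\<Sum>i\<in>A. Var (Suc i) * partial i p)"
  unfolding total_deriv_def
  by (intro arg_cong2[where f = "(+)"] refl sum.mono_neutral_left) (auto simp: partial_eq_0)

lemma diff_vars_add: "diff_vars (p + q) \<subseteq> diff_vars p \<union> diff_vars q"
  using Poly_Mapping.keys_add[of p q] unfolding diff_vars_def by blast

lemma diff_vars_mult: "diff_vars (p * q) \<subseteq> diff_vars p \<union> diff_vars (q :: 'a::comm_ring_1 diff_poly)"
proof -
  have p: "p \<in> polys UNIV (diff_vars p \<union> diff_vars q)" and q: "q \<in> polys UNIV (diff_vars p \<union> diff_vars q)"
    by (auto simp: polys_def diff_vars_def)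
  have "subring (UNIV :: 'a set)" by (simp add: subring_def)
  from polys_vars[OF polys_mult[OF this p q]] show ?thesis .
qed

context
  fixes \<Delta> :: "'b::comm_ring_1 \<Rightarrow> 'b"
  assumes der: "is_derivation \<Delta>"
begin

lemma lookup_coeff_deriv: "lookup (coeff_deriv \<Delta> p) m = \<Delta> (lookup p m)"
  by (simp add: coeff_deriv_def map.rep_eq when_def derivation_simps[OF der])

lemma coeff_deriv_add: "coeff_deriv \<Delta> (p + q) = coeff_deriv \<Delta> p + coeff_deriv \<Delta> q"
  by (rule poly_mapping_eqI) (simp add: lookup_coeff_deriv lookup_add derivation_simps[OF der])

lemma coeff_deriv_single: "coeff_deriv \<Delta> (single m c) = single m (\<Delta> c)"
  by (rule poly_mapping_eqI) (simp add: lookup_coeff_deriv lookup_single when_def derivation_simps[OF der])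

lemma coeff_deriv_mult: "coeff_deriv \<Delta> (p * q) = coeff_deriv \<Delta> p * q + p * coeff_deriv \<Delta> q"
proof -
  have "coeff_deriv \<Delta> (p * q) - (coeff_deriv \<Delta> p * q + p * coeff_deriv \<Delta> q) = 0"
    by (rule biadditive_zero[where B = "\<lambda>p q. coeff_deriv \<Delta> (p * q) - (coeff_deriv \<Delta> p * q + p * coeff_deriv \<Delta> q)"])
      (simp_all add: coeff_deriv_add coeff_deriv_single mult_single derivation_simps[OF der] single_add algebra_simps)
  then show ?thesis by simp
qed

lemma total_deriv_add: "total_deriv \<Delta> (p + q) = total_deriv \<Delta> p + total_deriv \<Delta> q"
proof -
  have "finite (diff_vars p \<union> diff_vars q)" by simp
  then show ?thesis
    using diff_vars_add[of p q]
    by (simp add: total_deriv_superset[of "diff_vars p \<union> diff_vars q"] coeff_deriv_add partial_add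
        algebra_simps sum.distrib)
qed

lemma total_deriv_mult: "total_deriv \<Delta> (p * q) = total_deriv \<Delta> p * q + p * total_deriv \<Delta> q"
proof -
  have "finite (diff_vars p \<union> diff_vars q)" by simp
  then show ?thesis
    using diff_vars_mult[of p q]
    by (simp add: total_deriv_superset[of "diff_vars p \<union> diff_vars q"] coeff_deriv_mult partial_mult
        algebra_simps sum.distrib sum_distrib_left)
qed

lemma total_deriv_Const: "total_deriv \<Delta> (Const c) = Const (\<Delta> c)"
  by (simp add: total_deriv_def Const_def coeff_deriv_single partial_single)

lemma total_deriv_Var: "total_deriv \<Delta> (Var i) = Var (Suc i)"
proof -
  have "diff_vars (Var i :: 'b diff_poly) \<subseteq> {i}" by (auto simp: diff_vars_def Var_def)
  then show ?thesis
    by (simp add: total_deriv_superset[of "{i}"] partial_Var)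
      (simp add: Var_def coeff_deriv_single derivation_simps[OF der])
qed

lemmas total_deriv_simps = total_deriv_add total_deriv_mult total_deriv_Const total_deriv_Var

lemma total_deriv_0: "total_deriv \<Delta> 0 = 0"
  using total_deriv_Const[of 0] by (simp add: Const_simps derivation_simps[OF der])

lemma total_deriv_polys:
  assumes K: "subring K" "\<And>x. x \<in> K \<Longrightarrow> \<Delta> x \<in> K" and p: "p \<in> polys K {..<n}"
  shows "total_deriv \<Delta> p \<in> polys K {..<Suc n}"
proof -
  note k = subringD[OF K(1)]
  have mono: "polys K {..<n} \<subseteq> polys K {..<Suc n}" by (rule polys_mono) auto
  have "p \<in> polys K {..<n} \<and> total_deriv \<Delta> p \<in> polys K {..<Suc n}"
    using p k(1,2)
  proof (induction rule: polys_induct)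
    case (mult p q)
    then have "p \<in> polys K {..<Suc n}" "q \<in> polys K {..<Suc n}" using mono by auto
    with mult show ?case unfolding total_deriv_simps by (intro conjI polys_add polys_mult K(1)) auto
  next
    case (add p q)
    then show ?case unfolding total_deriv_simps by (intro conjI polys_add K(1)) auto
  next
    case (Const c)
    then show ?case unfolding total_deriv_simps by (intro conjI polys_Const K(2))
  next
    case (Var i)
    then show ?case unfolding total_deriv_simps by (intro conjI polys_Var k(2)) auto
  qed (simp_all add: k)
  then show ?thesis by blast
qed

lemma eval_at_total_deriv:
  assumes "\<And>i. \<xi> (Suc i) = \<Delta> (\<xi> i)"
  shows "eval_at \<xi> (total_deriv \<Delta> p) = \<Delta> (eval_at \<xi> p)"
  by (induction p rule: poly_induct)
    (simp_all add: total_deriv_simps eval_at_simps derivation_simps[OF der] assms)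

text \<open>
  The commutator of the two derivations is a derivation, so it suffices to know it on constants and
  variables.
\<close>

lemma partial_total_deriv:
  "partial i (total_deriv \<Delta> p) = total_deriv \<Delta> (partial i p) + (if i = 0 then 0 else partial (i - 1) p)"
proof (induction p rule: poly_induct)
  case (Const c)
  then show ?case by (simp add: total_deriv_simps total_deriv_0)
next
  case (Var j)
  have "total_deriv \<Delta> 1 = 0"
    using total_deriv_Const[of 1] by (simp add: Const_1 Const_simps derivation_simps[OF der])
  then show ?case
    by (cases i) (auto simp: total_deriv_simps partial_Var total_deriv_0 One_nat_def)
next
  case (add p q)
  then show ?case by (simp add: total_deriv_simps partial_add)
next
  case (mult p q)
  then show ?case by (cases i) (simp_all add: total_deriv_simps partial_mult partial_add algebra_simps)
qed

end

lemma total_degree_add_le: "total_degree p \<le> d \<Longrightarrow> total_degree q \<le> d \<Longrightarrow> total_degree (p + q) \<le> d"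
  using Poly_Mapping.keys_add[of p q] by (auto simp: total_degree_le_iff)

lemma total_degree_sum_le:
  "(\<And>i. i \<in> A \<Longrightarrow> total_degree (f i) \<le> d) \<Longrightarrow> total_degree (\<Sum>i\<in>A. f i) \<le> d"
proof (induction A rule: infinite_finite_induct)
  case (insert x F)
  then show ?case by (simp add: total_degree_add_le)
qed (simp_all add: total_degree_le_iff)

lemma mdeg_add_single: "mdeg (m + single i 1) = mdeg m + 1"
  by (simp add: wdeg_add)

lemma total_degree_partial:
  assumes "m \<in> keys (partial i p)"
  shows "mdeg m + 1 \<le> total_degree p"
proof -
  have "m + single i 1 \<in> keys p"
    using assms by (auto simp: in_keys_iff lookup_partial)
  then show ?thesis using total_degree_le_iff[of p "total_degree p"] mdeg_add_single[of m i] by force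
qed

lemma total_degree_partial_le: "total_degree (partial i p) \<le> total_degree p"
  using total_degree_partial by (fastforce simp: total_degree_le_iff)

lemma total_degree_partial_less:
  assumes "partial i p \<noteq> 0"
  shows "total_degree (partial i p) < total_degree p"
  using total_degree_partial[OF lead_props(1)[OF assms, of "\<lambda>_. 1"]] total_degree_lead[OF assms]
  by simp

lemma total_degree_total_deriv:
  fixes p :: "'b::idom diff_poly"
  assumes "is_derivation \<Delta>" "total_degree p \<le> d"
  shows "total_degree (total_deriv \<Delta> p) \<le> d"
proof -
  have "total_degree (coeff_deriv \<Delta> p) \<le> d"
    using assms(2) derivation_simps(3)[OF assms(1)]
    by (auto simp: total_degree_le_iff in_keys_iff lookup_coeff_deriv[OF assms(1)])
  moreover have "total_degree (Var (Suc i) * partial i p) \<le> d" for i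
  proof (cases "partial i p = 0")
    case False
    have "total_degree (Var (Suc i) :: 'b diff_poly) \<le> 1"
      by (simp add: total_degree_le_iff Var_def)
    then show ?thesis
      using total_degree_mult_le[of "Var (Suc i)" "partial i p"] total_degree_partial_less[OF False] assms(2)
      by linarith
  qed (simp add: total_degree_def)
  ultimately show ?thesis
    unfolding total_deriv_def by (intro total_degree_add_le total_degree_sum_le)
qed

lemma partial_neq_0:
  fixes p :: "'b::idom diff_poly"
  assumes char0: "inj (of_nat :: nat \<Rightarrow> 'b)" and "i \<in> diff_vars p"
  shows "partial i p \<noteq> 0"
proof -
  obtain m where m: "m \<in> keys p" "i \<in> keys m" using assms(2) by (auto simp: diff_vars_def)
  then have "m - single i 1 + single i 1 = m"
    by (intro poly_mapping_eqI) (auto simp: lookup_add lookup_minus lookup_single when_def in_keys_iff)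
  moreover have "(of_nat (Suc n) :: 'b) \<noteq> 0" for n
    using injD[OF char0, of "Suc n" 0] by auto
  ultimately have "lookup (partial i p) (m - single i 1) \<noteq> 0"
    using m unfolding lookup_partial by (simp add: in_keys_iff del: of_nat_Suc)
  then show ?thesis by auto
qed

section \<open>Linear differential operators\<close>

text \<open>
  A univariate polynomial stands for the linear differential operator with the same coefficients, the
  \<open>i\<close>-th one belonging to \<open>\<partial>\<^sup>i\<close>.  Composition with \<open>\<partial>\<close> from the left is \<open>\<partial> (a \<partial>\<^sup>i) = a \<partial>\<^sup>i\<^sup>+\<^sup>1 + \<Delta> a \<partial>\<^sup>i\<close>.
\<close>

definition shift :: "('b::comm_ring_1 \<Rightarrow> 'b) \<Rightarrow> 'b poly \<Rightarrow> 'b poly" where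
  "shift \<Delta> \<eta> = map_poly \<Delta> \<eta> + pCons 0 \<eta>"

lemma coeff_shift:
  "is_derivation \<Delta> \<Longrightarrow> coeff (shift \<Delta> \<eta>) i = \<Delta> (coeff \<eta> i) + (if i = 0 then 0 else coeff \<eta> (i - 1))"
  by (cases i) (simp_all add: shift_def coeff_map_poly derivation_simps)

lemma shift_add: "is_derivation \<Delta> \<Longrightarrow> shift \<Delta> (\<eta> + \<zeta>) = shift \<Delta> \<eta> + shift \<Delta> \<zeta>"
  by (rule poly_eqI) (simp add: coeff_shift derivation_simps)

lemma shift_0: "is_derivation \<Delta> \<Longrightarrow> shift \<Delta> 0 = 0"
  by (rule poly_eqI) (simp add: coeff_shift derivation_simps)

lemma shift_smult: "is_derivation \<Delta> \<Longrightarrow> shift \<Delta> (smult c \<eta>) = smult c (shift \<Delta> \<eta>) + smult (\<Delta> c) \<eta>"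
  by (rule poly_eqI) (simp add: coeff_shift derivation_simps algebra_simps)

lemma degree_shift:
  assumes "is_derivation \<Delta>" "\<eta> \<noteq> 0"
  shows "degree (shift \<Delta> \<eta>) = degree \<eta> + 1" "coeff (shift \<Delta> \<eta>) (degree \<eta> + 1) = lead_coeff \<eta>"
    "shift \<Delta> \<eta> \<noteq> 0"
proof -
  show 1: "coeff (shift \<Delta> \<eta>) (degree \<eta> + 1) = lead_coeff \<eta>"
    by (simp add: coeff_shift assms coeff_eq_0 derivation_simps)
  then show 2: "shift \<Delta> \<eta> \<noteq> 0" using assms(2) by auto
  have "degree (shift \<Delta> \<eta>) \<le> degree \<eta> + 1"
    by (intro degree_le allI impI) (auto simp: coeff_shift assms coeff_eq_0 derivation_simps)
  moreover have "degree \<eta> + 1 \<le> degree (shift \<Delta> \<eta>)"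
    using 1 assms(2) by (intro le_degree) auto
  ultimately show "degree (shift \<Delta> \<eta>) = degree \<eta> + 1" by simp
qed

lemma degree_shift_funpow:
  assumes "is_derivation \<Delta>" "\<eta> \<noteq> 0"
  shows "degree ((shift \<Delta> ^^ k) \<eta>) = degree \<eta> + k \<and> lead_coeff ((shift \<Delta> ^^ k) \<eta>) = lead_coeff \<eta>
    \<and> (shift \<Delta> ^^ k) \<eta> \<noteq> 0"
proof (induction k)
  case (Suc k)
  then have "coeff ((shift \<Delta> ^^ k) \<eta>) (degree \<eta> + k) = lead_coeff \<eta>" by metis
  with Suc show ?case using degree_shift[OF assms(1), of "(shift \<Delta> ^^ k) \<eta>"] by simp
qed (simp add: assms)

lemma total_degree_diff_le: "total_degree p \<le> d \<Longrightarrow> total_degree q \<le> d \<Longrightarrow> total_degree (p - q) \<le> d"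
  for p q :: "'b::comm_ring_1 diff_poly"
  using total_degree_add_le[of p d "- q"] by (simp add: total_degree_le_iff in_keys_iff)

lemma smult_cancel: "c \<noteq> 0 \<Longrightarrow> smult c p = smult c q \<longleftrightarrow> p = q" for c :: "'b::field"
  by (auto simp: poly_eq_iff)

text \<open>
  The linearisation of \<open>p\<close> at the point \<open>\<xi>\<close>, read as a differential operator.
\<close>

definition gradient :: "(nat \<Rightarrow> 'b::comm_ring_1) \<Rightarrow> 'b diff_poly \<Rightarrow> 'b poly" where
  "gradient \<xi> p = (\<Sum>i\<in>diff_vars p. monom (eval_at \<xi> (partial i p)) i)"

lemma coeff_gradient: "coeff (gradient \<xi> p) i = eval_at \<xi> (partial i p)"
proof -
  have "coeff (gradient \<xi> p) i = (\<Sum>j\<in>diff_vars p. if j = i then eval_at \<xi> (partial j p) else 0)"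
    by (simp add: gradient_def coeff_sum)
  also have "\<dots> = (if i \<in> diff_vars p then eval_at \<xi> (partial i p) else 0)" by simp
  finally show ?thesis by (simp add: partial_eq_0 eval_at_simps)
qed

text \<open>
  Deriving an equation composes its linearisation with \<open>\<partial>\<close>.
\<close>

lemma gradient_total_deriv:
  assumes "is_derivation \<Delta>" "\<And>i. \<xi> (Suc i) = \<Delta> (\<xi> i)"
  shows "gradient \<xi> (total_deriv \<Delta> p) = shift \<Delta> (gradient \<xi> p)"
  by (rule poly_eqI)
    (simp add: coeff_gradient coeff_shift assms partial_total_deriv eval_at_simps eval_at_total_deriv)

section \<open>Fractions and their differentials\<close>

text \<open>
  The base field is treated as a subset \<open>F\<close> of the big field, so that polynomials over \<open>F\<close>, over the
  generated field and over the big field have one type and are told apart by \<open>polys\<close>.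
\<close>

locale transcendental_extension =
  fixes \<Delta> :: "'b::field \<Rightarrow> 'b" and F :: "'b set" and u :: 'b
  assumes der: "is_derivation \<Delta>"
    and F: "differential_subfield \<Delta> F"
    and char0: "inj (of_nat :: nat \<Rightarrow> 'b)"
    and indep: "\<And>p. p \<in> polys F UNIV \<Longrightarrow> eval_at (\<lambda>i. (\<Delta> ^^ i) u) p = 0 \<Longrightarrow> p = 0"
begin

abbreviation prolong :: "'b \<Rightarrow> nat \<Rightarrow> 'b" where
  "prolong x \<equiv> \<lambda>i. (\<Delta> ^^ i) x"

abbreviation E :: "'b diff_poly \<Rightarrow> 'b" where
  "E \<equiv> eval_at (prolong u)"

lemmas der_simps = derivation_simps[OF der]

lemma subfield_of_differential: "differential_subfield \<Delta> K \<Longrightarrow> subfield K"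
  by (auto simp: differential_subfield_def subfield_def subring_def)

lemma F_subfield: "subfield F" and F_subring: "subring F"
  using subfield_of_differential[OF F] subfieldD(1) by auto

lemma F_deriv: "x \<in> F \<Longrightarrow> \<Delta> x \<in> F"
  using F by (auto simp: differential_subfield_def)

lemmas F_simps = subringD[OF F_subring]

lemma polysF: "subring (polys F X)"
  by (rule subring_polys[OF F_subring])

lemma polysF_total_deriv:
  assumes "p \<in> polys F UNIV"
  shows "total_deriv \<Delta> p \<in> polys F UNIV"
proof -
  have "finite (diff_vars p)" by simp
  then obtain n where "diff_vars p \<subseteq> {..<n}" by (meson finite_nat_iff_bounded)
  then have "p \<in> polys F {..<n}" using assms by (fastforce simp: polys_def diff_vars_def)
  then have "total_deriv \<Delta> p \<in> polys F {..<Suc n}"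
    using total_deriv_polys[OF der F_subring] F_deriv by blast
  then show ?thesis using polys_mono[of F F "{..<Suc n}" UNIV] by auto
qed

text \<open>
  The differential field generated by \<open>w\<close> over \<open>F\<close>, in the explicit form of quotients of differential
  polynomials in \<open>w\<close>.
\<close>

definition fractions :: "'b \<Rightarrow> 'b set" where
  "fractions w = {x. \<exists>p\<in>polys F UNIV. \<exists>q\<in>polys F UNIV.
     eval_at (prolong w) q \<noteq> 0 \<and> eval_at (prolong w) q * x = eval_at (prolong w) p}"

lemma fractionsI:
  assumes "p \<in> polys F UNIV" "q \<in> polys F UNIV" "eval_at (prolong w) q \<noteq> 0"
    "eval_at (prolong w) q * x = eval_at (prolong w) p"
  shows "x \<in> fractions w"
  using assms by (auto simp: fractions_def)

lemma fractions_polys: "p \<in> polys F UNIV \<Longrightarrow> eval_at (prolong w) p \<in> fractions w"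
  by (rule fractionsI[of p 1]) (auto simp: eval_at_simps subringD[OF polysF])

lemma fractions_differential_subfield: "differential_subfield \<Delta> (fractions w)"
  unfolding differential_subfield_def
proof (intro conjI ballI)
  note pF = subringD[OF polysF[of UNIV]]
  show "0 \<in> fractions w" "1 \<in> fractions w"
    using fractions_polys[of 0 w] fractions_polys[of 1 w] pF by (simp_all add: eval_at_simps)
  fix x assume "x \<in> fractions w"
  then obtain p q where p: "p \<in> polys F UNIV" "q \<in> polys F UNIV" "eval_at (prolong w) q \<noteq> 0"
    "eval_at (prolong w) q * x = eval_at (prolong w) p" by (auto simp: fractions_def)
  {
    fix y assume "y \<in> fractions w"
    then obtain p' q' where p': "p' \<in> polys F UNIV" "q' \<in> polys F UNIV" "eval_at (prolong w) q' \<noteq> 0"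
      "eval_at (prolong w) q' * y = eval_at (prolong w) p'" by (auto simp: fractions_def)
    show "x + y \<in> fractions w"
      by (rule fractionsI[of "p * q' + p' * q" "q * q'"])
        (use p(1-3) p'(1-3) in \<open>auto simp: eval_at_simps pF algebra_simps simp flip: p(4) p'(4)\<close>)
    show "x - y \<in> fractions w"
      by (rule fractionsI[of "p * q' - p' * q" "q * q'"])
        (use p(1-3) p'(1-3) in \<open>auto simp: eval_at_simps pF algebra_simps simp flip: p(4) p'(4)\<close>)
    show "x * y \<in> fractions w"
      by (rule fractionsI[of "p * p'" "q * q'"])
        (use p(1-3) p'(1-3) in \<open>auto simp: eval_at_simps pF algebra_simps simp flip: p(4) p'(4)\<close>)
  }
  show "inverse x \<in> fractions w"
  proof (cases "x = 0")
    case True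
    then show ?thesis using \<open>0 \<in> fractions w\<close> by simp
  next
    case False
    then show ?thesis
      using p by (intro fractionsI[of q p]) (auto simp flip: p(4) simp: field_simps)
  qed
  have 1: "eval_at (prolong w) (total_deriv \<Delta> r) = \<Delta> (eval_at (prolong w) r)" for r
    by (rule eval_at_total_deriv[OF der]) simp
  have "eval_at (prolong w) q * \<Delta> x = \<Delta> (eval_at (prolong w) p) - \<Delta> (eval_at (prolong w) q) * x"
    by (simp add: der_simps flip: p(4))
  then show "\<Delta> x \<in> fractions w"
    using p(1-3) by (intro fractionsI[of "total_deriv \<Delta> p * q - total_deriv \<Delta> q * p" "q * q"])
      (auto simp: eval_at_simps pF polysF_total_deriv 1 der_simps algebra_simps simp flip: p(4))
qed

lemma fractions_base: "F \<subseteq> fractions w" "w \<in> fractions w"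
  using fractions_polys[of "Const _" w] fractions_polys[of "Var 0" w] F_simps
  by (auto simp: eval_at_simps polys_Const polys_Var)

abbreviation L :: "'b set" where
  "L \<equiv> fractions u"

lemmas L_subring = subfieldD(1)[OF subfield_of_differential[OF fractions_differential_subfield[of u]]]
lemmas L_simps = subringD[OF L_subring]

lemma L_deriv: "x \<in> L \<Longrightarrow> \<Delta> x \<in> L"
  using fractions_differential_subfield[of u] by (auto simp: differential_subfield_def)

lemma L_inverse: "x \<in> L \<Longrightarrow> inverse x \<in> L"
  using fractions_differential_subfield[of u] by (auto simp: differential_subfield_def)

definition frac_of :: "'b diff_poly \<Rightarrow> 'b diff_poly \<Rightarrow> 'b \<Rightarrow> bool" where
  "frac_of p q x \<longleftrightarrow> p \<in> polys F UNIV \<and> q \<in> polys F UNIV \<and> q \<noteq> 0 \<and> E q * x = E p"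

lemma E_eq_0_iff: "p \<in> polys F UNIV \<Longrightarrow> E p = 0 \<longleftrightarrow> p = 0"
  using indep by (auto simp: eval_at_simps)

lemma E_eq_iff: "p \<in> polys F UNIV \<Longrightarrow> q \<in> polys F UNIV \<Longrightarrow> E p = E q \<longleftrightarrow> p = q"
  using E_eq_0_iff[of "p - q"] subringD(4)[OF polysF] by (auto simp: eval_at_simps)

lemma frac_of_nz: "frac_of p q x \<Longrightarrow> E q \<noteq> 0"
  using E_eq_0_iff by (auto simp: frac_of_def)

lemma L_iff: "x \<in> L \<longleftrightarrow> (\<exists>p q. frac_of p q x)"
  unfolding fractions_def frac_of_def using E_eq_0_iff by auto

text \<open>
  The differential of \<open>x = p / q\<close> is \<open>(dp - x dq) / q\<close>; its \<open>i\<close>-th coefficient is \<open>\<partial>x / \<partial>u\<^sup>(\<^sup>i\<^sup>)\<close>.  It does not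
  depend on the fraction chosen because \<open>p q' = p' q\<close> may be differentiated (\<open>differential_eq\<close>).
\<close>

definition differential :: "'b \<Rightarrow> 'b poly" where
  "differential x = (THE \<eta>. \<forall>p q. frac_of p q x \<longrightarrow>
     smult (E q) \<eta> = gradient (prolong u) p - smult x (gradient (prolong u) q))"

abbreviation gr :: "'b diff_poly \<Rightarrow> 'b poly" where
  "gr \<equiv> gradient (prolong u)"

lemma gr_mult: "gr (p * q) = smult (E q) (gr p) + smult (E p) (gr q)"
  by (rule poly_eqI) (simp add: coeff_gradient partial_mult eval_at_simps)

lemma gr_add: "gr (p + q) = gr p + gr q"
  by (rule poly_eqI) (simp add: coeff_gradient partial_add eval_at_simps)

lemma differential_eq:
  assumes "frac_of p q x"
  shows "smult (E q) (differential x) = gr p - smult x (gr q)"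
proof -
  define \<eta> where "\<eta> = smult (inverse (E q)) (gr p - smult x (gr q))"
  have q0: "E q \<noteq> 0" using frac_of_nz[OF assms] .
  have all: "smult (E q') \<eta> = gr p' - smult x (gr q')" if f: "frac_of p' q' x" for p' q'
  proof -
    have **: "E p = E q * x" "E p' = E q' * x" using f assms by (auto simp: frac_of_def)
    then have "E (p * q') = E (p' * q)" by (simp add: eval_at_simps)
    then have "p * q' = p' * q"
      using f assms subringD(5)[OF polysF] by (subst (asm) E_eq_iff) (auto simp: frac_of_def)
    then have "gr (p * q') = gr (p' * q)" by simp
    then have *: "coeff (gr p) i * E q' + E p * coeff (gr q') i = coeff (gr p') i * E q + E p' * coeff (gr q) i" for i
      by (simp add: gr_mult poly_eq_iff ac_simps)
    show ?thesis
    proof (rule poly_eqI)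
      fix i
      have "E q * (coeff (gr p') i - x * coeff (gr q') i) = E q' * (coeff (gr p) i - x * coeff (gr q) i)"
        using *[of i] unfolding ** by (simp add: algebra_simps)
      then have "inverse (E q) * (E q * (coeff (gr p') i - x * coeff (gr q') i))
          = E q' * (inverse (E q) * (coeff (gr p) i - x * coeff (gr q) i))" by simp
      then show "coeff (smult (E q') \<eta>) i = coeff (gr p' - smult x (gr q')) i"
        using q0 by (simp add: \<eta>_def flip: mult.assoc)
    qed
  qed
  have "differential x = \<eta>"
    unfolding differential_def
  proof (rule the_equality)
    show "\<forall>p q. frac_of p q x \<longrightarrow> smult (E q) \<eta> = gr p - smult x (gr q)" using all by blast
  next
    fix \<zeta> assume "\<forall>p q. frac_of p q x \<longrightarrow> smult (E q) \<zeta> = gr p - smult x (gr q)"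
    then have "smult (E q) \<zeta> = smult (E q) \<eta>" using all[OF assms] assms by simp
    then show "\<zeta> = \<eta>" using q0 by (simp add: smult_cancel)
  qed
  then show ?thesis using all[OF assms] by simp
qed

lemma coeff_differential_eq:
  "frac_of p q x \<Longrightarrow> E q * coeff (differential x) i = coeff (gr p) i - x * coeff (gr q) i"
  using arg_cong[OF differential_eq, of p q x "\<lambda>r. coeff r i"] by simp

lemma differential_E: "p \<in> polys F UNIV \<Longrightarrow> differential (E p) = gr p"
proof -
  assume "p \<in> polys F UNIV"
  then have "frac_of p 1 (E p)" using subringD(2)[OF polysF] by (simp add: frac_of_def eval_at_simps)
  from differential_eq[OF this] show ?thesis
    using coeff_gradient[of "prolong u" 1] by (simp add: eval_at_simps poly_eq_iff flip: Const_1)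
qed

lemma differential_add:
  assumes "x \<in> L" "y \<in> L"
  shows "differential (x + y) = differential x + differential y"
proof (rule poly_eqI)
  fix i
  obtain p q p' q' where f: "frac_of p q x" "frac_of p' q' y" using assms by (auto simp: L_iff)
  note nz = frac_of_nz[OF f(1)] frac_of_nz[OF f(2)]
  have **: "E p = E q * x" "E p' = E q' * y" using f by (auto simp: frac_of_def)
  have "E (q * q') * (x + y) = E (p * q' + p' * q)" by (simp add: eval_at_simps ** algebra_simps)
  then have "frac_of (p * q' + p' * q) (q * q') (x + y)"
    using f subringD[OF polysF[of UNIV]] by (auto simp: frac_of_def)
  from coeff_differential_eq[OF this, of i]
  have "E q * E q' * coeff (differential (x + y)) i = E q' * (coeff (gr p) i - x * coeff (gr q) i)
      + E q * (coeff (gr p') i - y * coeff (gr q') i)"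
    by (simp add: gr_add gr_mult eval_at_simps ** algebra_simps)
  also have "\<dots> = E q * E q' * (coeff (differential x) i + coeff (differential y) i)"
    unfolding coeff_differential_eq[OF f(1), symmetric] coeff_differential_eq[OF f(2), symmetric]
    by (simp add: algebra_simps)
  finally show "coeff (differential (x + y)) i = coeff (differential x + differential y) i" using nz by simp
qed

lemma differential_mult:
  assumes "x \<in> L" "y \<in> L"
  shows "differential (x * y) = smult y (differential x) + smult x (differential y)"
proof (rule poly_eqI)
  fix i
  obtain p q p' q' where f: "frac_of p q x" "frac_of p' q' y" using assms by (auto simp: L_iff)
  note nz = frac_of_nz[OF f(1)] frac_of_nz[OF f(2)]
  have **: "E p = E q * x" "E p' = E q' * y" using f by (auto simp: frac_of_def)
  have "frac_of (p * p') (q * q') (x * y)"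
    using f subringD[OF polysF[of UNIV]] by (auto simp: frac_of_def eval_at_simps algebra_simps **)
  from coeff_differential_eq[OF this, of i]
  have "E q * E q' * coeff (differential (x * y)) i = E q' * y * (coeff (gr p) i - x * coeff (gr q) i)
      + E q * x * (coeff (gr p') i - y * coeff (gr q') i)"
    by (simp add: gr_add gr_mult eval_at_simps ** algebra_simps)
  also have "\<dots> = E q * E q' * (y * coeff (differential x) i + x * coeff (differential y) i)"
    unfolding coeff_differential_eq[OF f(1), symmetric] coeff_differential_eq[OF f(2), symmetric]
    by (simp add: algebra_simps)
  finally show "coeff (differential (x * y)) i = coeff (smult y (differential x) + smult x (differential y)) i" using nz by simp
qed

lemma differential_F: "c \<in> F \<Longrightarrow> differential c = 0"
  using differential_E[of "Const c"] coeff_gradient[of "prolong u" "Const c"]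
  by (simp add: eval_at_simps polys_Const poly_eq_iff)

lemma differential_minus: "x \<in> L \<Longrightarrow> y \<in> L \<Longrightarrow> differential (x - y) = differential x - differential y"
  using differential_add[of "x - y" y] L_simps by simp

lemma differential_inverse: "x \<in> L \<Longrightarrow> x \<noteq> 0 \<Longrightarrow> differential (inverse x) = smult (- (inverse x ^ 2)) (differential x)"
proof -
  assume x: "x \<in> L" "x \<noteq> 0"
  have "0 = differential (x * inverse x)" using differential_F[of 1] x F_simps by simp
  also have "\<dots> = smult (inverse x) (differential x) + smult x (differential (inverse x))"
    by (rule differential_mult[OF x(1) L_inverse[OF x(1)]])
  finally have "smult (inverse x) (smult x (differential (inverse x))) = smult (inverse x) (- smult (inverse x) (differential x))"
    by (metis add.commute eq_neg_iff_add_eq_0)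
  then show ?thesis using x by (simp add: power2_eq_square)
qed

text \<open>
  For polynomial expressions in \<open>u\<close> this is \<open>gradient_total_deriv\<close>; the product rule, applied to
  \<open>q x = p\<close> before and after derivation, carries it over to fractions.
\<close>

lemma differential_deriv:
  assumes "x \<in> L"
  shows "differential (\<Delta> x) = shift \<Delta> (differential x)"
proof -
  obtain p q where f: "frac_of p q x" using assms by (auto simp: L_iff)
  define a b where "a = E p" and "b = E q"
  have b0: "b \<noteq> 0" using frac_of_nz[OF f] by (simp add: b_def)
  have pq: "p \<in> polys F UNIV" "q \<in> polys F UNIV" and ba: "b * x = a"
    using f by (auto simp: frac_of_def a_def b_def)
  have *: "differential (\<Delta> (E r)) = shift \<Delta> (differential (E r))" "E r \<in> L" if "r \<in> polys F UNIV" for r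
  proof -
    have "\<Delta> (E r) = E (total_deriv \<Delta> r)" by (rule eval_at_total_deriv[OF der, symmetric]) simp
    then show "differential (\<Delta> (E r)) = shift \<Delta> (differential (E r))"
      using differential_E[OF that] differential_E[OF polysF_total_deriv[OF that]] by (simp add: gradient_total_deriv[OF der])
    show "E r \<in> L" using fractions_polys[OF that] .
  qed
  have L: "b \<in> L" "\<Delta> b \<in> L" "\<Delta> x \<in> L" "x \<in> L"
    using *(2)[OF pq(2)] assms L_deriv by (auto simp: b_def)
  have "differential (\<Delta> a) = shift \<Delta> (differential a)" "differential (\<Delta> b) = shift \<Delta> (differential b)"
    using * pq by (auto simp: a_def b_def)
  moreover have "differential (\<Delta> a) = smult x (differential (\<Delta> b)) + smult (\<Delta> b) (differential x)
      + (smult (\<Delta> x) (differential b) + smult b (differential (\<Delta> x)))"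
    using L by (simp flip: ba add: der_simps differential_add differential_mult L_simps)
  moreover have "shift \<Delta> (differential a) = smult x (shift \<Delta> (differential b)) + smult (\<Delta> x) (differential b)
      + (smult b (shift \<Delta> (differential x)) + smult (\<Delta> b) (differential x))"
    using L by (simp flip: ba add: differential_mult shift_add[OF der] shift_smult[OF der])
  ultimately have "smult b (differential (\<Delta> x)) = smult b (shift \<Delta> (differential x))" by simp
  then show ?thesis using b0 by (simp add: smult_cancel)
qed

definition shift_submodule :: "'b poly set \<Rightarrow> bool" where
  "shift_submodule J \<longleftrightarrow> 0 \<in> J \<and> (\<forall>\<eta>\<in>J. \<forall>\<zeta>\<in>J. \<eta> + \<zeta> \<in> J) \<and> (\<forall>c. \<forall>\<eta>\<in>J. smult c \<eta> \<in> J)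
     \<and> (\<forall>\<eta>\<in>J. shift \<Delta> \<eta> \<in> J)"

text \<open>
  This translates membership in a generated differential field into membership of differentials in a
  generated left module.
\<close>

lemma differential_subfield_of_submodule:
  assumes "shift_submodule J"
  shows "differential_subfield \<Delta> {x\<in>L. differential x \<in> J}" "F \<subseteq> {x\<in>L. differential x \<in> J}"
proof -
  note j = assms[unfolded shift_submodule_def]
  have neg: "\<eta> - \<zeta> \<in> J" if "\<eta> \<in> J" "\<zeta> \<in> J" for \<eta> \<zeta>
  proof -
    have "\<eta> + smult (-1) \<zeta> \<in> J" using j that by blast
    then show ?thesis by simp
  qed
  show "F \<subseteq> {x\<in>L. differential x \<in> J}" using fractions_base(1)[of u] differential_F j by auto
  have inv: "differential (inverse x) \<in> J" if "x \<in> L" "differential x \<in> J" for x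
  proof (cases "x = 0")
    case True
    then show ?thesis using j by (simp add: differential_F F_simps)
  next
    case False
    have "smult (- (inverse x ^ 2)) (differential x) \<in> J" using j that by blast
    then show ?thesis using differential_inverse[OF that(1) False] by simp
  qed
  show "differential_subfield \<Delta> {x\<in>L. differential x \<in> J}"
    unfolding differential_subfield_def
    using j by (auto simp: L_simps L_inverse L_deriv differential_F F_simps differential_add differential_minus differential_mult differential_deriv neg inv)
qed

text \<open>
  Fractions can be made free of the variables on which they do not depend, without raising degrees:
  if \<open>\<partial>x / \<partial>u\<^sup>(\<^sup>i\<^sup>) = 0\<close> and \<open>q x = p\<close>, then also \<open>(\<partial>q / \<partial>y\<^sub>i) x = \<partial>p / \<partial>y\<^sub>i\<close>, which is
  a fraction with a denominator of smaller degree unless \<open>q\<close> does not involve \<open>y\<^sub>i\<close>.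
\<close>

lemma bounded_representation:
  assumes x: "frac_of p q x" and d: "total_degree p \<le> d" "total_degree q \<le> d"
    and X: "\<And>i. i \<in> X \<Longrightarrow> coeff (differential x) i = 0"
  shows "\<exists>p q. frac_of p q x \<and> total_degree p \<le> d \<and> total_degree q \<le> d
    \<and> p \<in> polys F (- X) \<and> q \<in> polys F (- X)"
proof -
  define R where "R q = (\<exists>p. frac_of p q x \<and> total_degree p \<le> d \<and> total_degree q \<le> d)" for q
  have "R q" using x d by (auto simp: R_def)
  then obtain q where "R q" and min: "\<And>q'. R q' \<Longrightarrow> total_degree q \<le> total_degree q'"
    by (metis (full_types) arg_min_nat_lemma)
  then obtain p where p: "frac_of p q x" "total_degree p \<le> d" "total_degree q \<le> d" by (auto simp: R_def)
  have pd: "E (partial i q) * x = E (partial i p)" if "i \<in> X" for i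
    using coeff_differential_eq[OF p(1), of i] X[OF that] by (simp add: coeff_gradient mult.commute)
  have part: "partial i r \<in> polys F UNIV" if "r \<in> polys F UNIV" for i r
    using polys_partial[OF F_subring that] .
  have q: "partial i q = 0" if "i \<in> X" for i
  proof (rule ccontr)
    assume nz: "partial i q \<noteq> 0"
    have "frac_of (partial i p) (partial i q) x"
      using p(1) pd[OF that] nz part by (auto simp: frac_of_def)
    moreover have "total_degree (partial i p) \<le> d" "total_degree (partial i q) \<le> d"
      using p total_degree_partial_le le_trans by blast+
    ultimately have "R (partial i q)" by (auto simp: R_def)
    from min[OF this] total_degree_partial_less[OF nz] show False by simp
  qed
  have p0: "partial i p = 0" if "i \<in> X" for i
    using pd[OF that] q[OF that] p(1) part E_eq_0_iff[of "partial i p"] by (auto simp: frac_of_def eval_at_simps)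
  have "r \<in> polys F (- X)" if "r \<in> polys F UNIV" "\<And>i. i \<in> X \<Longrightarrow> partial i r = 0" for r
  proof -
    have "diff_vars r \<inter> X = {}" using partial_neq_0[OF char0] that by blast
    then show ?thesis using that(1) by (fastforce simp: polys_def diff_vars_def)
  qed
  then show ?thesis using p q p0 unfolding frac_of_def by blast
qed

lemma differential_eq_0_imp:
  assumes "x \<in> L" "differential x = 0"
  shows "x \<in> F"
proof -
  obtain p q where "frac_of p q x" using assms by (auto simp: L_iff)
  then obtain p q where pq: "frac_of p q x" "p \<in> polys F {}" "q \<in> polys F {}"
    using bounded_representation[of p q x "max (total_degree p) (total_degree q)" UNIV] assms(2) by auto
  have "E r \<in> F" if "r \<in> polys F {}" for r
    unfolding eval_at_def by (rule poly_eval_in_subring[OF F_subring _ _ that]) auto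
  moreover have "x = E p / E q" using pq(1) frac_of_nz[OF pq(1)] by (auto simp: frac_of_def field_simps)
  ultimately show ?thesis using subfieldD(3)[OF F_subfield] pq by auto
qed

end

section \<open>From relations over the generated field to a fraction\<close>

context transcendental_extension
begin

lemma prolong_L: "w \<in> L \<Longrightarrow> prolong w k \<in> L"
  by (induction k) (auto intro: L_deriv)

lemma differential_prolong: "w \<in> L \<Longrightarrow> differential (prolong w k) = (shift \<Delta> ^^ k) (differential w)"
  by (induction k) (auto simp: differential_deriv prolong_L)

lemma differential_generator: "differential (prolong u k) = monom 1 k"
proof (rule poly_eqI)
  fix i
  have "differential (E (Var k)) = gr (Var k)" by (rule differential_E) (simp add: polys_Var F_simps)
  then show "coeff (differential (prolong u k)) i = coeff (monom 1 k) i"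
    by (auto simp: eval_at_simps coeff_gradient partial_Var)
qed

text \<open>
  The fractions that depend on \<open>u, \<dots>, u\<^sup>(\<^sup>m\<^sup>)\<close> only.
\<close>

definition order_le :: "nat \<Rightarrow> 'b set" where
  "order_le m = {x\<in>L. \<forall>j>m. coeff (differential x) j = 0}"

lemma order_le_subring: "subring (order_le m)"
  by (auto simp: subring_def order_le_def L_simps differential_F F_simps differential_add differential_minus differential_mult)

lemma order_le_base: "F \<subseteq> order_le m" "i \<le> m \<Longrightarrow> prolong u i \<in> order_le m"
  using fractions_base[of u] prolong_L[of u i]
  by (auto simp: order_le_def differential_F differential_generator)

text \<open>
  The derivatives \<open>v', v'', \<dots>\<close> are algebraically independent over the fractions of order at most \<open>m\<close>.
  If \<open>v\<^sup>(\<^sup>k\<^sup>)\<close> is the highest derivative in a relation of least degree, differentiate the relation with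
  respect to \<open>u\<^sup>(\<^sup>m\<^sup>+\<^sup>k\<^sup>)\<close>: only \<open>v\<^sup>(\<^sup>k\<^sup>)\<close> depends on it, with the nonzero derivative \<open>\<partial>v / \<partial>u\<^sup>(\<^sup>m\<^sup>)\<close>, and so the
  partial derivative of the relation is a relation of smaller degree.
\<close>

lemma prolong_independent:
  assumes v: "v \<in> L" "differential v \<noteq> 0" and "R \<in> polys (order_le (degree (differential v))) {1..}"
    and "eval_at (prolong v) R = 0"
  shows "R = 0"
  using assms(3,4)
proof (induction "total_degree R" arbitrary: R rule: less_induct)
  case less
  define m where "m = degree (differential v)"
  note sr = order_le_subring[of m]
  show ?case
  proof (cases "diff_vars R = {}")
    case True
    then have "keys R \<subseteq> {0}" by (auto simp: diff_vars_def)
    then have R: "R = Const (lookup R 0)"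
      by (intro poly_mapping_eqI) (auto simp: Const_def lookup_single when_def in_keys_iff)
    then have "lookup R 0 = 0" using less.prems(2) eval_at_simps(1) by metis
    then show ?thesis using R by (simp add: Const_simps)
  next
    case False
    define k where "k = Max (diff_vars R)"
    have k: "k \<in> diff_vars R" "\<And>i. i \<in> diff_vars R \<Longrightarrow> i \<le> k"
      using False by (auto simp: k_def)
    have k1: "k \<ge> 1" using k(1) polys_vars[OF less.prems(1)] by auto
    have Rk: "R \<in> polys (order_le m) {..k}"
      using less.prems(1) k(2) by (fastforce simp: polys_def diff_vars_def m_def)
    have dv: "coeff (differential (prolong v i)) (m + k) = (if i = k then lead_coeff (differential v) else 0)" if "i \<le> k" for i
      using degree_shift_funpow[OF der v(2), of i] that v(1)
      by (auto simp: differential_prolong m_def intro!: coeff_eq_0)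
    have "eval_at (prolong v) R \<in> L \<and>
        coeff (differential (eval_at (prolong v) R)) (m + k) = eval_at (prolong v) (partial k R) * lead_coeff (differential v)"
      using Rk
    proof (induction rule: polys_induct)
      case (Const c)
      then show ?case using k1 by (simp add: eval_at_simps order_le_def)
    next
      case (Var i)
      then show ?case using dv[of i] prolong_L[OF v(1), of i] by (auto simp: eval_at_simps partial_Var)
    next
      case (add p q)
      then show ?case by (simp add: eval_at_simps partial_add L_simps differential_add algebra_simps)
    next
      case (mult p q)
      then show ?case by (simp add: eval_at_simps partial_mult L_simps differential_mult algebra_simps)
    qed (simp_all add: subringD[OF sr])
    then have "eval_at (prolong v) (partial k R) = 0"
      using less.prems(2) v(2) by (simp add: differential_F F_simps)
    moreover have "partial k R \<in> polys (order_le m) {1..}"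
      using polys_partial[OF sr less.prems(1)[folded m_def]] .
    moreover have nz: "partial k R \<noteq> 0" by (rule partial_neq_0[OF char0 k(1)])
    ultimately show ?thesis
      using less.hyps[of "partial k R"] total_degree_partial_less[OF nz] by (auto simp: m_def)
  qed
qed

lemma common_denominator:
  assumes "finite A" "\<And>a. a \<in> A \<Longrightarrow> c a \<in> fractions w"
  shows "\<exists>Q r. Q \<noteq> 0 \<and> (\<forall>a\<in>A. r a \<in> polys F UNIV \<and> eval_at (prolong w) (r a) = Q * c a)"
proof -
  have "\<forall>a\<in>A. \<exists>p q. p \<in> polys F UNIV \<and> q \<in> polys F UNIV \<and> eval_at (prolong w) q \<noteq> 0 \<and>
      eval_at (prolong w) q * c a = eval_at (prolong w) p"
    using assms(2) by (fastforce simp: fractions_def)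
  then obtain p q where pq: "\<And>a. a \<in> A \<Longrightarrow> p a \<in> polys F UNIV \<and> q a \<in> polys F UNIV \<and>
      eval_at (prolong w) (q a) \<noteq> 0 \<and> eval_at (prolong w) (q a) * c a = eval_at (prolong w) (p a)"
    by metis
  define Q where "Q = (\<Prod>a\<in>A. eval_at (prolong w) (q a))"
  define r where "r a = p a * (\<Prod>b\<in>A - {a}. q b)" for a
  have "Q \<noteq> 0" using pq assms(1) by (simp add: Q_def)
  moreover have "r a \<in> polys F UNIV" if "a \<in> A" for a
    using pq that unfolding r_def by (intro subringD(5)[OF polysF] subring_prod[OF polysF]) auto
  moreover have "eval_at (prolong w) (r a) = Q * c a" if "a \<in> A" for a
  proof -
    have "eval_at (prolong w) (r a) = eval_at (prolong w) (q a) * c a * (\<Prod>b\<in>A - {a}. eval_at (prolong w) (q b))"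
      using pq[OF that] by (simp add: r_def eval_at_simps ring_map_prod[OF ring_map_eval_at])
    also have "\<dots> = Q * c a" unfolding Q_def using assms(1) that by (simp add: prod.remove)
    finally show ?thesis .
  qed
  ultimately show ?thesis by blast
qed

text \<open>
  After clearing denominators the coefficients of \<open>h\<close> are polynomials in \<open>v, v', v'', \<dots>\<close>.  By the
  independence of \<open>v', v'', \<dots>\<close> the relation splits according to the monomials in these, and one of the
  parts, which involves \<open>v\<close> only, is not trivial.
\<close>

lemma descend_to_powers:
  assumes v: "v \<in> L" "differential v \<noteq> 0" and m: "m = degree (differential v)"
    and h: "h \<in> polys (fractions v) {..m}" "h \<noteq> 0" "E h = 0" and W: "total_degree h \<le> W"
  shows "\<exists>K g. (\<forall>k. g k \<in> polys F {..m} \<and> total_degree (g k) \<le> W) \<and> (\<exists>k\<le>K. g k \<noteq> 0)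
    \<and> (\<Sum>k\<le>K. v ^ k * E (g k)) = 0"
proof -
  define A where "A = keys h"
  have A: "finite A" "\<And>a. a \<in> A \<Longrightarrow> keys a \<subseteq> {..m} \<and> mdeg a \<le> W"
    using h(1) W by (auto simp: A_def polys_def total_degree_le_iff)
  have "\<exists>D r. D \<noteq> 0 \<and> (\<forall>a\<in>A. r a \<in> polys F UNIV \<and> eval_at (prolong v) (r a) = D * lookup h a)"
    by (rule common_denominator[OF A(1)]) (use h(1) in \<open>auto simp: A_def polys_def\<close>)
  then obtain D r where "D \<noteq> 0 \<and> (\<forall>a\<in>A. r a \<in> polys F UNIV \<and> eval_at (prolong v) (r a) = D * lookup h a)"
    by (elim exE)
  then have D: "D \<noteq> 0" and r: "\<And>a. a \<in> A \<Longrightarrow> r a \<in> polys F UNIV"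
    "\<And>a. a \<in> A \<Longrightarrow> eval_at (prolong v) (r a) = D * lookup h a" by auto
  \<comment> \<open>Variable 0 stands for \<open>v\<close> itself: \<open>strip\<close> removes it, and \<open>lift k\<close> below restores its \<open>k\<close>-th power.\<close>
  define strip where "strip \<rho> = \<rho> - single 0 (lookup \<rho> 0)" for \<rho> :: "nat \<Rightarrow>\<^sub>0 nat"
  have strip: "strip \<rho> + single 0 (lookup \<rho> 0) = \<rho>" for \<rho>
    by (intro poly_mapping_eqI) (auto simp: strip_def lookup_add lookup_minus lookup_single when_def)
  have keys_strip: "keys (strip \<rho>) \<subseteq> {1..}" for \<rho>
  proof
    fix i assume "i \<in> keys (strip \<rho>)"
    then show "i \<in> {1..}"
      by (cases i) (auto simp: strip_def in_keys_iff lookup_minus lookup_single One_nat_def)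
  qed
  define R where "R = (\<Sum>a\<in>A. \<Sum>\<rho>\<in>keys (r a).
    single (strip \<rho>) (lookup (r a) \<rho> * v ^ lookup \<rho> 0 * mono_eval (prolong u) a))"
  have "eval_at (prolong v) R = (\<Sum>a\<in>A. mono_eval (prolong u) a * (D * lookup h a))"
  proof -
    have 1: "mono_eval (prolong v) \<rho> = v ^ lookup \<rho> 0 * mono_eval (prolong v) (strip \<rho>)" for \<rho>
      by (subst strip[of \<rho>, symmetric], subst mono_eval_add) simp
    have 2: "eval_at (prolong v) (r a) = (\<Sum>\<rho>\<in>keys (r a). lookup (r a) \<rho> * mono_eval (prolong v) \<rho>)" for a
      unfolding eval_at_def by (subst poly_eval_superset[of _ "keys (r a)"]) auto
    have "eval_at (prolong v) R = (\<Sum>a\<in>A. \<Sum>\<rho>\<in>keys (r a).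
        mono_eval (prolong u) a * (lookup (r a) \<rho> * mono_eval (prolong v) \<rho>))"
      unfolding R_def eval_at_simps
    proof (intro sum.cong refl)
      fix a \<rho>
      show "lookup (r a) \<rho> * v ^ lookup \<rho> 0 * mono_eval (prolong u) a * mono_eval (prolong v) (strip \<rho>)
          = mono_eval (prolong u) a * (lookup (r a) \<rho> * mono_eval (prolong v) \<rho>)"
        unfolding 1[of \<rho>] by (simp only: ac_simps)
    qed
    also have "\<dots> = (\<Sum>a\<in>A. mono_eval (prolong u) a * eval_at (prolong v) (r a))"
      unfolding 2 by (simp add: sum_distrib_left)
    finally show ?thesis using r(2) by simp
  qed
  also have "\<dots> = D * E h"
    unfolding eval_at_def by (subst poly_eval_superset[of _ A]) (auto simp: A_def sum_distrib_left ac_simps)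
  finally have evR: "eval_at (prolong v) R = 0" using h(3) by simp
  have "R \<in> polys (order_le m) {1..}"
  proof -
    note sr = order_le_subring[of m]
    have "v \<in> order_le m" using v(1) by (auto simp: order_le_def m intro: coeff_eq_0)
    moreover have "mono_eval (prolong u) a \<in> order_le m" if "a \<in> A" for a
      using A(2)[OF that] order_le_base(2) by (intro subring_mono_eval[OF sr]) auto
    moreover have "lookup (r a) \<rho> \<in> order_le m" if "a \<in> A" for a \<rho>
      using polys_lookup[OF F_simps(1) r(1)[OF that]] order_le_base(1) by auto
    ultimately show ?thesis unfolding R_def
      by (intro polys_sum[OF sr] polys_single keys_strip subringD(5)[OF sr] subring_power[OF sr]) auto
  qed
  then have R0: "R = 0" using prolong_independent[OF v _ evR] by (simp add: m)
  have "\<exists>a\<in>A. r a \<noteq> 0"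
  proof -
    obtain a where a: "a \<in> A" using lead_props(1)[OF h(2)] A_def by blast
    then have "eval_at (prolong v) (r a) \<noteq> 0" using r(2)[OF a] D by (simp add: A_def in_keys_iff)
    then have "r a \<noteq> 0" by (auto simp: eval_at_simps)
    with a show ?thesis by blast
  qed
  then obtain a0 where a0: "a0 \<in> A" "r a0 \<noteq> 0" by blast
  then obtain \<rho>0 where \<rho>0: "\<rho>0 \<in> keys (r a0)" using lead_props(1) by blast
  define \<nu> where "\<nu> = strip \<rho>0"
  define lift where "lift k = \<nu> + single 0 k" for k
  have \<nu>0: "lookup \<nu> 0 = 0" by (simp add: \<nu>_def strip_def lookup_minus)
  have lift0: "lookup (lift k) 0 = k" for k by (simp add: lift_def lookup_add \<nu>0)
  have strip_lift: "strip (lift k) = \<nu>" for k by (simp add: strip_def lift0) (simp add: lift_def)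
  have strip_eq: "strip \<rho> = \<nu> \<longleftrightarrow> \<rho> = lift (lookup \<rho> 0)" for \<rho>
    using strip[of \<rho>] strip_lift by (metis lift_def)
  define K where "K = Max (insert 0 ((\<lambda>\<rho>. lookup \<rho> 0) ` (\<Union>a\<in>A. keys (r a))))"
  have K: "lookup \<rho> 0 \<le> K" if "a \<in> A" "\<rho> \<in> keys (r a)" for a \<rho>
    unfolding K_def using that A(1) by (intro Max_ge) auto
  define g where "g k = (\<Sum>a\<in>A. single a (lookup (r a) (lift k)))" for k
  have "(\<Sum>k\<le>K. v ^ k * E (g k)) = (\<Sum>k\<le>K. \<Sum>a\<in>A. lookup (r a) (lift k) * v ^ k * mono_eval (prolong u) a)"
    by (simp add: g_def eval_at_simps sum_distrib_left ac_simps)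
  also have "\<dots> = (\<Sum>a\<in>A. \<Sum>k\<le>K. lookup (r a) (lift k) * v ^ k * mono_eval (prolong u) a)"
    by (rule sum.swap)
  also have "\<dots> = (\<Sum>a\<in>A. \<Sum>\<rho>\<in>keys (r a). if strip \<rho> = \<nu>
      then lookup (r a) \<rho> * v ^ lookup \<rho> 0 * mono_eval (prolong u) a else 0)"
  proof (rule sum.cong[OF refl])
    fix a assume a: "a \<in> A"
    let ?t = "\<lambda>\<rho>. lookup (r a) \<rho> * v ^ lookup \<rho> 0 * mono_eval (prolong u) a"
    have "inj_on lift {..K}" by (rule inj_onI) (metis lift0)
    then have "(\<Sum>k\<le>K. lookup (r a) (lift k) * v ^ k * mono_eval (prolong u) a) = (\<Sum>\<rho>\<in>lift ` {..K}. ?t \<rho>)"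
      by (simp add: sum.reindex lift0)
    also have "\<dots> = (\<Sum>\<rho>\<in>{\<rho>\<in>keys (r a). strip \<rho> = \<nu>}. ?t \<rho>)"
    proof (rule sum.mono_neutral_right)
      show "{\<rho>\<in>keys (r a). strip \<rho> = \<nu>} \<subseteq> lift ` {..K}" using K[OF a] strip_eq by auto
      show "\<forall>\<rho>\<in>lift ` {..K} - {\<rho>\<in>keys (r a). strip \<rho> = \<nu>}. ?t \<rho> = 0"
        by (auto simp: strip_lift in_keys_iff)
    qed simp
    also have "\<dots> = (\<Sum>\<rho>\<in>keys (r a). if strip \<rho> = \<nu> then ?t \<rho> else 0)"
      by (simp add: sum.inter_filter)
    finally show "(\<Sum>k\<le>K. lookup (r a) (lift k) * v ^ k * mono_eval (prolong u) a)
      = (\<Sum>\<rho>\<in>keys (r a). if strip \<rho> = \<nu> then ?t \<rho> else 0)" .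
  qed
  also have "\<dots> = lookup R \<nu>"
    by (simp add: R_def lookup_sum lookup_single when_def)
  finally have sum0: "(\<Sum>k\<le>K. v ^ k * E (g k)) = 0" by (simp add: R0)
  have "g k \<in> polys F {..m} \<and> total_degree (g k) \<le> W" for k
    unfolding g_def
  proof
    show "(\<Sum>a\<in>A. single a (lookup (r a) (lift k))) \<in> polys F {..m}"
      using A(2) r(1) F_simps(1) by (intro polys_sum[OF F_subring] polys_single) (auto intro: polys_lookup)
    show "total_degree (\<Sum>a\<in>A. single a (lookup (r a) (lift k))) \<le> W"
      using A(2) by (intro total_degree_sum_le) (auto simp: total_degree_le_iff)
  qed
  moreover have "lookup \<rho>0 0 \<le> K" by (rule K[OF a0(1) \<rho>0])
  moreover have "g (lookup \<rho>0 0) \<noteq> 0"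
  proof -
    have "lookup (g (lookup \<rho>0 0)) a0 = lookup (r a0) (lift (lookup \<rho>0 0))"
      using A(1) a0(1) by (simp add: g_def lookup_sum lookup_single when_def)
    also have "lift (lookup \<rho>0 0) = \<rho>0" using strip_eq[of \<rho>0] by (simp add: \<nu>_def)
    finally show ?thesis using \<rho>0 by (auto simp: in_keys_iff)
  qed
  ultimately show ?thesis using sum0 by blast
qed

lemma total_degree_power:
  fixes p :: "'b diff_poly"
  assumes "p \<noteq> 0"
  shows "total_degree (p ^ n) = n * total_degree p"
  using assms by (induction n) (simp_all add: total_degree_1 total_degree_mult)

text \<open>
  With \<open>H\<close> the leading coefficient of the relation for \<open>v\<close>, the product \<open>H v\<close> satisfies a monic equation
  with polynomial coefficients, so it is a polynomial \<open>p\<close>.  A degree of \<open>p\<close> above \<open>W\<close> would make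
  \<open>p ^ k\<close> the only term of highest degree in this equation.
\<close>

lemma representation_from_powers:
  assumes v: "frac_of P Q v" "P \<in> polys F {..m}" "Q \<in> polys F {..m}"
    and g: "\<And>k. g k \<in> polys F {..m}" "\<And>k. total_degree (g k) \<le> W" and "k0 \<le> K" "g k0 \<noteq> 0"
    and "(\<Sum>k\<le>K. v ^ k * E (g k)) = 0"
  shows "\<exists>p q. frac_of p q v \<and> p \<in> polys F {..m} \<and> q \<in> polys F {..m}
    \<and> total_degree p \<le> W \<and> total_degree q \<le> W"
proof -
  define k where "k = Max {k. k \<le> K \<and> g k \<noteq> 0}"
  have "k \<in> {k. k \<le> K \<and> g k \<noteq> 0}" unfolding k_def using assms(6,7) by (intro Max_in) auto
  then have k: "k \<le> K" "g k \<noteq> 0" by auto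
  have above: "g j = 0" if "k < j" "j \<le> K" for j
  proof (rule ccontr)
    assume "g j \<noteq> 0"
    then have "j \<le> k" unfolding k_def using that by (intro Max_ge) auto
    then show False using that by simp
  qed
  have rel: "(\<Sum>j<k. v ^ j * E (g j)) + v ^ k * E (g k) = 0"
  proof -
    have "(\<Sum>j\<le>k. v ^ j * E (g j)) = (\<Sum>j\<le>K. v ^ j * E (g j))"
      using k above by (intro sum.mono_neutral_left) (auto simp: eval_at_simps not_le)
    then show ?thesis using assms(8) by (simp flip: lessThan_Suc_atMost)
  qed
  have gE: "E (g k) \<noteq> 0" using k(2) E_eq_0_iff[of "g k"] g(1) polys_mono[of F F "{..m}" UNIV] by auto
  have k0: "k \<noteq> 0" using rel gE by (cases k) auto
  define H where "H = g k"
  define pw where "pw = (\<lambda>j. H ^ (k - 1 - j))"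
  have UN: "polys F {..m} \<subseteq> polys F UNIV" by (rule polys_mono) auto
  note pm = subringD[OF polysF[of "{..m}"]] and pmp = subring_power[OF polysF[of "{..m}"]]
    and pms = subring_sum[OF polysF[of "{..m}"]]
  have HF: "H \<in> polys F {..m}" using g by (simp add: H_def)
  \<comment> \<open>The relation for \<open>v\<close>, multiplied by \<open>E H ^ (k - 1)\<close>, is monic in \<open>E H * v\<close>.\<close>
  have monic: "(E H * v) ^ k = - (\<Sum>j<k. E (g j * pw j) * (E H * v) ^ j)"
  proof -
    have "E H ^ (k - 1) * ((\<Sum>j<k. v ^ j * E (g j)) + v ^ k * E H) = 0" using rel by (simp add: H_def)
    then have "(\<Sum>j<k. E H ^ (k - 1) * (v ^ j * E (g j))) + E H ^ (k - 1) * E H * v ^ k = 0"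
      by (simp add: distrib_left sum_distrib_left ac_simps)
    moreover have "E H ^ (k - 1) * (v ^ j * E (g j)) = E (g j * pw j) * (E H * v) ^ j" if "j < k" for j
    proof -
      have "E H ^ (k - 1) = E H ^ (k - 1 - j) * E H ^ j" using that by (simp flip: power_add)
      then show ?thesis by (simp add: pw_def eval_at_simps power_mult_distrib)
    qed
    moreover have "E H ^ (k - 1) * E H = E H ^ k" using k0 by (simp add: power_eq_if)
    ultimately show ?thesis by (simp add: power_mult_distrib eq_neg_iff_add_eq_0 add.commute)
  qed
  have EP: "E P = E Q * v" and Q0: "Q \<noteq> 0" using v by (auto simp: frac_of_def)
  have "\<exists>r. Q ^ k * (H * P) ^ n = Q ^ n * r" for n
  proof (induction n rule: less_induct)
    case (less n)
    show ?case
    proof (cases "n \<le> k")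
      case True
      then have "Q ^ k = Q ^ n * Q ^ (k - n)" by (simp flip: power_add)
      then show ?thesis by (metis mult.assoc)
    next
      case False
      define i where "i = n - k"
      have n: "n = k + i" using False by (simp add: i_def)
      have HPk: "(H * P) ^ k = - (\<Sum>j<k. g j * pw j * (H * P) ^ j * Q ^ (k - j))"
      proof (subst E_eq_iff[symmetric])
        have pwF: "pw j \<in> polys F {..m}" for j unfolding pw_def by (intro pmp HF)
        show "(H * P) ^ k \<in> polys F UNIV" by (intro subsetD[OF UN] pmp pm(5) HF v(2))
        show "- (\<Sum>j<k. g j * pw j * (H * P) ^ j * Q ^ (k - j)) \<in> polys F UNIV"
          using HF v g pwF by (intro subsetD[OF UN] pm(6) pms pm(5) pmp) auto
        have "E ((H * P) ^ k) = E Q ^ k * (E H * v) ^ k"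
          by (simp add: eval_at_simps EP power_mult_distrib)
        also have "\<dots> = - (\<Sum>j<k. E Q ^ k * (E (g j * pw j) * (E H * v) ^ j))"
          unfolding monic by (simp add: sum_distrib_left)
        also have "(\<Sum>j<k. E Q ^ k * (E (g j * pw j) * (E H * v) ^ j))
            = (\<Sum>j<k. E (g j * pw j * (H * P) ^ j * Q ^ (k - j)))"
        proof (rule sum.cong[OF refl])
          fix j assume "j \<in> {..<k}"
          then have "E Q ^ k = E Q ^ j * E Q ^ (k - j)" by (simp flip: power_add)
          then show "E Q ^ k * (E (g j * pw j) * (E H * v) ^ j) = E (g j * pw j * (H * P) ^ j * Q ^ (k - j))"
            by (simp add: eval_at_simps EP power_mult_distrib)
        qed
        finally show "E ((H * P) ^ k) = E (- (\<Sum>j<k. g j * pw j * (H * P) ^ j * Q ^ (k - j)))"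
          by (simp add: eval_at_simps)
      qed
      obtain r where r: "\<And>l. l < n \<Longrightarrow> Q ^ k * (H * P) ^ l = Q ^ l * r l" using less.IH by metis
      have "Q ^ k * (H * P) ^ n = - (\<Sum>j<k. g j * pw j * Q ^ (k - j) * (Q ^ k * (H * P) ^ (j + i)))"
        unfolding n power_add HPk by (simp add: sum_distrib_left sum_distrib_right ac_simps)
      also have "\<dots> = - (\<Sum>j<k. Q ^ n * (g j * pw j * r (j + i)))"
      proof -
        have "g j * pw j * Q ^ (k - j) * (Q ^ k * (H * P) ^ (j + i)) = Q ^ n * (g j * pw j * r (j + i))"
          if "j < k" for j
        proof -
          have "Q ^ n = Q ^ (k - j) * Q ^ (j + i)" using that n by (simp flip: power_add)
          then show ?thesis using r[of "j + i"] that n by (simp add: ac_simps)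
        qed
        then show ?thesis by (metis (no_types, lifting) lessThan_iff sum.cong)
      qed
      also have "\<dots> = Q ^ n * (- (\<Sum>j<k. g j * pw j * r (j + i)))" by (simp add: sum_distrib_left)
      finally show ?thesis by blast
    qed
  qed
  then have "\<exists>p\<in>polys F {..m}. H * P = Q * p"
    using v HF pm Q0 by (intro almost_integral_dvd[OF F_subfield, where s = "Q ^ k"]) auto
  then obtain p where p: "p \<in> polys F {..m}" "H * P = Q * p" by blast
  have "E Q * E p = E Q * (E H * v)"
    using arg_cong[OF p(2), of E] unfolding eval_at_simps EP by (simp only: ac_simps)
  then have Ep: "E p = E H * v" using frac_of_nz[OF v(1)] by simp
  have "total_degree p \<le> W"
  proof (rule ccontr)
    assume big: "\<not> total_degree p \<le> W"
    then have p0: "p \<noteq> 0" by (auto simp: total_degree_def)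
    have "p ^ k = - (\<Sum>j<k. g j * pw j * p ^ j)"
    proof (subst E_eq_iff[symmetric])
      show "p ^ k \<in> polys F UNIV" by (intro subsetD[OF UN] pmp p(1))
      show "- (\<Sum>j<k. g j * pw j * p ^ j) \<in> polys F UNIV"
        using HF g p(1) unfolding pw_def by (intro subsetD[OF UN] pm(6) pms pm(5) pmp) auto
      show "E (p ^ k) = E (- (\<Sum>j<k. g j * pw j * p ^ j))"
        using monic by (simp add: eval_at_simps Ep)
    qed
    moreover have "total_degree (\<Sum>j<k. g j * pw j * p ^ j) \<le> k * total_degree p - 1"
    proof (rule total_degree_sum_le)
      fix j assume j: "j \<in> {..<k}"
      have "total_degree (g j * pw j * p ^ j) \<le> total_degree (g j) + total_degree (pw j) + j * total_degree p"
        using total_degree_mult_le[of "g j * pw j" "p ^ j"] total_degree_mult_le[of "g j" "pw j"]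
          total_degree_power_le[of p j] by linarith
      also have "\<dots> \<le> W + (k - 1 - j) * W + j * total_degree p"
        using g(2)[of j] total_degree_power_le[of H "k - 1 - j"] mult_le_mono2[OF g(2)[of k], of "k - 1 - j"]
        unfolding pw_def H_def by linarith
      also have "\<dots> = (k - j) * W + j * total_degree p"
      proof -
        have "k - j = Suc (k - 1 - j)" using j by simp
        then show ?thesis by simp
      qed
      also have "\<dots> < (k - j) * total_degree p + j * total_degree p"
        using j big by (intro add_strict_right_mono mult_strict_left_mono) auto
      also have "\<dots> = k * total_degree p" using j by (simp flip: distrib_right)
      finally show "total_degree (g j * pw j * p ^ j) \<le> k * total_degree p - 1" by simp
    qed
    moreover have "total_degree (- q) = total_degree q" for q :: "'b diff_poly"
      by (simp add: total_degree_def)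
    ultimately have "k * total_degree p \<le> k * total_degree p - 1"
      using total_degree_power[OF p0, of k] by metis
    moreover have "k * total_degree p > 0" using k0 big by simp
    ultimately show False by linarith
  qed
  moreover have "frac_of p H v"
    using p(1) HF UN Ep k(2) by (auto simp: frac_of_def H_def)
  ultimately show ?thesis using p(1) HF g(2) by (auto simp: H_def)
qed

end

section \<open>Linear algebra of prolonged systems\<close>

interpretation poly_vs: vector_space "smult :: 'b::field \<Rightarrow> 'b poly \<Rightarrow> 'b poly"
  by unfold_locales (simp_all add: smult_add_right smult_add_left)

interpretation poly_dual: vector_space_pair "smult :: 'b::field \<Rightarrow> 'b poly \<Rightarrow> 'b poly" "(*) :: 'b \<Rightarrow> 'b \<Rightarrow> 'b"
  by unfold_locales (simp_all add: algebra_simps)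

lemma coeff_0_on_span:
  assumes "x \<in> poly_vs.span S" "\<And>y. y \<in> S \<Longrightarrow> coeff y i = 0"
  shows "coeff x i = 0"
  using assms(1)
proof (induction rule: poly_vs.span_induct)
  case base
  show ?case using assms(2) by (auto simp: poly_vs.subspace_def)
next
  case (step x)
  then show ?case using assms(2) by simp
qed

text \<open>
  Operators \<open>z k\<close> of pairwise different degrees \<open>D + k\<close> cannot cancel each other in degrees \<open>\<ge> D\<close>.
\<close>

lemma span_peel:
  fixes z :: "nat \<Rightarrow> 'b::field poly"
  assumes x: "x \<in> poly_vs.span (A \<union> range z)" "\<And>i. i \<ge> D \<Longrightarrow> coeff x i = 0"
    and A: "\<And>y i. y \<in> A \<Longrightarrow> i \<ge> D \<Longrightarrow> coeff y i = 0"
    and z: "\<And>k. z k \<noteq> 0" "\<And>k. degree (z k) = D + k"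
  shows "x \<in> poly_vs.span A"
proof -
  obtain T r where T: "finite T" "T \<subseteq> A \<union> range z" "x = (\<Sum>a\<in>T. smult (r a) a)"
    using x(1) unfolding poly_vs.span_explicit by blast
  have "\<exists>M. T \<subseteq> A \<union> z ` {..<M}"
  proof -
    obtain I where "finite I" "T - A \<subseteq> z ` I"
      using T finite_subset_image[of "T - A" z UNIV] by (metis Diff_subset_conv finite_Diff order_refl subset_UNIV)
    moreover then obtain M where "I \<subseteq> {..<M}" by (meson finite_nat_iff_bounded)
    ultimately show ?thesis by (intro exI[of _ M]) blast
  qed
  then obtain M where M: "T \<subseteq> A \<union> z ` {..<M}" by blast
  have "x \<in> poly_vs.span T" using T by (auto intro: poly_vs.span_sum poly_vs.span_scale poly_vs.span_base)
  then have "x \<in> poly_vs.span (A \<union> z ` {..<M})" using poly_vs.span_mono[OF M] by blast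
  then show ?thesis
  proof (induction M)
    case 0
    then show ?case by simp
  next
    case (Suc M)
    have "A \<union> z ` {..<Suc M} = insert (z M) (A \<union> z ` {..<M})" by (auto simp: lessThan_Suc)
    then obtain c where c: "x - smult c (z M) \<in> poly_vs.span (A \<union> z ` {..<M})"
      using Suc.prems poly_vs.span_breakdown_eq by metis
    have "coeff (x - smult c (z M)) (D + M) = 0"
    proof (rule coeff_0_on_span[OF c])
      fix y assume "y \<in> A \<union> z ` {..<M}"
      then show "coeff y (D + M) = 0"
        using A[of y "D + M"] z(2) by (cases "y \<in> A") (auto intro!: coeff_eq_0)
    qed
    then have "c * lead_coeff (z M) = 0" using x(2)[of "D + M"] z(2)[of M] by simp
    then have "c = 0" using z(1)[of M] by simp
    then show ?case using c Suc.IH by simp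
  qed
qed

lemma independent_by_degree:
  fixes z :: "nat \<Rightarrow> 'b::field poly"
  assumes z: "\<And>k. z k \<noteq> 0" "\<And>k. degree (z k) = D + k"
  shows "poly_vs.independent (z ` {..<M}) \<and> card (z ` {..<M}) = M"
proof -
  have "inj z"
  proof (rule injI)
    fix i j assume "z i = z j"
    then have "D + i = D + j" using z(2) by metis
    then show "i = j" by simp
  qed
  then have "card (z ` {..<M}) = M" by (simp add: card_image inj_on_subset)
  moreover have "poly_vs.independent (z ` {..<M})"
  proof (induction M)
    case 0
    then show ?case by (simp add: poly_vs.dependent_def)
  next
    case (Suc M)
    have "z M \<notin> poly_vs.span (z ` {..<M})"
    proof
      assume "z M \<in> poly_vs.span (z ` {..<M})"
      then have "coeff (z M) (D + M) = 0"
        by (rule coeff_0_on_span) (use z(2) in \<open>auto intro!: coeff_eq_0\<close>)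
      then show False using z[of M] by (metis leading_coeff_0_iff)
    qed
    then show ?case using Suc by (simp add: lessThan_Suc poly_vs.independent_insertI)
  qed
  ultimately show ?thesis by blast
qed

lemma independent_functional:
  fixes g :: "nat \<Rightarrow> 'b::field poly"
  assumes "inj_on g I" "poly_vs.independent (g ` I)" "\<And>i. i \<in> I \<Longrightarrow> degree (g i) < N"
  shows "\<exists>w. \<forall>i\<in>I. (\<Sum>x<N. w x * coeff (g i) x) = l i"
proof -
  obtain f where f: "Vector_Spaces.linear smult (*) f" "\<forall>x\<in>g ` I. f x = l (inv_into I g x)"
    using poly_dual.linear_independent_extend[OF assms(2), of "\<lambda>x. l (inv_into I g x)"] by blast
  have "(\<Sum>x<N. f (monom 1 x) * coeff (g i) x) = l i" if i: "i \<in> I" for i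
  proof -
    have "g i = (\<Sum>x<N. smult (coeff (g i) x) (monom 1 x))"
    proof (rule poly_eqI)
      fix n
      have "coeff (\<Sum>x<N. smult (coeff (g i) x) (monom 1 x)) n = (\<Sum>x<N. if x = n then coeff (g i) x else 0)"
        unfolding coeff_sum by (intro sum.cong) auto
      also have "\<dots> = coeff (g i) n" using assms(3)[OF i] by (auto simp: coeff_eq_0)
      finally show "coeff (g i) n = coeff (\<Sum>x<N. smult (coeff (g i) x) (monom 1 x)) n" by (rule sym)
    qed
    then have "f (g i) = f (\<Sum>x<N. smult (coeff (g i) x) (monom 1 x))" by (rule arg_cong)
    also have "\<dots> = (\<Sum>x<N. coeff (g i) x * f (monom 1 x))"
      by (simp only: poly_dual.linear_sum[OF f(1)] poly_dual.linear_scale[OF f(1)])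
    finally have "f (g i) = (\<Sum>x<N. coeff (g i) x * f (monom 1 x))" .
    moreover have "f (g i) = l (inv_into I g (g i))" using f(2) i by blast
    moreover have "(\<Sum>x<N. coeff (g i) x * f (monom 1 x)) = (\<Sum>x<N. f (monom 1 x) * coeff (g i) x)"
      by (intro sum.cong refl mult.commute)
    ultimately show ?thesis using inv_into_f_f[OF assms(1) i] by metis
  qed
  then show ?thesis by (intro exI[of _ "\<lambda>x. f (monom 1 x)"] ballI)
qed

text \<open>
  The span of this set is the left module of operators generated by the \<open>\<eta> j\<close>.
\<close>

abbreviation orbits :: "('b::comm_ring_1 \<Rightarrow> 'b) \<Rightarrow> ('j \<Rightarrow> 'b poly) \<Rightarrow> 'j set \<Rightarrow> 'b poly set" where
  "orbits \<Delta> \<eta> J \<equiv> {(shift \<Delta> ^^ k) (\<eta> j) |j k. j \<in> J}"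

context
  fixes \<Delta> :: "'b::field \<Rightarrow> 'b"
  assumes der: "is_derivation \<Delta>"
begin

lemma shift_span:
  assumes x: "x \<in> poly_vs.span S" and S: "\<And>y. y \<in> S \<Longrightarrow> shift \<Delta> y \<in> poly_vs.span T" and "S \<subseteq> poly_vs.span T"
  shows "shift \<Delta> x \<in> poly_vs.span T"
proof -
  have "shift \<Delta> x \<in> poly_vs.span T \<and> x \<in> poly_vs.span T"
    using x
  proof (induction rule: poly_vs.span_induct)
    case base
    show ?case
      unfolding poly_vs.subspace_def
      by (auto simp: shift_0[OF der] shift_add[OF der] shift_smult[OF der]
          intro: poly_vs.span_add poly_vs.span_scale poly_vs.span_zero)
  next
    case (step x)
    then show ?case using S assms(3) by auto
  qed
  then show ?thesis ..
qed

lemma shift_span_range: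
  "x \<in> poly_vs.span (orbits \<Delta> \<eta> J) \<Longrightarrow>
    shift \<Delta> x \<in> poly_vs.span (orbits \<Delta> \<eta> J)"
proof (erule shift_span)
  fix y assume "y \<in> (orbits \<Delta> \<eta> J)"
  then obtain j k where "j \<in> J" "y = (shift \<Delta> ^^ k) (\<eta> j)" by blast
  then have "shift \<Delta> y = (shift \<Delta> ^^ Suc k) (\<eta> j)" by simp
  then show "shift \<Delta> y \<in> poly_vs.span (orbits \<Delta> \<eta> J)"
    using \<open>j \<in> J\<close> by (intro poly_vs.span_base) blast
qed (rule poly_vs.span_superset)

text \<open>
  Let \<open>t = M - m\<close>, let \<open>V\<^sub>r\<close> be spanned by the \<open>\<partial>\<^sup>k \<eta>\<^sub>j\<close> with \<open>k < r\<close>, and let \<open>\<eta>\<^sub>1\<close> have the maximal degree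
  \<open>M\<close>.  All of \<open>V\<^sub>r\<close> consists of left multiples of \<open>\<Lambda>\<close> of degree below \<open>M + r\<close>, so its dimension is at most
  \<open>t + r\<close>.  The step from \<open>V\<^sub>r\<close> to the next space adds at least the new top degree \<open>\<partial>\<^sup>r \<eta>\<^sub>1\<close>.  As long as it
  adds more than that, the dimension grows by 2, which the upper bound permits for at most \<open>t\<close> steps.
  From the first step \<open>s\<close> that adds \<open>\<partial>\<^sup>s \<eta>\<^sub>1\<close> only, this remains so for ever, and hence the whole module is
  \<open>V\<^sub>s\<close> together with the \<open>\<partial>\<^sup>k \<eta>\<^sub>1\<close> for \<open>k \<ge> s\<close>.  Comparing degrees, \<open>V\<^sub>s\<close> contains all left multiples of
  \<open>\<Lambda>\<close> of degree below \<open>M + s\<close>: it has the full dimension \<open>t + s \<le> 2 t\<close>.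

  If \<open>s = 0\<close>, then \<open>t = 0\<close> and one operator suffices.  Otherwise already the first step adds two
  dimensions, which takes at least two operators \<open>\<eta>\<^sub>j\<close>.  The number called \<open>s\<close> in the statement is
  the largest number of derivations used, one less than here unless \<open>s = 0\<close>.
\<close>

lemma prolonged_rank:
  fixes \<eta> :: "'j \<Rightarrow> 'b poly" and \<Lambda> :: "'b poly"
  assumes J: "finite J" "J \<noteq> {}" and nz: "\<And>j. j \<in> J \<Longrightarrow> \<eta> j \<noteq> 0" and \<Lambda>: "\<Lambda> \<noteq> 0"
    and \<eta>\<Lambda>: "\<And>j. j \<in> J \<Longrightarrow> \<eta> j \<in> poly_vs.span (range (\<lambda>i. (shift \<Delta> ^^ i) \<Lambda>))"
    and \<Lambda>\<eta>: "\<Lambda> \<in> poly_vs.span (orbits \<Delta> \<eta> J)"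
    and M: "M = Max ((\<lambda>j. degree (\<eta> j)) ` J)"
  shows "\<exists>s c B. B \<subseteq> {(shift \<Delta> ^^ k) (\<eta> j) |j k. j \<in> J \<and> k \<le> s} \<and> poly_vs.independent B
    \<and> finite B \<and> card B = c \<and> M + s + 1 = degree \<Lambda> + c \<and> c \<ge> 1
    \<and> (s = 0 \<and> c = 1 \<or> card J \<ge> 2 \<and> M + s + 1 \<le> 2 * M \<and> c \<le> 2 * M)"
proof -
  define m where "m = degree \<Lambda>"
  have degM: "degree (\<eta> j) \<le> M" if "j \<in> J" for j
    unfolding M using J that by (intro Max_ge) auto
  have "M \<in> (\<lambda>j. degree (\<eta> j)) ` J" unfolding M using J by (intro Max_in) auto
  then obtain j1 where j1: "j1 \<in> J" "degree (\<eta> j1) = M" by auto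
  define z where "z k = (shift \<Delta> ^^ k) (\<eta> j1)" for k
  have z: "z k \<noteq> 0" "degree (z k) = M + k" for k
    using degree_shift_funpow[OF der nz[OF j1(1)], of k] j1 by (auto simp: z_def)
  define y where "y k = (shift \<Delta> ^^ k) \<Lambda>" for k
  have y: "y k \<noteq> 0" "degree (y k) = m + k" for k
    using degree_shift_funpow[OF der \<Lambda>, of k] by (auto simp: y_def m_def)
  define gens where "gens r = {(shift \<Delta> ^^ k) (\<eta> j) |j k. j \<in> J \<and> k < r}" for r
  have gens_coeff: "coeff p i = 0" if p: "p \<in> gens r" "i \<ge> M + r" for p i r
  proof -
    obtain j k where jk: "p = (shift \<Delta> ^^ k) (\<eta> j)" "j \<in> J" "k < r" using p(1) unfolding gens_def by blast
    then have "degree p < i"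
      using degree_shift_funpow[OF der nz[OF jk(2)], of k] degM[OF jk(2)] p(2) by simp
    then show ?thesis by (rule coeff_eq_0)
  qed
  have Yshift: "shift \<Delta> x \<in> poly_vs.span (range y)" if "x \<in> poly_vs.span (range y)" for x
    using that
  proof (rule shift_span)
    fix p assume "p \<in> range y"
    then obtain i where "p = y i" by blast
    then have "shift \<Delta> p = y (Suc i)" by (simp add: y_def)
    then show "shift \<Delta> p \<in> poly_vs.span (range y)" by (simp add: poly_vs.span_base)
  qed (rule poly_vs.span_superset)
  have gensY: "gens r \<subseteq> poly_vs.span (range y)" for r
  proof
    fix p assume "p \<in> gens r"
    then obtain j k where jk: "p = (shift \<Delta> ^^ k) (\<eta> j)" "j \<in> J" unfolding gens_def by blast
    have "(shift \<Delta> ^^ k) (\<eta> j) \<in> poly_vs.span (range y)" for k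
      using \<eta>\<Lambda>[OF jk(2), folded y_def] by (induction k) (auto intro: Yshift)
    then show "p \<in> poly_vs.span (range y)" by (simp add: jk)
  qed
  \<comment> \<open>No nonzero left multiple of \<open>\<Lambda>\<close> has a smaller degree than \<open>\<Lambda>\<close>.\<close>
  have mM: "m \<le> M"
  proof (rule ccontr)
    assume "\<not> m \<le> M"
    have "\<eta> j1 \<in> gens 1"
      unfolding gens_def using j1(1) by (intro CollectI exI[of _ j1] exI[of _ "0::nat"]) simp
    then have "\<eta> j1 \<in> poly_vs.span ({} \<union> range y)" using gensY by auto
    moreover have "coeff (\<eta> j1) i = 0" if "i \<ge> m" for i
      using that \<open>\<not> m \<le> M\<close> j1 by (intro coeff_eq_0) simp
    ultimately have "\<eta> j1 \<in> poly_vs.span {}" by (rule span_peel[where D = m]) (auto simp: y)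
    then show False using nz[OF j1(1)] by simp
  qed
  define t where "t = M - m"
  have gens_upper: "gens r \<subseteq> poly_vs.span (y ` {..<t + r})" for r
  proof
    fix p assume p: "p \<in> gens r"
    have "range y \<subseteq> y ` {..<t + r} \<union> range (\<lambda>k. y (t + r + k))"
    proof
      fix x assume "x \<in> range y"
      then obtain k where k: "x = y k" by auto
      then show "x \<in> y ` {..<t + r} \<union> range (\<lambda>k. y (t + r + k))"
        by (cases "k < t + r") (auto simp: image_iff not_less le_iff_add)
    qed
    then have "p \<in> poly_vs.span (y ` {..<t + r} \<union> range (\<lambda>k. y (t + r + k)))"
      using gensY p poly_vs.span_mono by blast
    then show "p \<in> poly_vs.span (y ` {..<t + r})"
    proof (rule span_peel[where D = "M + r"])
      show "coeff p i = 0" if "i \<ge> M + r" for i using gens_coeff[OF p that] .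
      show "coeff q i = 0" if "q \<in> y ` {..<t + r}" "i \<ge> M + r" for q i
        using that y(2) mM by (auto simp: t_def intro!: coeff_eq_0)
      show "y (t + r + k) \<noteq> 0" "degree (y (t + r + k)) = M + r + k" for k
        using y mM by (auto simp: t_def)
    qed
  qed
  have upper: "card I \<le> t + r" if "poly_vs.independent I" "I \<subseteq> poly_vs.span (gens r)" for I r
  proof -
    have "I \<subseteq> poly_vs.span (y ` {..<t + r})"
      using that(2) poly_vs.span_mono[OF gens_upper[of r]] by (simp add: poly_vs.span_span)
    then show ?thesis
      using poly_vs.independent_span_bound[of "y ` {..<t + r}" I] that(1) card_image_le[of "{..<t + r}" y]
      by simp
  qed
  \<comment> \<open>A slow step adds nothing but the new top degree; any other step adds a second dimension.\<close>
  define slow where "slow r \<longleftrightarrow> (\<forall>j\<in>J. (shift \<Delta> ^^ r) (\<eta> j) \<in> poly_vs.span (insert (z r) (gens r)))" for r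
  have gens_mono: "gens r \<subseteq> gens (Suc r)" for r by (auto simp: gens_def less_Suc_eq)
  have growth: "\<exists>I. finite I \<and> poly_vs.independent I \<and> I \<subseteq> poly_vs.span (gens r) \<and> card I = 2 * r"
    if "\<forall>i<r. \<not> slow i" for r
    using that
  proof (induction r)
    case 0
    show ?case by (intro exI[of _ "{}"]) (simp add: poly_vs.dependent_def)
  next
    case (Suc r)
    then obtain I where I: "finite I" "poly_vs.independent I" "I \<subseteq> poly_vs.span (gens r)" "card I = 2 * r" by auto
    obtain j where j: "j \<in> J" "(shift \<Delta> ^^ r) (\<eta> j) \<notin> poly_vs.span (insert (z r) (gens r))"
      using Suc.prems by (auto simp: slow_def)
    define b where "b = (shift \<Delta> ^^ r) (\<eta> j)"
    have spI: "poly_vs.span I \<subseteq> poly_vs.span (gens r)" using poly_vs.span_mono[OF I(3)] by (simp add: poly_vs.span_span)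
    have z_new: "z r \<notin> poly_vs.span (gens r)"
    proof
      assume "z r \<in> poly_vs.span (gens r)"
      then have "coeff (z r) (M + r) = 0" by (rule coeff_0_on_span) (auto intro: gens_coeff)
      then show False using z[of r] by (metis leading_coeff_0_iff)
    qed
    have "poly_vs.span (insert (z r) I) \<subseteq> poly_vs.span (insert (z r) (gens r))"
    proof -
      have "insert (z r) I \<subseteq> poly_vs.span (insert (z r) (gens r))"
        using I(3) poly_vs.span_mono[of "gens r" "insert (z r) (gens r)"] poly_vs.span_base[of "z r" "insert (z r) (gens r)"]
        by auto
      from poly_vs.span_mono[OF this] show ?thesis by (simp add: poly_vs.span_span)
    qed
    then have b_new: "b \<notin> poly_vs.span (insert (z r) I)" using j(2) by (auto simp: b_def)
    have z_new': "z r \<notin> poly_vs.span I" using z_new spI by blast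
    have "poly_vs.independent (insert b (insert (z r) I))"
      using I(2) b_new z_new' by (intro poly_vs.independent_insertI)
    moreover have "card (insert b (insert (z r) I)) = 2 * Suc r"
    proof -
      have "z r \<notin> I" "b \<notin> insert (z r) I" using z_new' b_new poly_vs.span_base by blast+
      then show ?thesis using I by simp
    qed
    moreover have "insert b (insert (z r) I) \<subseteq> poly_vs.span (gens (Suc r))"
    proof -
      have "z r \<in> gens (Suc r)" "b \<in> gens (Suc r)" using j1 j by (auto simp: gens_def z_def b_def)
      then show ?thesis using I(3) poly_vs.span_mono[OF gens_mono[of r]] poly_vs.span_base by blast
    qed
    ultimately show ?case using I(1) by (intro exI[of _ "insert b (insert (z r) I)"]) simp
  qed
  have ex: "\<exists>r\<le>t. slow r"
  proof (rule ccontr)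
    assume "\<not> (\<exists>r\<le>t. slow r)"
    then have "\<forall>i<Suc t. \<not> slow i" by auto
    from growth[OF this] obtain I where "poly_vs.independent I" "I \<subseteq> poly_vs.span (gens (Suc t))" "card I = 2 * Suc t"
      by blast
    with upper[of I "Suc t"] show False by simp
  qed
  define s where "s = (LEAST r. slow r)"
  have s: "slow s" "s \<le> t"
    unfolding s_def using ex by (auto intro: LeastI Least_le order_trans)
  have before: "\<not> slow i" if "i < s" for i
    using that unfolding s_def by (rule not_less_Least)
  \<comment> \<open>From a slow step on, the orbit of \<open>\<eta> j1\<close> suffices, since the span of \<open>T\<close> is closed under the shift.\<close>
  define T where "T = gens s \<union> range (\<lambda>k. z (s + k))"
  have T_shift: "shift \<Delta> p \<in> poly_vs.span T" if "p \<in> poly_vs.span T" for p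
    using that
  proof (rule shift_span)
    show "T \<subseteq> poly_vs.span T" by (rule poly_vs.span_superset)
    fix q assume "q \<in> T"
    then consider "q \<in> gens s" | k where "q = z (s + k)" by (auto simp: T_def)
    then show "shift \<Delta> q \<in> poly_vs.span T"
    proof cases
      case 1
      then obtain j k where jk: "q = (shift \<Delta> ^^ k) (\<eta> j)" "j \<in> J" "k < s" unfolding gens_def by blast
      then have q: "shift \<Delta> q = (shift \<Delta> ^^ Suc k) (\<eta> j)" by simp
      show ?thesis
      proof (cases "Suc k = s")
        case True
        then have "shift \<Delta> q \<in> poly_vs.span (insert (z s) (gens s))" using s(1) jk(2) unfolding q slow_def by auto
        moreover have "insert (z s) (gens s) \<subseteq> T" by (auto simp: T_def intro: range_eqI[of _ _ 0])
        ultimately show ?thesis using poly_vs.span_mono by blast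
      next
        case False
        then have "Suc k < s" using jk(3) by simp
        then have "shift \<Delta> q \<in> gens s" using jk(2) unfolding q gens_def by blast
        then show ?thesis by (auto simp: T_def intro: poly_vs.span_base)
      qed
    next
      case 2
      then have "shift \<Delta> q = z (s + Suc k)" by (simp add: z_def)
      then show ?thesis unfolding T_def by (intro poly_vs.span_base) blast
    qed
  qed
  have \<eta>T: "\<eta> j \<in> poly_vs.span T" if "j \<in> J" for j
  proof (cases "s = 0")
    case True
    then have "\<eta> j \<in> poly_vs.span (insert (z s) (gens s))" using s(1) that by (auto simp: slow_def)
    moreover have "insert (z s) (gens s) \<subseteq> T" by (auto simp: T_def intro: range_eqI[of _ _ 0])
    ultimately show ?thesis using poly_vs.span_mono by blast
  next
    case False
    then have "\<eta> j \<in> gens s"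
      unfolding gens_def using that by (intro CollectI exI[of _ j] exI[of _ "0::nat"]) simp
    then show ?thesis by (auto simp: T_def intro: poly_vs.span_base)
  qed
  have "(orbits \<Delta> \<eta> J) \<subseteq> poly_vs.span T"
  proof clarify
    fix j k assume "j \<in> J"
    then show "(shift \<Delta> ^^ k) (\<eta> j) \<in> poly_vs.span T"
      by (induction k) (auto intro: \<eta>T T_shift)
  qed
  then have "\<Lambda> \<in> poly_vs.span T" using \<Lambda>\<eta> poly_vs.span_mono poly_vs.span_span by blast
  then have yT: "y i \<in> poly_vs.span T" for i by (induction i) (auto simp: y_def intro: T_shift)
  have yg: "y i \<in> poly_vs.span (gens s)" if "i < t + s" for i
  proof (rule span_peel[where D = "M + s" and z = "\<lambda>k. z (s + k)"])
    show "y i \<in> poly_vs.span (gens s \<union> range (\<lambda>k. z (s + k)))" using yT[of i] by (simp add: T_def)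
    show "coeff (y i) l = 0" if "l \<ge> M + s" for l
      using that \<open>i < t + s\<close> y(2)[of i] mM by (intro coeff_eq_0) (simp add: t_def)
  qed (auto simp: z intro: gens_coeff)
  obtain B0 where B0: "B0 \<subseteq> gens s" "poly_vs.independent B0" "gens s \<subseteq> poly_vs.span B0"
    using poly_vs.maximal_independent_subset[of "gens s"] by blast
  have "gens s = (\<lambda>(j, k). (shift \<Delta> ^^ k) (\<eta> j)) ` (J \<times> {..<s})" by (auto simp: gens_def)
  then have "finite (gens s)" using J by simp
  then have finB0: "finite B0" using B0(1) finite_subset by blast
  have "y ` {..<t + s} \<subseteq> poly_vs.span B0"
    using yg poly_vs.span_mono[OF B0(3)] by (auto simp: poly_vs.span_span)
  then have cardB0: "t + s \<le> card B0"
    using poly_vs.independent_span_bound[OF finB0, of "y ` {..<t + s}"] independent_by_degree[of y m "t + s"] y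
    by auto
  show ?thesis
  proof (cases "s = 0")
    case True
    then have "B0 = {}" using B0(1) by (auto simp: gens_def)
    then have "t = 0" using cardB0 by simp
    then have "M = m" using mM by (simp add: t_def)
    have "poly_vs.independent {\<eta> j1}" using nz[OF j1(1)] by (simp add: poly_vs.dependent_single)
    moreover have "{\<eta> j1} \<subseteq> {(shift \<Delta> ^^ k) (\<eta> j) |j k. j \<in> J \<and> k \<le> 0}"
      using j1(1) by (auto intro: exI[of _ j1])
    ultimately show ?thesis
      using \<open>M = m\<close> by (intro exI[of _ 0] exI[of _ 1] exI[of _ "{\<eta> j1}"]) (auto simp: m_def)
  next
    case False
    then have "\<not> slow 0" using before by simp
    then obtain j2 where j2: "j2 \<in> J" "\<eta> j2 \<notin> poly_vs.span (insert (z 0) (gens 0))" by (auto simp: slow_def)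
    then have "j2 \<noteq> j1" using poly_vs.span_base[of "z 0" "insert (z 0) (gens 0)"] by (auto simp: z_def)
    then have "card {j1, j2} = 2" by simp
    then have J2: "card J \<ge> 2" using J j1 j2 card_mono[of J "{j1, j2}"] by simp
    obtain B where B: "B \<subseteq> B0" "card B = t + s" using cardB0 by (metis obtain_subset_with_card_n)
    have "B \<subseteq> {(shift \<Delta> ^^ k) (\<eta> j) |j k. j \<in> J \<and> k \<le> s - 1}"
      using B(1) B0(1) unfolding gens_def by fastforce
    moreover have "poly_vs.independent B" using B(1) B0(2) poly_vs.independent_mono by blast
    moreover have "finite B" using B(1) finB0 finite_subset by blast
    moreover have "M + (s - 1) + 1 = degree \<Lambda> + (t + s)" using False mM by (simp add: t_def m_def)
    moreover have "M + (s - 1) + 1 \<le> 2 * M" using False s(2) by (simp add: t_def)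
    moreover have "t + s \<le> 2 * M" using s(2) by (simp add: t_def)
    moreover have "t + s \<ge> 1" using False by simp
    ultimately show ?thesis using B(2) J2
      by (intro exI[of _ "s - 1"] exI[of _ "t + s"] exI[of _ B]) blast
  qed
qed

end

section \<open>The degree of a generator\<close>

context transcendental_extension
begin

definition adjoin :: "'b set \<Rightarrow> 'b set" where
  "adjoin S = \<Inter> {K. differential_subfield \<Delta> K \<and> F \<subseteq> K \<and> S \<subseteq> K}"

lemma adjoin_least: "differential_subfield \<Delta> K \<Longrightarrow> F \<subseteq> K \<Longrightarrow> S \<subseteq> K \<Longrightarrow> adjoin S \<subseteq> K"
  by (auto simp: adjoin_def)

lemma adjoin_differential_subfield: "differential_subfield \<Delta> (adjoin S)"
  by (auto simp: adjoin_def differential_subfield_def)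

lemma adjoin_superset: "F \<subseteq> adjoin S" "S \<subseteq> adjoin S"
  by (auto simp: adjoin_def)

lemma shift_submodule_span:
  "shift_submodule (poly_vs.span (orbits \<Delta> \<eta> J))"
  unfolding shift_submodule_def
  by (intro conjI ballI allI poly_vs.span_zero poly_vs.span_add poly_vs.span_scale shift_span_range[OF der])

lemma differential_in_span_of_adjoin:
  assumes "S \<subseteq> L" "\<And>s. s \<in> S \<Longrightarrow> differential s \<in> poly_vs.span (orbits \<Delta> \<eta> J)"
    and "x \<in> adjoin S"
  shows "x \<in> L \<and> differential x \<in> poly_vs.span (orbits \<Delta> \<eta> J)"
  using adjoin_least[OF differential_subfield_of_submodule[OF shift_submodule_span[of \<eta> J]], of S] assms
  by blast

lemma degree_differential_le:
  assumes "frac_of p q x" "p \<in> polys F {..e}" "q \<in> polys F {..e}"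
  shows "degree (differential x) \<le> e"
proof (rule degree_le, intro allI impI)
  fix i assume "e < i"
  then have "partial i p = 0" "partial i q = 0"
    using polys_vars[OF assms(2)] polys_vars[OF assms(3)] by (auto intro!: partial_eq_0)
  then have "E q * coeff (differential x) i = 0"
    using coeff_differential_eq[OF assms(1), of i] by (simp add: coeff_gradient eval_at_simps)
  then show "coeff (differential x) i = 0" using frac_of_nz[OF assms(1)] by simp
qed

lemma differential_constant_degree:
  assumes "frac_of p q x" "total_degree p = 0" "total_degree q = 0"
  shows "differential x = 0"
proof (rule poly_eqI)
  fix i
  have "partial i p = 0" "partial i q = 0"
    using total_degree_partial_less[of i p] total_degree_partial_less[of i q] assms by auto
  then have "E q * coeff (differential x) i = 0"
    using coeff_differential_eq[OF assms(1), of i] by (simp add: coeff_gradient eval_at_simps)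
  then show "coeff (differential x) i = coeff 0 i" using frac_of_nz[OF assms(1)] by simp
qed

text \<open>
  The degree of \<open>differential v\<close> is the order of \<open>v\<close>.  The representations of the \<open>\<alpha> j\<close> are first replaced by
  ones in the variables \<open>y\<^sub>0, \<dots>, y\<^sub>M\<close>, where \<open>M\<close> is the largest order of an \<open>\<alpha> j\<close>, because the rank
  computed from the operators has to be compared with the number of variables that occur.
\<close>

theorem generator_bound:
  fixes P Q :: "'j \<Rightarrow> 'b diff_poly" and \<alpha> :: "'j \<Rightarrow> 'b"
  assumes J: "finite J" "J \<noteq> {}"
    and fr: "\<And>j. j \<in> J \<Longrightarrow> frac_of (P j) (Q j) (\<alpha> j)"
    and ord: "\<And>j. j \<in> J \<Longrightarrow> P j \<in> polys F {..e} \<and> Q j \<in> polys F {..e}"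
    and deg: "\<And>j. j \<in> J \<Longrightarrow> total_degree (P j) \<le> d \<and> total_degree (Q j) \<le> d"
    and nonconst: "\<And>j. j \<in> J \<Longrightarrow> \<alpha> j \<notin> F"
    and vG: "v \<in> adjoin (\<alpha> ` J)" and G: "adjoin (\<alpha> ` J) = adjoin {v}"
  shows "\<exists>p q N c. frac_of p q v \<and> p \<in> polys F {..degree (differential v)} \<and> q \<in> polys F {..degree (differential v)}
      \<and> total_degree p \<le> (N + 1) * d ^ c \<and> total_degree q \<le> (N + 1) * d ^ c
      \<and> (N = degree (differential v) + 1 \<and> c = 1 \<or> card J \<ge> 2 \<and> N \<le> 2 * e \<and> c \<le> 2 * e)"
    and "d \<ge> 1" and "degree (differential v) \<le> e"
    and "\<And>j. j \<in> J \<Longrightarrow> differential (\<alpha> j) \<noteq> 0 \<and> degree (differential v) \<le> degree (differential (\<alpha> j))"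
proof -
  define \<Lambda> where "\<Lambda> = differential v"
  define m where "m = degree \<Lambda>"
  have \<alpha>L: "\<alpha> j \<in> L" if "j \<in> J" for j using fr[OF that] L_iff by blast
  have nz: "differential (\<alpha> j) \<noteq> 0" if "j \<in> J" for j
    using differential_eq_0_imp[OF \<alpha>L[OF that]] nonconst[OF that] by blast
  obtain j0 where j0: "j0 \<in> J" using J by blast
  show d: "d \<ge> 1"
  proof (rule ccontr)
    assume "\<not> d \<ge> 1"
    then have "total_degree (P j0) = 0" "total_degree (Q j0) = 0" using deg[OF j0] by auto
    then show False using differential_constant_degree[OF fr[OF j0]] nz[OF j0] by blast
  qed
  have vL: "v \<in> L"
    using vG adjoin_least[OF fractions_differential_subfield[of u] fractions_base(1)] \<alpha>L by blast
  have \<alpha>\<Lambda>: "differential (\<alpha> j) \<in> poly_vs.span (range (\<lambda>k. (shift \<Delta> ^^ k) \<Lambda>))" if "j \<in> J" for j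
  proof -
    have eq: "{(shift \<Delta> ^^ k) \<Lambda> |(j::unit) k. j \<in> {()}} = range (\<lambda>k. (shift \<Delta> ^^ k) \<Lambda>)" by auto
    have "\<alpha> j \<in> adjoin {v}" using adjoin_superset(2) that G by blast
    moreover have "differential v \<in> poly_vs.span (range (\<lambda>k. (shift \<Delta> ^^ k) \<Lambda>))"
      by (rule poly_vs.span_base, rule range_eqI[of _ _ 0]) (simp add: \<Lambda>_def)
    ultimately have "\<alpha> j \<in> L \<and> differential (\<alpha> j) \<in> poly_vs.span (range (\<lambda>k. (shift \<Delta> ^^ k) \<Lambda>))"
      using vL by (intro differential_in_span_of_adjoin[of "{v}" "\<lambda>_. \<Lambda>" "{()}", unfolded eq]) auto
    then show ?thesis ..
  qed
  have \<Lambda>0: "\<Lambda> \<noteq> 0"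
  proof
    assume "\<Lambda> = 0"
    then have "(shift \<Delta> ^^ k) \<Lambda> = 0" for k by (induction k) (simp_all add: shift_0[OF der])
    then have "differential (\<alpha> j0) \<in> poly_vs.span {0}" using \<alpha>\<Lambda>[OF j0] by simp
    then show False using nz[OF j0] by (simp add: poly_vs.span_insert_0)
  qed
  have sh\<Lambda>: "degree ((shift \<Delta> ^^ k) \<Lambda>) = m + k" "(shift \<Delta> ^^ k) \<Lambda> \<noteq> 0" for k
    using degree_shift_funpow[OF der \<Lambda>0, of k] by (simp_all add: m_def)
  have m_le: "m \<le> degree (differential (\<alpha> j))" if "j \<in> J" for j
  proof (rule ccontr)
    assume "\<not> m \<le> degree (differential (\<alpha> j))"
    then have "coeff (differential (\<alpha> j)) i = 0" if "i \<ge> m" for i using that by (intro coeff_eq_0) simp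
    then have "differential (\<alpha> j) \<in> poly_vs.span {}"
      by (rule span_peel[where D = m and z = "\<lambda>k. (shift \<Delta> ^^ k) \<Lambda>", rotated])
        (use \<alpha>\<Lambda>[OF that] sh\<Lambda> in auto)
    then show False using nz[OF that] by simp
  qed
  have \<alpha>e: "degree (differential (\<alpha> j)) \<le> e" if "j \<in> J" for j
    using degree_differential_le[OF fr[OF that]] ord[OF that] by blast
  show "degree (differential v) \<le> e" using m_le[OF j0] \<alpha>e[OF j0] by (simp add: m_def \<Lambda>_def)
  show "differential (\<alpha> j) \<noteq> 0 \<and> degree (differential v) \<le> degree (differential (\<alpha> j))" if "j \<in> J" for j
    using nz[OF that] m_le[OF that] by (simp add: m_def \<Lambda>_def)
  define M where "M = Max ((\<lambda>j. degree (differential (\<alpha> j))) ` J)"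
  have M: "degree (differential (\<alpha> j)) \<le> M" if "j \<in> J" for j
    unfolding M_def using J that by (intro Max_ge) auto
  have Me: "M \<le> e" unfolding M_def using J \<alpha>e by (subst Max_le_iff) auto
  \<comment> \<open>Representations of the \<open>\<alpha> j\<close> in the variables up to their largest order \<open>M\<close>.\<close>
  have "\<exists>p q. frac_of p q (\<alpha> j) \<and> total_degree p \<le> d \<and> total_degree q \<le> d
      \<and> p \<in> polys F (- {M<..}) \<and> q \<in> polys F (- {M<..})" if "j \<in> J" for j
    using fr[OF that] deg[OF that] M[OF that]
    by (intro bounded_representation[of "P j" "Q j"]) (auto intro: coeff_eq_0)
  then obtain P' Q' where PQ: "\<And>j. j \<in> J \<Longrightarrow> frac_of (P' j) (Q' j) (\<alpha> j)
      \<and> total_degree (P' j) \<le> d \<and> total_degree (Q' j) \<le> d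
      \<and> P' j \<in> polys F (- {M<..}) \<and> Q' j \<in> polys F (- {M<..})"
    by metis
  define K where "K = adjoin {v}"
  have K: "differential_subfield \<Delta> K" "F \<subseteq> K" "\<And>j. j \<in> J \<Longrightarrow> \<alpha> j \<in> K"
    using adjoin_differential_subfield adjoin_superset(1)[of "{v}"] adjoin_superset(2)[of "\<alpha> ` J"] G
    by (auto simp: K_def)
  have Ksf: "subfield K" by (rule subfield_of_differential[OF K(1)])
  note Ksr = subfieldD(1)[OF Ksf]
  have K\<Delta>: "\<Delta> x \<in> K" if "x \<in> K" for x using K(1) that by (auto simp: differential_subfield_def)
  \<comment> \<open>These equations have coefficients in the generated field and hold at \<open>u\<close>.\<close>
  define f where "f j = P' j - Const (\<alpha> j) * Q' j" for j
  have fK: "f j \<in> polys K {..<M + 1}" if "j \<in> J" for j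
  proof -
    have eq: "- {M<..} = {..<M + 1}" by auto
    have "P' j \<in> polys K {..<M + 1}" "Q' j \<in> polys K {..<M + 1}"
      using PQ[OF that] polys_mono[OF K(2), of "{..<M + 1}" "{..<M + 1}"] unfolding eq by blast+
    then show ?thesis
      unfolding f_def using K(3)[OF that]
      by (intro subringD(4)[OF subring_polys[OF Ksr]] subringD(5)[OF subring_polys[OF Ksr]] polys_Const)
  qed
  have fd: "total_degree (f j) \<le> d" if "j \<in> J" for j
  proof -
    have "total_degree (Const (\<alpha> j)) = 0" by (simp add: total_degree_def Const_def)
    then show ?thesis
      unfolding f_def
      using PQ[OF that] total_degree_mult_le[of "Const (\<alpha> j)" "Q' j"]
      by (intro total_degree_diff_le) auto
  qed
  have f0: "E (f j) = 0" if "j \<in> J" for j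
    using PQ[OF that] by (simp add: f_def eval_at_simps frac_of_def mult.commute)
  define \<eta> where "\<eta> j = gr (f j)" for j
  have \<eta>: "\<eta> j = smult (E (Q' j)) (differential (\<alpha> j))" if "j \<in> J" for j
  proof (rule poly_eqI)
    fix i
    have "coeff (\<eta> j) i = coeff (gr (P' j)) i - \<alpha> j * coeff (gr (Q' j)) i"
      by (simp add: \<eta>_def f_def coeff_gradient partial_diff partial_mult eval_at_simps)
    then show "coeff (\<eta> j) i = coeff (smult (E (Q' j)) (differential (\<alpha> j))) i"
      using coeff_differential_eq[of "P' j" "Q' j" "\<alpha> j" i] PQ[OF that] by simp
  qed
  have Q0: "E (Q' j) \<noteq> 0" if "j \<in> J" for j using PQ[OF that] frac_of_nz by blast
  have \<eta>nz: "\<eta> j \<noteq> 0" if "j \<in> J" for j using \<eta>[OF that] nz[OF that] Q0[OF that] by simp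
  have \<eta>\<Lambda>: "\<eta> j \<in> poly_vs.span (range (\<lambda>k. (shift \<Delta> ^^ k) \<Lambda>))" if "j \<in> J" for j
    unfolding \<eta>[OF that] using \<alpha>\<Lambda>[OF that] by (rule poly_vs.span_scale)
  have \<Lambda>\<eta>: "\<Lambda> \<in> poly_vs.span (orbits \<Delta> \<eta> J)"
  proof -
    have "differential (\<alpha> j) \<in> poly_vs.span (orbits \<Delta> \<eta> J)" if "j \<in> J" for j
    proof -
      have "\<eta> j \<in> (orbits \<Delta> \<eta> J)"
        using that by (intro CollectI exI[of _ j] exI[of _ "0::nat"]) simp
      then have "smult (inverse (E (Q' j))) (\<eta> j) \<in> poly_vs.span (orbits \<Delta> \<eta> J)"
        by (intro poly_vs.span_scale poly_vs.span_base)
      then show ?thesis using Q0[OF that] by (simp add: \<eta>[OF that])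
    qed
    then show ?thesis
      using differential_in_span_of_adjoin[OF _ _ vG, of \<eta> J] \<alpha>L unfolding \<Lambda>_def by blast
  qed
  have M\<eta>: "M = Max ((\<lambda>j. degree (\<eta> j)) ` J)"
    unfolding M_def using \<eta> Q0 by (intro arg_cong[where f = Max] image_cong refl) simp
  obtain s c B where B: "B \<subseteq> {(shift \<Delta> ^^ k) (\<eta> j) |j k. j \<in> J \<and> k \<le> s}" "poly_vs.independent B"
      "finite B" "card B = c" "M + s + 1 = m + c" "c \<ge> 1"
      "s = 0 \<and> c = 1 \<or> card J \<ge> 2 \<and> M + s + 1 \<le> 2 * M \<and> c \<le> 2 * M"
    using prolonged_rank[OF der J \<eta>nz \<Lambda>0 \<eta>\<Lambda> \<Lambda>\<eta> M\<eta>] unfolding m_def by blast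
  define N where "N = M + s + 1"
  obtain b where b: "bij_betw b {..<c} B"
    using B(4) ex_bij_betw_nat_finite[OF B(3)] by (auto simp: atLeast0LessThan)
  have "\<exists>j k. j \<in> J \<and> k \<le> s \<and> b i = (shift \<Delta> ^^ k) (\<eta> j)" if "i < c" for i
    using bij_betwE[OF b] that B(1) by blast
  then obtain jj kk where jk: "\<And>i. i < c \<Longrightarrow> jj i \<in> J \<and> kk i \<le> s \<and> b i = (shift \<Delta> ^^ kk i) (\<eta> (jj i))"
    by metis
  define g where "g i = (total_deriv \<Delta> ^^ kk i) (f (jj i))" for i
  have pr: "(total_deriv \<Delta> ^^ k) (f j) \<in> polys K {..<M + 1 + k}
      \<and> total_degree ((total_deriv \<Delta> ^^ k) (f j)) \<le> d \<and> E ((total_deriv \<Delta> ^^ k) (f j)) = 0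
      \<and> gr ((total_deriv \<Delta> ^^ k) (f j)) = (shift \<Delta> ^^ k) (\<eta> j)" if "j \<in> J" for j k
  proof (induction k)
    case 0
    then show ?case using fK fd f0 that by (simp add: \<eta>_def)
  next
    case (Suc k)
    then show ?case
      using total_deriv_polys[OF der Ksr K\<Delta>] total_degree_total_deriv[OF der]
      by (auto simp: eval_at_total_deriv[OF der] gradient_total_deriv[OF der] der_simps)
  qed
  have g: "g i \<in> polys K {..<N}" "total_degree (g i) \<le> d" "E (g i) = 0" "gr (g i) = b i" if "i < c" for i
  proof -
    have "polys K {..<M + 1 + kk i} \<subseteq> polys K {..<N}"
      using jk[OF that] by (intro polys_mono) (auto simp: N_def)
    then show "g i \<in> polys K {..<N}" using pr[of "jj i" "kk i"] jk[OF that] by (auto simp: g_def)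
    show "total_degree (g i) \<le> d" "E (g i) = 0" "gr (g i) = b i"
      using pr[of "jj i" "kk i"] jk[OF that] by (auto simp: g_def)
  qed
  have rank: "\<exists>w. \<forall>i<c. (\<Sum>x<N. w x * E (partial x (g i))) = l i" for l
  proof -
    have inj: "inj_on b {..<c}" and im: "b ` {..<c} = B" using b by (auto simp: bij_betw_def)
    have "degree (b i) < N" if "i \<in> {..<c}" for i
    proof -
      have "i < c" using that by simp
      note jki = jk[OF this]
      have "degree (\<eta> (jj i)) \<le> M" using jki M \<eta> Q0 by simp
      then show ?thesis
        using degree_shift_funpow[OF der \<eta>nz, of "jj i" "kk i"] jki by (simp add: N_def)
    qed
    from independent_functional[OF inj _ this, of l] obtain w
      where w: "\<forall>i\<in>{..<c}. (\<Sum>x<N. w x * coeff (b i) x) = l i"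
      using B(2) im by auto
    have "(\<Sum>x<N. w x * E (partial x (g i))) = l i" if "i < c" for i
      using w that g(4)[OF that] by (simp flip: coeff_gradient)
    then show ?thesis by blast
  qed
  have "\<exists>h\<in>polys K {..<m + 1}. h \<noteq> 0 \<and> total_degree h \<le> (N + 1) * d ^ c \<and> E h = 0"
    by (rule bounded_elimination[OF char0 Ksf d _ _ _ _ _ rank])
      (use B(5,6) g in \<open>auto simp: N_def\<close>)
  then obtain h where h: "h \<in> polys K {..<m + 1}" "h \<noteq> 0" "total_degree h \<le> (N + 1) * d ^ c" "E h = 0"
    by blast
  have "K \<subseteq> fractions v"
    unfolding K_def using fractions_differential_subfield fractions_base by (intro adjoin_least) auto
  then have hv: "h \<in> polys (fractions v) {..m}"
    using h(1) polys_mono[of K "fractions v" "{..<m + 1}" "{..m}"] by fastforce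
  obtain k a where a: "\<And>i. a i \<in> polys F {..m}" "\<And>i. total_degree (a i) \<le> (N + 1) * d ^ c"
    "\<exists>i\<le>k. a i \<noteq> 0" "(\<Sum>i\<le>k. v ^ i * E (a i)) = 0"
    using descend_to_powers[OF vL _ _ hv h(2,4,3)] \<Lambda>0 unfolding m_def \<Lambda>_def by blast
  obtain p q where "frac_of p q v" using vL L_iff by blast
  then obtain p q where pq: "frac_of p q v" "p \<in> polys F (- {m<..})" "q \<in> polys F (- {m<..})"
    using bounded_representation[of p q v "max (total_degree p) (total_degree q)" "{m<..}"]
    by (auto simp: m_def \<Lambda>_def coeff_eq_0)
  have eq: "- {m<..} = {..m}" by auto
  obtain i0 where i0: "i0 \<le> k" "a i0 \<noteq> 0" using a(3) by blast
  from representation_from_powers[OF pq(1) pq(2,3)[unfolded eq] a(1,2) i0 a(4)]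
  obtain p q where "frac_of p q v" "p \<in> polys F {..m}" "q \<in> polys F {..m}"
    "total_degree p \<le> (N + 1) * d ^ c" "total_degree q \<le> (N + 1) * d ^ c" by blast
  moreover have "N = m + 1 \<and> c = 1 \<or> card J \<ge> 2 \<and> N \<le> 2 * e \<and> c \<le> 2 * e"
    using B(5,7) Me by (auto simp: N_def)
  ultimately show "\<exists>p q N c. frac_of p q v \<and> p \<in> polys F {..degree (differential v)} \<and> q \<in> polys F {..degree (differential v)}
      \<and> total_degree p \<le> (N + 1) * d ^ c \<and> total_degree q \<le> (N + 1) * d ^ c
      \<and> (N = degree (differential v) + 1 \<and> c = 1 \<or> card J \<ge> 2 \<and> N \<le> 2 * e \<and> c \<le> 2 * e)"
    unfolding m_def \<Lambda>_def by blast
qed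

end

section \<open>Numerical estimates\<close>

lemma power_bound_small:
  fixes d e :: nat
  assumes "e \<ge> 1"
  shows "(e + 2) * d \<le> (d + 1) ^ (e + 1)"
  using assms
proof (induction e rule: dec_induct)
  case base
  have "d \<le> 1 + d * d" by (cases d) auto
  then show ?case by (simp add: power_add power2_eq_square algebra_simps)
next
  case (step e)
  have "(d + 1) ^ (e + 1) \<ge> 1" by simp
  then have "d * 1 \<le> d * (d + 1) ^ (e + 1)" by (rule mult_le_mono2)
  moreover have "(Suc e + 2) * d = (e + 2) * d + d * 1" by simp
  moreover have "(d + 1) ^ (Suc e + 1) = (d + 1) ^ (e + 1) + d * (d + 1) ^ (e + 1)"
    by (simp add: power_add algebra_simps)
  ultimately show ?case using step.IH by linarith
qed

lemma power_bound_large: "(k + 1) * d ^ k \<le> (d + 1) ^ (k + 1)" for d k :: nat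
proof (induction k)
  case (Suc k)
  have "d ^ Suc k \<le> (d + 1) ^ Suc k" by (rule power_mono) auto
  moreover have "d * ((k + 1) * d ^ k) \<le> d * (d + 1) ^ (k + 1)" using Suc by (rule mult_le_mono2)
  moreover have "(Suc k + 1) * d ^ Suc k = d * ((k + 1) * d ^ k) + d ^ Suc k"
    by (simp add: algebra_simps)
  moreover have "(d + 1) ^ (Suc k + 1) = d * (d + 1) ^ (k + 1) + (d + 1) ^ Suc k"
    by (simp add: power_add algebra_simps)
  ultimately show ?case by linarith
qed simp

text \<open>
  The first alternative may occur with \<open>n = 1\<close>, where the bounds are smallest; in the second one the
  factor \<open>2 e + 1\<close> is absorbed by one further factor of the power.
\<close>

lemma degree_bound_numeric:
  fixes d e n N c :: nat
  assumes "d \<ge> 1" "e \<ge> 1" "n \<ge> 1" and N: "N \<le> e + 1 \<and> c = 1 \<or> n \<ge> 2 \<and> N \<le> 2 * e \<and> c \<le> 2 * e"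
  shows "(N + 1) * d ^ c \<le> min ((d + 1) ^ ((e + 1) * n)) ((n * d * (e + 1) + 1) ^ (2 * e + 1))"
  using N
proof
  assume *: "N \<le> e + 1 \<and> c = 1"
  then have "N + 1 \<le> e + 2" by simp
  then have "(N + 1) * d \<le> (e + 2) * d" by (rule mult_le_mono1)
  then have "(N + 1) * d ^ c \<le> (e + 2) * d" using * by simp
  moreover have "(d + 1) ^ (e + 1) \<le> (d + 1) ^ ((e + 1) * n)"
    using assms(3) by (intro power_increasing) auto
  moreover have "(e + 2) * d \<le> (n * d * (e + 1) + 1) ^ (2 * e + 1)"
  proof -
    define x where "x = n * d * (e + 1) + 1"
    have x: "d * (e + 1) + 1 \<le> x" using assms(3) by (simp add: x_def)
    have "(e + 2) * d \<le> 2 * (d * (e + 1))" by (simp add: algebra_simps)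
    also have "2 * y \<le> (y + 1) ^ 2" for y :: nat by (simp add: power2_eq_square algebra_simps)
    then have "2 * (d * (e + 1)) \<le> (d * (e + 1) + 1) ^ 2" .
    also have "\<dots> \<le> x ^ 2" using x by (rule power_mono) simp
    also have "\<dots> \<le> x ^ (2 * e + 1)" using assms(2) by (intro power_increasing) (auto simp: x_def)
    finally show ?thesis by (simp add: x_def)
  qed
  ultimately show ?thesis using power_bound_small[OF assms(2), of d] by linarith
next
  assume *: "n \<ge> 2 \<and> N \<le> 2 * e \<and> c \<le> 2 * e"
  have "d ^ c \<le> d ^ (2 * e)" using * assms(1) by (intro power_increasing) auto
  then have le: "(N + 1) * d ^ c \<le> (2 * e + 1) * d ^ (2 * e)" using * by (intro mult_le_mono) auto
  have "2 * e + 1 \<le> (e + 1) * n"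
    using mult_le_mono2[of 2 n "e + 1"] * by simp
  then have "(d + 1) ^ (2 * e + 1) \<le> (d + 1) ^ ((e + 1) * n)"
    by (intro power_increasing) auto
  then have 1: "(N + 1) * d ^ c \<le> (d + 1) ^ ((e + 1) * n)"
    using le power_bound_large[of "2 * e" d] by linarith
  define x where "x = n * d * (e + 1) + 1"
  have "2 * 1 * (e + 1) + 1 \<le> x" unfolding x_def using * assms(1) by (intro add_right_mono mult_le_mono) auto
  moreover have "1 * d * 1 \<le> n * d * (e + 1)" using * by (intro mult_le_mono) auto
  then have "d \<le> x" unfolding x_def by linarith
  then have "d ^ (2 * e) \<le> x ^ (2 * e)" by (rule power_mono) simp
  ultimately have "(2 * e + 1) * d ^ (2 * e) \<le> x * x ^ (2 * e)" by (intro mult_le_mono) auto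
  then have 2: "(2 * e + 1) * d ^ (2 * e) \<le> x ^ (2 * e + 1)" by (simp add: power_add mult.commute)
  show ?thesis
    unfolding x_def[symmetric] using le 1 2 by (intro min.boundedI) linarith+
qed

section \<open>Coefficients in the base field\<close>

definition embed :: "('a::zero \<Rightarrow> 'b::zero) \<Rightarrow> 'a diff_poly \<Rightarrow> 'b diff_poly" where
  "embed \<iota> p = Poly_Mapping.map \<iota> p"

context
  fixes \<iota> :: "'a::field \<Rightarrow> 'b::field"
  assumes hom: "ring_map \<iota>"
begin

lemma hom_eq_0_iff: "\<iota> x = 0 \<longleftrightarrow> x = 0"
proof
  assume *: "\<iota> x = 0"
  show "x = 0"
  proof (rule ccontr)
    assume "x \<noteq> 0"
    then have "\<iota> x * \<iota> (inverse x) = 1" by (simp flip: ring_mapD(3)[OF hom] add: ring_mapD(1)[OF hom])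
    with * show False by simp
  qed
qed (simp add: ring_mapD[OF hom])

lemma hom_inj: "inj \<iota>"
proof (rule injI)
  fix x y assume "\<iota> x = \<iota> y"
  then have "\<iota> (x - y) = 0" by (simp add: ring_mapD[OF hom])
  then show "x = y" by (simp add: hom_eq_0_iff)
qed

lemma hom_inverse: "\<iota> (inverse x) = inverse (\<iota> x)"
proof (cases "x = 0")
  case False
  then have "\<iota> x * \<iota> (inverse x) = 1" by (simp flip: ring_mapD(3)[OF hom] add: ring_mapD(1)[OF hom])
  then show ?thesis by (metis inverse_unique)
qed (simp add: ring_mapD[OF hom])

lemma lookup_embed: "lookup (embed \<iota> p) m = \<iota> (lookup p m)"
  by (simp add: embed_def map.rep_eq when_def ring_mapD[OF hom])

lemma keys_embed: "keys (embed \<iota> p) = keys p"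
  by (auto simp: in_keys_iff lookup_embed hom_eq_0_iff)

lemma total_degree_embed: "total_degree (embed \<iota> p) = total_degree p"
  by (simp add: total_degree_def keys_embed)

lemma diff_vars_embed: "diff_vars (embed \<iota> p) = diff_vars p"
  by (simp add: diff_vars_def keys_embed)

lemma embed_eq_0_iff: "embed \<iota> p = 0 \<longleftrightarrow> p = 0"
  using keys_embed[of p] by (metis keys_eq_empty)

lemma eval_at_embed: "eval_at \<xi> (embed \<iota> p) = poly_eval \<iota> \<xi> p"
  unfolding eval_at_def
  by (simp add: poly_eval_superset[of _ "keys p"] keys_embed lookup_embed ring_mapD[OF hom])

lemma embed_polys: "diff_vars p \<subseteq> X \<Longrightarrow> embed \<iota> p \<in> polys (range \<iota>) X"
  by (auto simp: polys_def keys_embed lookup_embed diff_vars_def)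

lemma polys_range_embed:
  assumes "p \<in> polys (range \<iota>) X"
  obtains p' where "p = embed \<iota> p'"
proof
  have inv0: "inv \<iota> 0 = 0" using inv_f_f[OF hom_inj, of 0] by (simp add: ring_mapD[OF hom])
  have "lookup p m \<in> range \<iota>" for m
    using polys_lookup[OF _ assms] ring_mapD(4)[OF hom] by (metis rangeI)
  then have "\<iota> (inv \<iota> (lookup p m)) = lookup p m" for m by (simp add: f_inv_into_f)
  then show "p = embed \<iota> (Poly_Mapping.map (inv \<iota>) p)"
    by (intro poly_mapping_eqI) (simp add: lookup_embed map.rep_eq when_def inv0 ring_mapD[OF hom])
qed

end

lemma total_degree_0_unit:
  fixes r :: "'a::field diff_poly"
  assumes "r \<noteq> 0" "total_degree r = 0"
  shows "r dvd 1"
proof -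
  have "m = 0" if "m \<in> keys r" for m
  proof -
    have "mdeg m = 0" using assms(2) that total_degree_le_iff[of r 0] by simp
    then show ?thesis using lookup_le_mdeg[of m] by (intro poly_mapping_eqI) simp
  qed
  then have r: "r = Const (lookup r 0)"
    by (intro poly_mapping_eqI) (auto simp: Const_def lookup_single when_def in_keys_iff)
  then have "lookup r 0 \<noteq> 0" using assms(1) by (metis Const_simps(2))
  then have "Const (lookup r 0) * Const (inverse (lookup r 0)) = 1"
    by (simp flip: Const_mult add: Const_1)
  then show ?thesis using r by (metis dvdI)
qed

text \<open>
  A representation with a denominator of least degree is reduced, since a common factor of positive degree
  could be cancelled; cancelling enlarges neither the variables nor the degrees.
\<close>

lemma reduce_representation:
  fixes p q :: "'a::field diff_poly" and \<iota> :: "'a \<Rightarrow> 'b::field"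
  assumes hom: "ring_map \<iota>" and tr: "differentially_transcendental \<Delta> \<iota> u"
    and "q \<noteq> 0" "x = diff_eval \<Delta> \<iota> u p / diff_eval \<Delta> \<iota> u q"
    and "diff_vars p \<subseteq> X" "diff_vars q \<subseteq> X" "total_degree p \<le> W" "total_degree q \<le> W"
  shows "\<exists>p q. reduced_representation \<Delta> \<iota> u x p q \<and> diff_vars p \<subseteq> X \<and> diff_vars q \<subseteq> X
    \<and> total_degree p \<le> W \<and> total_degree q \<le> W"
proof -
  define R where "R q \<longleftrightarrow> (\<exists>p. q \<noteq> 0 \<and> x = diff_eval \<Delta> \<iota> u p / diff_eval \<Delta> \<iota> u q \<and> diff_vars p \<subseteq> X
    \<and> diff_vars q \<subseteq> X \<and> total_degree p \<le> W \<and> total_degree q \<le> W)" for q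
  have "R q" unfolding R_def using assms(3-) by blast
  then obtain q where "R q" and min: "\<And>q'. R q' \<Longrightarrow> total_degree q \<le> total_degree q'"
    by (metis (full_types) arg_min_nat_lemma)
  then obtain p where pq: "q \<noteq> 0" "x = diff_eval \<Delta> \<iota> u p / diff_eval \<Delta> \<iota> u q" "diff_vars p \<subseteq> X"
    "diff_vars q \<subseteq> X" "total_degree p \<le> W" "total_degree q \<le> W" by (auto simp: R_def)
  have ev0: "diff_eval \<Delta> \<iota> u r \<noteq> 0" if "r \<noteq> 0" for r
    using tr that by (auto simp: differentially_transcendental_def algebraically_independent_def diff_eval_def)
  have "r dvd 1" if r: "r dvd p" "r dvd q" for r
  proof -
    obtain p' q' where p': "p = r * p'" and q': "q = r * q'" using r by (auto simp: dvd_def)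
    have nz: "r \<noteq> 0" "q' \<noteq> 0" using pq(1) q' by auto
    have "x = diff_eval \<Delta> \<iota> u p' / diff_eval \<Delta> \<iota> u q'"
      using pq(2) ev0[OF nz(1)] by (simp add: p' q' diff_eval_def poly_eval_mult[OF hom])
    moreover have "diff_vars p' \<subseteq> X \<and> total_degree p' \<le> W"
    proof (cases "p' = 0")
      case True
      then show ?thesis by (simp add: diff_vars_def total_degree_def)
    next
      case False
      then show ?thesis
        using pq(3,5) nz(1) unfolding p' by (simp add: diff_vars_factor total_degree_mult)
    qed
    moreover have "diff_vars q' \<subseteq> X" "total_degree q = total_degree r + total_degree q'"
      using pq(4) nz unfolding q' by (simp_all add: diff_vars_factor total_degree_mult)
    ultimately have "R q'" unfolding R_def using nz(2) pq(6) by auto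
    then have "total_degree r = 0" using min[of q'] \<open>total_degree q = _\<close> by simp
    then show ?thesis using total_degree_0_unit[OF nz(1)] by simp
  qed
  then have "reduced_representation \<Delta> \<iota> u x p q"
    using pq by (auto simp: reduced_representation_def relatively_prime_def)
  with pq show ?thesis by blast
qed

lemma diff_order_le_iff: "diff_order p \<le> n \<longleftrightarrow> diff_vars p \<subseteq> {..n}"
  by (auto simp: diff_order_def)

theorem theorem1:
  fixes \<delta> :: "'a::field_char_0 \<Rightarrow> 'a"
    and \<Delta> :: "'b::field \<Rightarrow> 'b"
    and \<iota> :: "'a \<Rightarrow> 'b"
    and u v :: 'b
    and P Q :: "nat \<Rightarrow> 'a diff_poly"
    and G :: "'b set"
    and n d e :: nat
  assumes "differential_extension \<delta> \<Delta> \<iota>"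
    and "differentially_transcendental \<Delta> \<iota> u"
    and "n \<ge> 1"
    and "e \<ge> 1"
    and "\<And>j. j \<in> {1..n} \<Longrightarrow> Q j \<noteq> 0"
    and "\<And>j. j \<in> {1..n} \<Longrightarrow> relatively_prime (P j) (Q j)"
    and "\<And>j. j \<in> {1..n} \<Longrightarrow> diff_order (P j) \<le> e \<and> diff_order (Q j) \<le> e"
    and "\<exists>j\<in>{1..n}. \<exists>i\<ge>1. i \<in> diff_vars (P j) \<union> diff_vars (Q j)"
    and "\<And>j. j \<in> {1..n} \<Longrightarrow> total_degree (P j) \<le> d \<and> total_degree (Q j) \<le> d"
    and "\<And>j. j \<in> {1..n} \<Longrightarrow> diff_eval \<Delta> \<iota> u (P j) / diff_eval \<Delta> \<iota> u (Q j) \<notin> range \<iota>"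
    and "G = diff_field_adjoin \<Delta> \<iota>
               ((\<lambda>j. diff_eval \<Delta> \<iota> u (P j) / diff_eval \<Delta> \<iota> u (Q j)) ` {1..n})"
    and "v \<in> G"
    and "G = diff_field_adjoin \<Delta> \<iota> {v}"
  shows "\<exists>p q. reduced_representation \<Delta> \<iota> u v p q \<and>
           (let N = Min ((\<lambda>j. element_order \<Delta> \<iota> u
                               (diff_eval \<Delta> \<iota> u (P j) / diff_eval \<Delta> \<iota> u (Q j))) ` {1..n});
                D = min ((d + 1) ^ ((e + 1) * n)) ((n * d * (e + 1) + 1) ^ (2 * e + 1))
            in diff_order p \<le> N \<and> diff_order q \<le> N \<and> total_degree p \<le> D \<and> total_degree q \<le> D)"
proof -
  have hom: "ring_map \<iota>" and der: "is_derivation \<Delta>" and \<iota>\<delta>: "\<And>x. \<Delta> (\<iota> x) = \<iota> (\<delta> x)"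
    using assms(1) by (auto simp: differential_extension_def ring_map_def)
  have ev0: "diff_eval \<Delta> \<iota> u r \<noteq> 0" if "r \<noteq> 0" for r
    using assms(2) that
    by (auto simp: differentially_transcendental_def algebraically_independent_def diff_eval_def)
  interpret transcendental_extension \<Delta> "range \<iota>" u
  proof
    show "is_derivation \<Delta>" by (rule der)
    show "differential_subfield \<Delta> (range \<iota>)"
      unfolding differential_subfield_def
      using ring_mapD[OF hom] hom_inverse[OF hom] \<iota>\<delta> by (auto simp: image_iff) (metis)+
    have "\<iota> (of_nat k) = of_nat k" for k by (rule ring_map_of_nat[OF hom])
    then show "inj (of_nat :: nat \<Rightarrow> 'b)"
      using hom_inj[OF hom] by (metis injD inj_onI of_nat_eq_iff)
  next
    fix p assume p: "p \<in> polys (range \<iota>) UNIV" "eval_at (\<lambda>i. (\<Delta> ^^ i) u) p = 0"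
    obtain p' where p': "p = embed \<iota> p'" using polys_range_embed[OF hom p(1)] .
    then have "diff_eval \<Delta> \<iota> u p' = 0" using p(2) by (simp add: eval_at_embed[OF hom] diff_eval_def)
    then have "p' = 0" using ev0 by blast
    then show "p = 0" by (simp add: p' embed_eq_0_iff[OF hom])
  qed
  have E_embed: "E (embed \<iota> r) = diff_eval \<Delta> \<iota> u r" for r
    by (simp add: eval_at_embed[OF hom] diff_eval_def)
  define \<alpha> where "\<alpha> j = diff_eval \<Delta> \<iota> u (P j) / diff_eval \<Delta> \<iota> u (Q j)" for j
  have frac_embed: "frac_of (embed \<iota> p) (embed \<iota> q) x"
    if "q \<noteq> 0" "x = diff_eval \<Delta> \<iota> u p / diff_eval \<Delta> \<iota> u q" for p q x
    using that ev0[OF that(1)] embed_polys[OF hom, of _ UNIV]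
    by (simp add: frac_of_def E_embed embed_eq_0_iff[OF hom])
  have ad: "diff_field_adjoin \<Delta> \<iota> S = adjoin S" for S by (simp add: diff_field_adjoin_def adjoin_def)
  have fr: "frac_of (embed \<iota> (P j)) (embed \<iota> (Q j)) (\<alpha> j)" if "j \<in> {1..n}" for j
    using frac_embed[OF assms(5)[OF that]] by (simp add: \<alpha>_def)
  have ord: "embed \<iota> (P j) \<in> polys (range \<iota>) {..e} \<and> embed \<iota> (Q j) \<in> polys (range \<iota>) {..e}"
    if "j \<in> {1..n}" for j
    using assms(7)[OF that] embed_polys[OF hom] by (simp add: diff_order_le_iff)
  have deg: "total_degree (embed \<iota> (P j)) \<le> d \<and> total_degree (embed \<iota> (Q j)) \<le> d" if "j \<in> {1..n}" for j
    using assms(9)[OF that] by (simp add: total_degree_embed[OF hom])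
  have nonconst: "\<alpha> j \<notin> range \<iota>" if "j \<in> {1..n}" for j using assms(10)[OF that] by (simp add: \<alpha>_def)
  have vG: "v \<in> adjoin (\<alpha> ` {1..n})" and G: "adjoin (\<alpha> ` {1..n}) = adjoin {v}"
    using assms(11-13) by (simp_all add: ad \<alpha>_def[abs_def])
  have fin: "finite {1..n}" "{1..n} \<noteq> {}" using assms(3) by auto
  note bound = generator_bound[of "{1..n}" "\<lambda>j. embed \<iota> (P j)" "\<lambda>j. embed \<iota> (Q j)" \<alpha> e d v,
      OF fin fr ord deg nonconst vG G]
  define m where "m = degree (differential v)"
  have order_ge: "m \<le> degree (differential (\<alpha> j))" if "j \<in> {1..n}" for j
    using bound(4) that unfolding m_def by blast
  define D where "D = min ((d + 1) ^ ((e + 1) * n)) ((n * d * (e + 1) + 1) ^ (2 * e + 1))"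
  define N where "N = Min ((\<lambda>j. element_order \<Delta> \<iota> u (\<alpha> j)) ` {1..n})"
  obtain p q k c where pq: "frac_of p q v" "p \<in> polys (range \<iota>) {..m}" "q \<in> polys (range \<iota>) {..m}"
      "total_degree p \<le> (k + 1) * d ^ c" "total_degree q \<le> (k + 1) * d ^ c"
      and kc: "k = m + 1 \<and> c = 1 \<or> card {1..n} \<ge> 2 \<and> k \<le> 2 * e \<and> c \<le> 2 * e"
    using bound(1) unfolding m_def by blast
  have "(k + 1) * d ^ c \<le> D"
    unfolding D_def using kc bound(2,3) assms(3,4)
    by (intro degree_bound_numeric) (auto simp: m_def)
  then have pqD: "total_degree p \<le> D" "total_degree q \<le> D" using pq by auto
  obtain p0 where p0: "p = embed \<iota> p0" using polys_range_embed[OF hom pq(2)] .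
  obtain q0 where q0: "q = embed \<iota> q0" using polys_range_embed[OF hom pq(3)] .
  have "q0 \<noteq> 0" "v = diff_eval \<Delta> \<iota> u p0 / diff_eval \<Delta> \<iota> u q0"
    using pq(1) frac_of_nz[OF pq(1)] by (auto simp: frac_of_def p0 q0 E_embed embed_eq_0_iff[OF hom] field_simps)
  moreover have "diff_vars p0 \<subseteq> {..m}" "diff_vars q0 \<subseteq> {..m}"
    using polys_vars[OF pq(2)] polys_vars[OF pq(3)] by (simp_all add: p0 q0 diff_vars_embed[OF hom])
  moreover have "total_degree p0 \<le> D" "total_degree q0 \<le> D"
    using pqD by (simp_all add: p0 q0 total_degree_embed[OF hom])
  ultimately obtain p q where red: "reduced_representation \<Delta> \<iota> u v p q" "diff_vars p \<subseteq> {..m}"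
      "diff_vars q \<subseteq> {..m}" "total_degree p \<le> D" "total_degree q \<le> D"
    using reduce_representation[OF hom assms(2)] by blast
  \<comment> \<open>Whichever reduced representation \<open>element_order\<close> refers to, it involves a variable of index at
    least the degree of \<open>differential (\<alpha> j)\<close>.\<close>
  have "m \<le> element_order \<Delta> \<iota> u (\<alpha> j)" if j: "j \<in> {1..n}" for j
  proof -
    have "\<exists>k p q. reduced_representation \<Delta> \<iota> u (\<alpha> j) p q \<and> k = max (diff_order p) (diff_order q)"
      using assms(5,6)[OF j] by (auto simp: reduced_representation_def \<alpha>_def)
    then have "\<exists>p q. reduced_representation \<Delta> \<iota> u (\<alpha> j) p q
        \<and> element_order \<Delta> \<iota> u (\<alpha> j) = max (diff_order p) (diff_order q)"
      unfolding element_order_def by (rule someI_ex)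
    then obtain p q where r: "reduced_representation \<Delta> \<iota> u (\<alpha> j) p q"
      "element_order \<Delta> \<iota> u (\<alpha> j) = max (diff_order p) (diff_order q)" by blast
    define K where "K = max (diff_order p) (diff_order q)"
    have "frac_of (embed \<iota> p) (embed \<iota> q) (\<alpha> j)"
      using r(1) by (intro frac_embed) (auto simp: reduced_representation_def)
    moreover have "diff_vars p \<subseteq> {..K}" "diff_vars q \<subseteq> {..K}"
      by (simp_all add: K_def flip: diff_order_le_iff)
    then have "embed \<iota> p \<in> polys (range \<iota>) {..K}" "embed \<iota> q \<in> polys (range \<iota>) {..K}"
      using embed_polys[OF hom] by blast+
    ultimately have "degree (differential (\<alpha> j)) \<le> K" by (rule degree_differential_le)
    then show ?thesis using order_ge[OF j] r(2) by (simp add: K_def)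
  qed
  then have "m \<le> N" unfolding N_def using fin by (subst Min_ge_iff) auto
  then have "diff_order p \<le> N" "diff_order q \<le> N"
    using red(2,3) by (auto simp: diff_order_le_iff)
  then show ?thesis
    using red unfolding Let_def N_def D_def \<alpha>_def by blast
qed

end
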